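(* Let $d\ge 1$, $\epsilon>0$, and let $\rho_0:\mathbb{T}^d\to[0,1]$ be an initial profile of class $C^{2+\epsilon}(\mathbb{T}^d)$ for which there exists a constant $\delta_0>0$ such that $\delta_0\le\rho_0(u)\le 1-\delta_0$ for all $u\in\mathbb{T}^d$. Let $(\mu^N)_N$ be a sequence of probability measures on $\chi_d^N=\{0,1\}^{\mathbb{T}_N^d}$ such that $$H(\mu^N/\nu^N_{\rho_0(\cdot)})=o(N^d)\quad\text{as } N\to\infty.$$ Let $(\eta_t)_{t\ge0}$ be the Markov process on $\chi_d^N$ with generator $\mathcal{L}_P$ and initial distribution $\mu^N$, and let $\pi^N_t(du)=\frac1{N^d}\sum_{x\in\mathbb{T}_N^d}\eta_{tN^2}(x)\,\delta_{x/N}(du)$. Then, for each $t\ge0$, $$\pi^N_t(du)\xrightarrow[N\to+\infty]{}\rho(t,u)\,du$$ in probability (for the weak topology on measures on $\mathbb{T}^d$), where $\rho(t,u)$ is the smooth solution of the porous medium equation $\partial_t\rho(t,u)=\Delta\big(\rho(t,u)^2\big)$ with $\rho(0,\cdot)=\rho_0(\cdot)$.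
   Context: $\mathbb{T}_N^d=\{0,1,\dots,N-1\}^d$ is the discrete $d$-dimensional torus (periodic boundary conditions) and $\mathbb{T}^d$ the continuous $d$-dimensional torus. A configuration is $\eta\in\chi_d^N=\{0,1\}^{\mathbb{T}_N^d}$; $\eta(x)=1$ means that site $x$ is occupied. $\eta^{x,y}$ is obtained from $\eta$ by exchanging the values $\eta(x)$ and $\eta(y)$. With $e_1,\dots,e_d$ the canonical basis, the exchange rates are $c(x,x+e_j,\eta)=c(x+e_j,x,\eta)=\eta(x-e_j)+\eta(x+2e_j)$. The generator $\mathcal{L}_P$ acts on functions $f:\chi_d^N\to\mathbb{R}$ by $$(\mathcal{L}_Pf)(\eta)=\sum_{x,y\in\mathbb{T}_N^d,\ |x-y|=1}c(x,y,\eta)\,\eta(x)(1-\eta(y))\,(f(\eta^{x,y})-f(\eta)),$$ where $|x-y|=\sum_i|x_i-y_i|$. $\nu^N_{\rho_0(\cdot)}$ is the product measure on $\chi_d^N$ with $\nu^N_{\rho_0(\cdot)}\{\eta:\eta(x)=1\}=\rho_0(x/N)$. The relative entropy of $\mu$ with respect to $\nu$ is $H(\mu/\nu)=\sup_f\{\int f\,d\mu-\log\int e^f\,d\nu\}$, the supremum being over all (continuous) functions $f$ on $\chi_d^N$. The smooth solution is the solution of class $C^{1+\epsilon,2+\epsilon}(\mathbb{R}_+\times\mathbb{T}^d)$ of the Cauchy problem, which exists for initial profiles of class $C^{2+\epsilon}(\mathbb{T}^d)$ satisfying $\delta_0\le\rho_0\le1-\delta_0$. *)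

theory Defs
  imports "HOL-Probability.Probability"
begin

section \<open>The discrete torus and the porous medium exclusion dynamics\<close>

definition sites :: "nat \<Rightarrow> (int ^ 'd) set" where
  "sites N = {x. \<forall>i. 0 \<le> x $ i \<and> x $ i < int N}"

definition translate :: "nat \<Rightarrow> int ^ 'd \<Rightarrow> int ^ 'd \<Rightarrow> int ^ 'd" where
  "translate N x v = (\<chi> i. (x $ i + v $ i) mod int N)"

text \<open>The length \<open>|x - y|\<close>, where the difference is taken with periodic boundary conditions.\<close>

definition site_dist :: "nat \<Rightarrow> int ^ 'd \<Rightarrow> int ^ 'd \<Rightarrow> int" where
  "site_dist N x y = (\<Sum>i\<in>UNIV. min ((x $ i - y $ i) mod int N) ((y $ i - x $ i) mod int N))"

text \<open>The two values 1 and 0 of an occupation variable are rendered by \<open>True\<close> and \<open>False\<close>;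
  \<open>of_bool\<close> turns them into numbers.\<close>

type_synonym 'd config = "(int, 'd) vec \<Rightarrow> bool"

definition configs :: "nat \<Rightarrow> 'd::finite config set" where
  "configs N = sites N \<rightarrow>\<^sub>E UNIV"

definition exchange :: "'d::finite config \<Rightarrow> int ^ 'd \<Rightarrow> int ^ 'd \<Rightarrow> 'd config" where
  "exchange \<eta> x y = \<eta>(x := \<eta> y, y := \<eta> x)"

definition bond_rate :: "nat \<Rightarrow> int ^ 'd \<Rightarrow> 'd \<Rightarrow> 'd::finite config \<Rightarrow> real" where
  "bond_rate N x j \<eta> =
     of_bool (\<eta> (translate N x (- axis j 1))) + of_bool (\<eta> (translate N x (axis j 2)))"

text \<open>The rate \<open>c(x, y, \<eta>)\<close>, for \<open>y = x + e\<^sub>j\<close> and for \<open>x = y + e\<^sub>j\<close>; see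
  \<open>exchange_rate_forward\<close> and \<open>exchange_rate_backward\<close> below.\<close>

definition exchange_rate :: "nat \<Rightarrow> int ^ 'd \<Rightarrow> int ^ 'd \<Rightarrow> 'd::finite config \<Rightarrow> real" where
  "exchange_rate N x y \<eta> =
     (if \<exists>j. y = translate N x (axis j 1)
      then bond_rate N x (THE j. y = translate N x (axis j 1)) \<eta>
      else if \<exists>j. x = translate N y (axis j 1)
      then bond_rate N y (THE j. x = translate N y (axis j 1)) \<eta>
      else 0)"

definition generator :: "nat \<Rightarrow> ('d::finite config \<Rightarrow> real) \<Rightarrow> 'd config \<Rightarrow> real" where
  "generator N f \<eta> =
     (\<Sum>(x, y) \<in> {(x, y) \<in> sites N \<times> sites N. site_dist N x y = 1}.
        exchange_rate N x y \<eta> * of_bool (\<eta> x) * (1 - of_bool (\<eta> y))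
          * (f (exchange \<eta> x y) - f \<eta>))"

lemma translate_axis_inj:
  fixes x :: "int ^ 'd"
  assumes "N \<ge> 2" "translate N x (axis i 1) = translate N x (axis j 1)"
  shows "i = j"
proof (rule ccontr)
  assume "i \<noteq> j"
  from assms(2) have "translate N x (axis i 1) $ i = translate N x (axis j 1) $ i" by simp
  with \<open>i \<noteq> j\<close> have "(x $ i + 1) mod int N = (x $ i) mod int N"
    by (simp add: translate_def axis_def)
  then have "int N dvd 1" by (simp add: mod_eq_dvd_iff)
  with assms(1) show False by simp
qed

lemma exchange_rate_forward:
  fixes x :: "int ^ 'd"
  assumes "N \<ge> 2"
  shows "exchange_rate N x (translate N x (axis j 1)) \<eta> = bond_rate N x j \<eta>"
proof -
  have "(THE i. translate N x (axis j 1) = translate N x (axis i 1)) = j"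
    by (rule the_equality) (auto dest: translate_axis_inj[OF assms])
  then show ?thesis by (auto simp: exchange_rate_def)
qed

lemma exchange_rate_backward:
  fixes x :: "int ^ 'd"
  assumes "N \<ge> 3"
  shows "exchange_rate N (translate N x (axis j 1)) x \<eta> = bond_rate N x j \<eta>"
proof -
  let ?y = "translate N x (axis j 1)"
  have no: "x \<noteq> translate N ?y (axis i 1)" for i
  proof
    assume "x = translate N ?y (axis i 1)"
    then have "x $ j = translate N ?y (axis i 1) $ j" by simp
    then have "x $ j = (x $ j + 1 + (if i = j then 1 else 0)) mod int N"
      by (simp add: translate_def axis_def mod_simps add.commute split: if_splits)
    then have "(x $ j + 1 + (if i = j then 1 else 0)) mod int N = x $ j mod int N"
      by (metis mod_mod_trivial)
    then have "int N dvd 1 + (if i = j then 1 else 0)"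
      by (metis mod_eq_dvd_iff add.assoc add_diff_cancel_left')
    then have "int N \<le> 1 + (if i = j then 1 else 0)" by (rule zdvd_imp_le) auto
    with assms show False by (auto split: if_splits)
  qed
  have "(THE i. ?y = translate N x (axis i 1)) = j"
    by (rule the_equality) (use assms in \<open>auto dest: translate_axis_inj[rotated]\<close>)
  with no show ?thesis by (auto simp: exchange_rate_def)
qed

section \<open>Markov processes on a finite state space\<close>

text \<open>The semigroup \<open>exp (t L)\<close>; on a finite state space the series converges for every
  generator \<open>L\<close>.\<close>

definition semigroup_of ::
  "(('s \<Rightarrow> real) \<Rightarrow> 's \<Rightarrow> real) \<Rightarrow> real \<Rightarrow> ('s \<Rightarrow> real) \<Rightarrow> 's \<Rightarrow> real" where
  "semigroup_of L t f \<eta> = (\<Sum>n. t ^ n / fact n * (L ^^ n) f \<eta>)"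

definition past :: "'w measure \<Rightarrow> (real \<Rightarrow> 'w \<Rightarrow> 's) \<Rightarrow> real \<Rightarrow> 'w measure" where
  "past M X s = sigma (space M) {X r -` A \<inter> space M | r A. 0 \<le> r \<and> r \<le> s}"

definition markov_process ::
  "'s set \<Rightarrow> (('s \<Rightarrow> real) \<Rightarrow> 's \<Rightarrow> real) \<Rightarrow> 's measure \<Rightarrow> 'w measure
     \<Rightarrow> (real \<Rightarrow> 'w \<Rightarrow> 's) \<Rightarrow> bool" where
  "markov_process S L \<mu> M X \<longleftrightarrow>
     prob_space M \<and>
     (\<forall>t\<ge>0. X t \<in> measurable M (count_space S)) \<and>
     distr M (count_space S) (X 0) = \<mu> \<and>
     (\<forall>s\<ge>0. \<forall>t\<ge>0. \<forall>f :: 's \<Rightarrow> real. AE \<omega> in M.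
        real_cond_exp M (past M X s) (\<lambda>\<omega>. f (X (s + t) \<omega>)) \<omega> = semigroup_of L t f (X s \<omega>))"

section \<open>Product measures and relative entropy\<close>

definition embed :: "nat \<Rightarrow> int ^ 'd \<Rightarrow> real ^ 'd" where
  "embed N x = (\<chi> i. of_int (x $ i) / of_nat N)"

definition product_bernoulli :: "nat \<Rightarrow> (real ^ 'd \<Rightarrow> real) \<Rightarrow> 'd::finite config measure" where
  "product_bernoulli N \<rho>\<^sub>0 =
     (\<Pi>\<^sub>M x\<in>sites N. measure_pmf (bernoulli_pmf (\<rho>\<^sub>0 (embed N x))))"

text \<open>Meant for measures on a finite set equipped with all its subsets, where every function is
  continuous, bounded and measurable.\<close>

definition rel_entropy :: "'s measure \<Rightarrow> 's measure \<Rightarrow> ereal" where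
  "rel_entropy \<mu> \<nu> =
     (SUP f :: 's \<Rightarrow> real. ereal ((\<integral>\<eta>. f \<eta> \<partial>\<mu>) - ln (\<integral>\<eta>. exp (f \<eta>) \<partial>\<nu>)))"

section \<open>Functions and measures on the continuous torus\<close>

text \<open>Functions on the torus are functions on \<open>real ^ 'd\<close> with period 1 in every coordinate.\<close>

definition torus_fun :: "(real ^ 'd \<Rightarrow> 'b) \<Rightarrow> bool" where
  "torus_fun f \<longleftrightarrow> (\<forall>u (k :: int ^ 'd). f (u + (\<chi> i. of_int (k $ i))) = f u)"

text \<open>Measures on the torus are Borel measures on its fundamental domain. The topology of the
  torus enters only through the continuous torus functions against which they are integrated.\<close>

definition unit_cube :: "(real ^ 'd) set" where
  "unit_cube = {u. \<forall>i. 0 \<le> u $ i \<and> u $ i < 1}"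

definition torus_measures :: "(real ^ 'd) measure set" where
  "torus_measures = {m. finite_measure m \<and> sets m = sets (restrict_space borel unit_cube)}"

definition weak_topology :: "(real ^ 'd) measure topology" where
  "weak_topology = topology_generated_by
     {{m \<in> torus_measures. (\<integral>u. G u \<partial>m) \<in> V} | (G :: real ^ 'd \<Rightarrow> real) V.
        continuous_on UNIV G \<and> torus_fun G \<and> open V}"

definition empirical_measure :: "nat \<Rightarrow> 'd::finite config \<Rightarrow> (real ^ 'd) measure" where
  "empirical_measure N \<eta> =
     distr (density (count_space (sites N)) (\<lambda>x. ennreal (of_bool (\<eta> x) / real N ^ CARD('d))))
       (restrict_space borel unit_cube) (embed N)"

definition measure_with_density :: "(real ^ 'd \<Rightarrow> real) \<Rightarrow> (real ^ 'd) measure" where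
  "measure_with_density r = density (restrict_space lborel unit_cube) (\<lambda>u. ennreal (r u))"

text \<open>Convergence in probability, to a deterministic limit, of random elements of a topological
  space that may be defined on different probability spaces. Measurability of the events is
  demanded since \<open>measure\<close> is 0 on non-measurable sets.\<close>

definition converges_in_probability ::
  "'e topology \<Rightarrow> (nat \<Rightarrow> 'w measure) \<Rightarrow> (nat \<Rightarrow> 'w \<Rightarrow> 'e) \<Rightarrow> 'e \<Rightarrow> bool" where
  "converges_in_probability T M Y y \<longleftrightarrow>
     y \<in> topspace T \<and>
     (\<forall>U. openin T U \<and> y \<in> U \<longrightarrow>
        (\<forall>\<^sub>F N in sequentially. {\<omega> \<in> space (M N). Y N \<omega> \<notin> U} \<in> sets (M N)) \<and>
        (\<lambda>N. measure (M N) {\<omega> \<in> space (M N). Y N \<omega> \<notin> U}) \<longlonglongrightarrow> 0)"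

section \<open>Hoelder classes and the porous medium equation\<close>

text \<open>All partial derivatives up to order \<open>k\<close> exist and are continuous, those of order \<open>k\<close> being
  Hoelder continuous with exponent \<open>\<alpha>\<close>. For \<open>\<alpha> = 0\<close> and a torus function the last condition is
  void.\<close>

primrec holder :: "nat \<Rightarrow> real \<Rightarrow> (real ^ 'd \<Rightarrow> real) \<Rightarrow> bool" where
  "holder 0 \<alpha> f \<longleftrightarrow>
     continuous_on UNIV f \<and> (\<exists>K. \<forall>u v. \<bar>f u - f v\<bar> \<le> K * dist u v powr \<alpha>)"
| "holder (Suc k) \<alpha> f \<longleftrightarrow>
     (\<exists>g. (\<forall>u. GDERIV f u :> g u) \<and> (\<forall>i. holder k \<alpha> (\<lambda>u. g u $ i)))"

definition holder_torus :: "real \<Rightarrow> (real ^ 'd \<Rightarrow> real) \<Rightarrow> bool" where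
  "holder_torus r f \<longleftrightarrow> torus_fun f \<and> holder (nat \<lfloor>r\<rfloor>) (frac r) f"

text \<open>The space-time analogue in the parabolic scaling, where a time derivative counts twice: all
  derivatives with a times in \<open>t\<close> and b times in \<open>u\<close>, \<open>2 a + b \<le> k\<close>, exist and are continuous up to
  \<open>t = 0\<close>, and those with \<open>2 a + b = k\<close> are Hoelder continuous, with exponent \<open>\<alpha>\<close> in \<open>u\<close> and
  \<open>\<alpha> / 2\<close> in \<open>t\<close>, on bounded time intervals. The exponent \<open>\<alpha>\<close> in \<open>t\<close> cannot be asked for: already
  for the heat equation it fails at \<open>t = 0\<close> for general initial data of the corresponding
  class.\<close>

fun parabolic_holder :: "nat \<Rightarrow> real \<Rightarrow> (real \<Rightarrow> real ^ 'd \<Rightarrow> real) \<Rightarrow> bool" where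
  "parabolic_holder 0 \<alpha> f \<longleftrightarrow>
     continuous_on ({0..} \<times> UNIV) (\<lambda>(t, u). f t u) \<and>
     (\<forall>T. \<exists>K. \<forall>s\<in>{0..T}. \<forall>t\<in>{0..T}. \<forall>u v.
        \<bar>f s u - f t v\<bar> \<le> K * (dist u v powr \<alpha> + \<bar>s - t\<bar> powr (\<alpha> / 2)))"
| "parabolic_holder (Suc 0) \<alpha> f \<longleftrightarrow>
     continuous_on ({0..} \<times> UNIV) (\<lambda>(t, u). f t u) \<and>
     (\<exists>g. (\<forall>t\<ge>0. \<forall>u. GDERIV (f t) u :> g t u) \<and>
          (\<forall>i. parabolic_holder 0 \<alpha> (\<lambda>t u. g t u $ i)))"
| "parabolic_holder (Suc (Suc k)) \<alpha> f \<longleftrightarrow>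
     continuous_on ({0..} \<times> UNIV) (\<lambda>(t, u). f t u) \<and>
     (\<exists>g. (\<forall>t\<ge>0. \<forall>u. GDERIV (f t) u :> g t u) \<and>
          (\<forall>i. parabolic_holder (Suc k) \<alpha> (\<lambda>t u. g t u $ i))) \<and>
     (\<exists>h. (\<forall>t\<ge>0. \<forall>u. ((\<lambda>s. f s u) has_real_derivative h t u) (at t within {0..})) \<and>
          parabolic_holder k \<alpha> h)"

text \<open>The class denoted by \<open>C\<close> with superscripts \<open>1 + \<epsilon>\<close> (time) and \<open>2 + \<epsilon>\<close> (space), read in the
  parabolic scaling. For \<open>\<epsilon> < 1\<close>: the first time derivative and the second space derivatives are
  Hoelder continuous with exponent \<open>\<epsilon>\<close> in space and \<open>\<epsilon> / 2\<close> in time.\<close>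

definition parabolic_holder_torus :: "real \<Rightarrow> (real \<Rightarrow> real ^ 'd \<Rightarrow> real) \<Rightarrow> bool" where
  "parabolic_holder_torus \<epsilon> f \<longleftrightarrow>
     (\<forall>t\<ge>0. torus_fun (f t)) \<and> parabolic_holder (nat \<lfloor>2 + \<epsilon>\<rfloor>) (frac (2 + \<epsilon>)) f"

definition partial_deriv :: "'d \<Rightarrow> (real ^ 'd \<Rightarrow> real) \<Rightarrow> real ^ 'd \<Rightarrow> real" where
  "partial_deriv i f u = deriv (\<lambda>s. f (u + s *\<^sub>R axis i 1)) 0"

definition laplacian :: "(real ^ 'd \<Rightarrow> real) \<Rightarrow> real ^ 'd \<Rightarrow> real" where
  "laplacian f u = (\<Sum>i\<in>UNIV. partial_deriv i (partial_deriv i f) u)"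

definition smooth_pme_solution ::
  "real \<Rightarrow> (real ^ 'd \<Rightarrow> real) \<Rightarrow> (real \<Rightarrow> real ^ 'd \<Rightarrow> real) \<Rightarrow> bool" where
  "smooth_pme_solution \<epsilon> \<rho>\<^sub>0 \<rho> \<longleftrightarrow>
     parabolic_holder_torus \<epsilon> \<rho> \<and>
     \<rho> 0 = \<rho>\<^sub>0 \<and>
     (\<forall>t\<ge>0. \<forall>u. ((\<lambda>s. \<rho> s u) has_real_derivative laplacian (\<lambda>v. (\<rho> t v)\<^sup>2) u)
        (at t within {0..}))"

end

(* Yau's relative entropy method. The entropy of the law at time t N^2 with respect to the
   product measure with density rho(t) is differentiated in time; its derivative is a space
   average of local functions minus the Dirichlet form. Since the model is of gradient type, and
   since the average vanishes under the reference measure itself, the constant terms cancel, the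
   terms linear in the occupation variables cancel by the porous medium equation, and there remain
   products of two or more centred occupation variables.

   These products are replaced by products of block averages. The rates are degenerate, but two
   adjacent particles form a mobile cluster that travels along a line and allows every exchange
   of its neighbours, so it suffices to reserve an auxiliary segment that contains a pair outside
   an event of exponentially small probability. As the rate of the bond (x, x + e_j) only looks
   at the line in direction j, one-dimensional blocks suffice in every dimension. The products of
   block averages are bounded by the entropy inequality, and Gronwall's lemma concludes. *)

theory Submission
  imports Defs "HOL-Real_Asymp.Real_Asymp"
begin

section \<open>The discrete torus and bond exchanges\<close>

text \<open>The order of the limits carries the argument. The block length \<open>q\<close> is fixed
  according to the required accuracy: the entropy inequality prices the block terms at about
  \<open>ln q / q\<close> per site, because a small multiple of \<open>q\<close> times the square of
  a centred block mean has an exponential moment that is only linear in \<open>q\<close>. For fixed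
  \<open>q\<close> a segment carries finitely many words, so the number of exchanges that join two
  linked words has some finite bound \<open>M\<close>, and no path has to be counted. The resulting
  factor \<open>2 ^ n * M\<close> is huge but independent of \<open>N\<close>, and it meets a
  Dirichlet form which the diffusive time scale multiplies by \<open>N\<^sup>2\<close>. Hence
  \<open>N\<close> tends to infinity with \<open>q\<close> fixed, and neither a spectral gap nor a
  second block scale enters.

  The obstacle is the degeneracy: a word without a pair may be frozen, and words with equally many
  particles need not be connected. Exchanges are therefore made only on the event that the reserved
  sites contain a pair, an event which the exchange leaves unaffected; its complement is treated by
  the entropy inequality like the block means.\<close>

definition shift :: "nat \<Rightarrow> 'd \<Rightarrow> int \<Rightarrow> int ^ 'd \<Rightarrow> int ^ 'd::finite" where
  "shift N j k x = translate N x (axis j k)"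

lemma shift_nth: "shift N j k x $ i = (x $ i + (if i = j then k else 0)) mod int N"
  by (simp add: shift_def translate_def axis_def)

lemma sites_iff: "x \<in> sites N \<longleftrightarrow> (\<forall>i. 0 \<le> x $ i \<and> x $ i < int N)"
  by (simp add: sites_def)

lemma sites_bij:
  "bij_betw (\<lambda>x i. x $ i) (sites N :: (int ^ 'd::finite) set) (UNIV \<rightarrow>\<^sub>E {0..<int N})"
  by (rule bij_betwI[where g = "\<lambda>f. \<chi> i. f i"])
    (auto simp: sites_iff PiE_def Pi_def extensional_def)

lemma finite_sites [simp, intro]: "finite (sites N :: (int ^ 'd::finite) set)"
  using bij_betw_finite[OF sites_bij, of N] by (simp add: finite_PiE)

lemma card_sites: "card (sites N :: (int ^ 'd::finite) set) = N ^ CARD('d)"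
  using bij_betw_same_card[OF sites_bij, of N] by (simp add: card_PiE)

lemma sites_nonempty: "N \<ge> 1 \<Longrightarrow> sites N \<noteq> ({} :: (int ^ 'd::finite) set)"
proof -
  assume "N \<ge> 1"
  then have "0 \<in> (sites N :: (int ^ 'd::finite) set)" by (simp add: sites_iff)
  then show ?thesis by blast
qed

lemma shift_in_sites [simp]: "N \<ge> 1 \<Longrightarrow> shift N j k x \<in> sites N"
  by (simp add: sites_iff shift_nth)

lemma shift_shift: "shift N j k (shift N j l x) = shift N j (l + k) x"
  by (simp add: vec_eq_iff shift_nth mod_simps add.assoc)

lemma shift_0: "x \<in> sites N \<Longrightarrow> shift N j 0 x = x"
  by (simp add: vec_eq_iff shift_nth sites_iff)

lemma shift_cong: "k mod int N = l mod int N \<Longrightarrow> shift N j k x = shift N j l x"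
  by (simp add: vec_eq_iff shift_nth) (metis mod_add_right_eq)

lemma shift_eq_iff: "shift N j k x = shift N j l x \<longleftrightarrow> k mod int N = l mod int N"
proof
  assume "shift N j k x = shift N j l x"
  then have "shift N j k x $ j = shift N j l x $ j" by simp
  then show "k mod int N = l mod int N"
    by (simp add: shift_nth mod_eq_dvd_iff)
qed (rule shift_cong)

lemma shift_inj:
  assumes "\<bar>k - l\<bar> < int N"
  shows "shift N j k x = shift N j l x \<longleftrightarrow> k = l"
proof -
  have "k = l" if "int N dvd k - l"
    using that assms zdvd_imp_le[of "int N" "\<bar>k - l\<bar>"] by fastforce
  then show ?thesis by (auto simp: shift_eq_iff mod_eq_dvd_iff)
qed

lemma shift_bij: "N \<ge> 1 \<Longrightarrow> bij_betw (shift N j k) (sites N) (sites N)"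
  by (rule bij_betwI[where g = "shift N j (- k)"]) (auto simp: shift_shift shift_0)

lemma sum_shift:
  assumes "N \<ge> 1"
  shows "(\<Sum>x\<in>sites N. f (shift N j k x)) = (\<Sum>x\<in>sites N. f x)"
  by (rule sum.reindex_bij_betw[OF shift_bij[OF assms]])

text \<open>With \<open>N = 2\<close> two steps in the same direction return to the start. Excluding
  this keeps the forward and the backward ordered pairs of neighbours disjoint in
  \<open>generator_bonds\<close>.\<close>

lemma shift_two_ne:
  assumes "N \<ge> 3"
  shows "shift N i 1 (shift N j 1 x) \<noteq> x"
proof
  assume "shift N i 1 (shift N j 1 x) = x"
  then have "shift N i 1 (shift N j 1 x) $ j = x $ j" by simp
  then have "(x $ j + (1 + (if i = j then 1 else 0))) mod int N = x $ j mod int N"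
    by (cases "i = j") (auto simp: shift_nth mod_simps add.assoc, (metis mod_mod_trivial)+)
  then have "int N dvd 1 + (if i = j then 1 else 0)"
    by (metis mod_eq_dvd_iff add_diff_cancel_left')
  then have "int N \<le> 1 + (if i = j then 1 else 0)" by (rule zdvd_imp_le) auto
  with assms show False by (auto split: if_splits)
qed

lemma shift_dir_inj:
  assumes "N \<ge> 2" "shift N i 1 x = shift N j 1 x"
  shows "i = j"
  using translate_axis_inj[OF assms(1)] assms(2) by (auto simp: shift_def)

section \<open>Neighbours are shifts by one step\<close>

lemma site_dist_shift:
  assumes "N \<ge> 2" "x \<in> sites N"
  shows "site_dist N x (shift N j 1 x) = 1" "site_dist N (shift N j 1 x) x = 1"
proof -
  have a: "min ((x $ i - shift N j 1 x $ i) mod int N) ((shift N j 1 x $ i - x $ i) mod int N)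
      = (if i = j then 1 else 0)" for i
  proof (cases "i = j")
    case True
    have "(shift N j 1 x $ j - x $ j) mod int N = 1"
      using assms by (simp add: shift_nth mod_simps)
    moreover have "(x $ j - shift N j 1 x $ j) mod int N = (-1) mod int N"
      by (simp add: shift_nth mod_simps)
    moreover have "(-1) mod int N = int N - 1" using assms(1) by (simp add: zmod_minus1)
    ultimately show ?thesis using True assms(1) by simp
  qed (use assms in \<open>simp add: shift_nth sites_iff\<close>)
  show "site_dist N x (shift N j 1 x) = 1"
    unfolding site_dist_def a by simp
  show "site_dist N (shift N j 1 x) x = 1"
    unfolding site_dist_def by (subst min.commute) (simp add: a)
qed

text \<open>Nonnegative integers with sum 1 are one 1 and otherwise zeros; hence exactly one
  coordinate moves, by one step modulo \<open>N\<close>.\<close>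

lemma site_dist_1D:
  assumes "N \<ge> 2" "x \<in> sites N" "y \<in> sites N" "site_dist N x y = 1"
  shows "\<exists>j. y = shift N j 1 x \<or> x = shift N j 1 y"
proof -
  define m where "m i = min ((x $ i - y $ i) mod int N) ((y $ i - x $ i) mod int N)" for i
  have m0: "m i \<ge> 0" for i using assms(1) by (simp add: m_def)
  have s: "(\<Sum>i\<in>UNIV. m i) = 1" using assms(4) by (simp add: site_dist_def m_def)
  then obtain j where j: "m j \<noteq> 0" by (metis sum.neutral zero_neq_one)
  have "(\<Sum>i\<in>UNIV. m i) = m j + (\<Sum>i\<in>UNIV - {j}. m i)"
    by (rule sum.remove) auto
  moreover have "(\<Sum>i\<in>UNIV - {j}. m i) \<ge> 0" by (intro sum_nonneg m0)
  ultimately have mj: "m j = 1" and r: "(\<Sum>i\<in>UNIV - {j}. m i) = 0"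
    using s j m0[of j] by auto
  from r have mi: "m i = 0" if "i \<noteq> j" for i
    using that m0 by (subst (asm) sum_nonneg_eq_0_iff) auto
  have eq: "x $ i = y $ i" if "i \<noteq> j" for i
  proof -
    from mi[OF that] have "(x $ i - y $ i) mod int N = 0 \<or> (y $ i - x $ i) mod int N = 0"
      by (auto simp: m_def min_def split: if_splits)
    then have "x $ i mod int N = y $ i mod int N"
      by (metis mod_eq_dvd_iff dvd_eq_mod_eq_0)
    then show ?thesis using assms(2,3) by (simp add: sites_iff)
  qed
  from mj have "(x $ j - y $ j) mod int N = 1 \<or> (y $ j - x $ j) mod int N = 1"
    by (auto simp: m_def min_def split: if_splits)
  moreover have "x = shift N j 1 y" if "(x $ j - y $ j) mod int N = 1"
  proof -
    have "x $ j mod int N = (y $ j + 1) mod int N"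
      using that by (metis add.commute diff_add_cancel mod_add_left_eq)
    then show ?thesis using assms(2,3) eq by (auto simp: vec_eq_iff shift_nth sites_iff)
  qed
  moreover have "y = shift N j 1 x" if "(y $ j - x $ j) mod int N = 1"
  proof -
    have "y $ j mod int N = (x $ j + 1) mod int N"
      using that by (metis add.commute diff_add_cancel mod_add_left_eq)
    then show ?thesis using assms(2,3) eq by (auto simp: vec_eq_iff shift_nth sites_iff)
  qed
  ultimately show ?thesis by blast
qed

section \<open>The generator as a sum over bonds, and its symmetry\<close>

definition bond_swap :: "nat \<Rightarrow> int ^ 'd \<Rightarrow> 'd \<Rightarrow> 'd::finite config \<Rightarrow> 'd config" where
  "bond_swap N x j \<eta> = exchange \<eta> x (shift N j 1 x)"

lemma exchange_commute: "exchange \<eta> x y = exchange \<eta> y x"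
  by (auto simp: exchange_def fun_eq_iff)

lemma exchange_id: "\<eta> x = \<eta> y \<Longrightarrow> exchange \<eta> x y = \<eta>"
  by (auto simp: exchange_def fun_eq_iff)

text \<open>The two orders of a bond carry the same rate. Their exclusion factors add up to 1 when
  the bond holds one particle, and otherwise the exchange changes nothing; hence the factors
  disappear and every bond contributes once.\<close>

lemma generator_bonds:
  fixes f :: "'d::finite config \<Rightarrow> real"
  assumes N: "N \<ge> 3"
  shows "generator N f \<eta> =
    (\<Sum>x\<in>sites N. \<Sum>j\<in>UNIV. bond_rate N x j \<eta> * (f (bond_swap N x j \<eta>) - f \<eta>))"
proof -
  let ?S = "sites N \<times> (UNIV :: 'd set)"
  define F where "F = (\<lambda>(x, y). exchange_rate N x y \<eta> * of_bool (\<eta> x) * (1 - of_bool (\<eta> y))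
          * (f (exchange \<eta> x y) - f \<eta>))"
  define a where "a = (\<lambda>(x, j :: 'd). (x, shift N j 1 x))"
  define b where "b = (\<lambda>(x, j :: 'd). (shift N j 1 x, x))"
  have P: "{(x, y) \<in> sites N \<times> sites N. site_dist N x y = 1} = a ` ?S \<union> b ` ?S"
    using N site_dist_1D[of N] site_dist_shift[of N]
    by (fastforce simp: a_def b_def image_iff)
  have d: "a ` ?S \<inter> b ` ?S = {}"
    using shift_two_ne[OF N] by (force simp: a_def b_def)
  have ia: "inj_on a ?S" "inj_on b ?S"
    using shift_dir_inj[of N] N by (auto simp: a_def b_def inj_on_def)
  have "generator N f \<eta> = (\<Sum>p\<in>a ` ?S \<union> b ` ?S. F p)"
    unfolding generator_def P F_def by simp
  also have "\<dots> = (\<Sum>p\<in>a ` ?S. F p) + (\<Sum>p\<in>b ` ?S. F p)"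
    by (rule sum.union_disjoint) (use d in auto)
  also have "\<dots> = (\<Sum>p\<in>?S. F (a p) + F (b p))"
    by (simp add: sum.reindex[OF ia(1)] sum.reindex[OF ia(2)] sum.distrib)
  also have "\<dots> = (\<Sum>(x, j)\<in>?S. bond_rate N x j \<eta> * (f (bond_swap N x j \<eta>) - f \<eta>))"
  proof (rule sum.cong[OF refl], clarify)
    fix x :: "int ^ 'd" and j :: 'd assume "x \<in> sites N"
    have fw: "exchange_rate N x (shift N j 1 x) \<eta> = bond_rate N x j \<eta>"
      using exchange_rate_forward[of N] N by (simp add: shift_def)
    have bw: "exchange_rate N (shift N j 1 x) x \<eta> = bond_rate N x j \<eta>"
      using exchange_rate_backward[of N] N by (simp add: shift_def)
    show "F (a (x, j)) + F (b (x, j)) = bond_rate N x j \<eta> * (f (bond_swap N x j \<eta>) - f \<eta>)"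
      using exchange_id[of \<eta> x "shift N j 1 x"] exchange_commute[of \<eta> x "shift N j 1 x"]
      by (auto simp: F_def a_def b_def fw bw bond_swap_def of_bool_def)
  qed
  also have "\<dots> = (\<Sum>x\<in>sites N. \<Sum>j\<in>UNIV. bond_rate N x j \<eta> * (f (bond_swap N x j \<eta>) - f \<eta>))"
    by (simp add: sum.cartesian_product)
  finally show ?thesis .
qed

lemma bond_rate_shift:
  "bond_rate N x j \<eta> = of_bool (\<eta> (shift N j (-1) x)) + of_bool (\<eta> (shift N j 2 x))"
proof -
  have "- axis j 1 = (axis j (-1) :: int ^ 'a)" by (simp add: vec_eq_iff axis_def)
  then show ?thesis by (simp add: bond_rate_def shift_def)
qed

lemma bond_rate_bounds: "0 \<le> bond_rate N x j \<eta>" "bond_rate N x j \<eta> \<le> 2"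
  by (auto simp: bond_rate_shift)

lemma finite_configs [simp, intro]: "finite (configs N :: 'd::finite config set)"
  by (simp add: configs_def finite_PiE)

lemma configs_nonempty: "configs N \<noteq> ({} :: 'd::finite config set)"
  by (simp add: configs_def PiE_eq_empty_iff)

lemma bond_swap_in_configs [simp]: "N \<ge> 1 \<Longrightarrow> x \<in> sites N \<Longrightarrow> \<eta> \<in> configs N \<Longrightarrow> bond_swap N x j \<eta> \<in> configs N"
  using shift_in_sites[of N j] by (auto simp: bond_swap_def exchange_def configs_def PiE_def extensional_def)

lemma bond_swap_bond_swap [simp]: "bond_swap N x j (bond_swap N x j \<eta>) = \<eta>"
  by (auto simp: bond_swap_def exchange_def)

lemma bond_swap_apply:
  "bond_swap N x j \<eta> y = (if y = shift N j 1 x then \<eta> x else if y = x then \<eta> (shift N j 1 x) else \<eta> y)"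
  by (auto simp: bond_swap_def exchange_def)

lemma shift_ne:
  assumes "x \<in> sites N" "\<bar>k\<bar> < int N" "k \<noteq> 0"
  shows "shift N j k x \<noteq> x"
  using shift_inj[of k 0 N j x] shift_0[OF assms(1)] assms(2,3) by auto

text \<open>The rate looks only at the outer neighbours of the bond, which are none of its endpoints
  once \<open>N \<ge> 3\<close>. Equal rates for an exchange and its reversal make the counting
  measure reversible.\<close>

lemma bond_rate_bond_swap [simp]:
  assumes "N \<ge> 3" "x \<in> sites N"
  shows "bond_rate N x j (bond_swap N x j \<eta>) = bond_rate N x j \<eta>"
  using assms shift_inj[of "-1" 1 N j x] shift_inj[of 2 1 N j x] shift_ne[of x N "-1" j] shift_ne[of x N 2 j]
  by (simp add: bond_rate_shift bond_swap_apply)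

lemma sum_bond_swap:
  assumes "N \<ge> 1" "x \<in> sites N"
  shows "(\<Sum>\<eta>\<in>configs N. F (bond_swap N x j \<eta>)) = (\<Sum>\<eta>\<in>configs N. F \<eta>)"
  by (rule sum.reindex_bij_witness[where i = "bond_swap N x j" and j = "bond_swap N x j"]) (use assms in auto)

text \<open>Every bond exchange is an involution of \<open>configs N\<close> with invariant rate,
  hence symmetric for the counting measure. Tested with 1 this gives conservation of mass, tested
  with an indicator the forward equation.\<close>

lemma generator_symmetric:
  fixes f g :: "'d::finite config \<Rightarrow> real"
  assumes N: "N \<ge> 3"
  shows "(\<Sum>\<eta>\<in>configs N. f \<eta> * generator N g \<eta>) = (\<Sum>\<eta>\<in>configs N. generator N f \<eta> * g \<eta>)"
proof -
  have sw: "(\<Sum>\<eta>\<in>configs N. f \<eta> * generator N g \<eta>) =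
    (\<Sum>x\<in>sites N. \<Sum>j\<in>UNIV. \<Sum>\<eta>\<in>configs N. bond_rate N x j \<eta> * (f \<eta> * g (bond_swap N x j \<eta>) - f \<eta> * g \<eta>))"
    for f g :: "'d config \<Rightarrow> real"
    unfolding generator_bonds[OF N] sum_distrib_left
    by (subst sum.swap, rule sum.cong[OF refl], subst sum.swap)
       (simp add: algebra_simps)
  have "(\<Sum>\<eta>\<in>configs N. bond_rate N x j \<eta> * (f \<eta> * g (bond_swap N x j \<eta>)))
      = (\<Sum>\<eta>\<in>configs N. bond_rate N x j \<eta> * (g \<eta> * f (bond_swap N x j \<eta>)))" if "x \<in> sites N" for x j
    by (subst sum_bond_swap[symmetric, where x = x and j = j]) (use N that in \<open>auto simp: mult_ac\<close>)
  then have "(\<Sum>\<eta>\<in>configs N. f \<eta> * generator N g \<eta>) = (\<Sum>\<eta>\<in>configs N. g \<eta> * generator N f \<eta>)"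
    unfolding sw right_diff_distrib sum_subtractf
    by (intro sum.cong[OF refl, of "sites N"] sum.cong[OF refl, of "UNIV :: 'd set"]
          arg_cong2[where f = "(-)"]) (blast, simp add: mult_ac)
  then show ?thesis by (simp add: mult.commute)
qed

section \<open>Product weights and entropy\<close>

text \<open>A point weight instead of a measure, so that expectations are finite sums over
  \<open>configs N\<close>. The identification with \<open>product_bernoulli\<close> is made in
  \<open>product_bernoulli_singleton\<close>.\<close>

definition nu :: "nat \<Rightarrow> (int ^ 'd::finite \<Rightarrow> real) \<Rightarrow> 'd config \<Rightarrow> real" where
  "nu N r \<eta> = (\<Prod>x\<in>sites N. if \<eta> x then r x else 1 - r x)"

definition expect :: "nat \<Rightarrow> (int ^ 'd::finite \<Rightarrow> real) \<Rightarrow> ('d config \<Rightarrow> real) \<Rightarrow> real" where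
  "expect N r f = (\<Sum>\<eta>\<in>configs N. nu N r \<eta> * f \<eta>)"

definition local_on :: "'a set \<Rightarrow> (('a \<Rightarrow> bool) \<Rightarrow> real) \<Rightarrow> bool" where
  "local_on A f \<longleftrightarrow> (\<forall>\<eta> \<eta>'. (\<forall>x\<in>A. \<eta> x = \<eta>' x) \<longrightarrow> f \<eta> = f \<eta>')"

lemma local_onD: "local_on A f \<Longrightarrow> (\<And>x. x \<in> A \<Longrightarrow> \<eta> x = \<eta>' x) \<Longrightarrow> f \<eta> = f \<eta>'"
  unfolding local_on_def by blast

lemma local_on_comp: "local_on A f \<Longrightarrow> local_on A (\<lambda>\<eta>. h (f \<eta>))"
  unfolding local_on_def by metis

lemma local_on_prod:
  fixes F :: "'i \<Rightarrow> ('a \<Rightarrow> bool) \<Rightarrow> real"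
  assumes "\<And>i. i \<in> I \<Longrightarrow> local_on (A i) (F i)"
  shows "local_on (\<Union>i\<in>I. A i) (\<lambda>\<eta>. \<Prod>i\<in>I. F i \<eta>)"
  unfolding local_on_def
proof (intro allI impI prod.cong refl)
  fix \<eta> \<eta>' :: "'a \<Rightarrow> bool" and i assume "\<forall>x\<in>\<Union> (A ` I). \<eta> x = \<eta>' x" "i \<in> I"
  then show "F i \<eta> = F i \<eta>'" by (intro local_onD[OF assms]) auto
qed

lemma sum_prod_sites:
  "(\<Sum>\<eta>\<in>configs N. \<Prod>x\<in>sites N. h x (\<eta> x)) = (\<Prod>x\<in>sites N. h x True + h x False :: real)"
  for h :: "int ^ 'd::finite \<Rightarrow> bool \<Rightarrow> real"
  by (simp add: configs_def prod_sum_PiE[symmetric] UNIV_bool add.commute)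

lemma expect_one [simp]: "expect N r (\<lambda>_. 1) = 1"
  unfolding expect_def nu_def using sum_prod_sites[of "\<lambda>x b. if b then r x else 1 - r x" N] by simp

lemma expect_cmult: "expect N r (\<lambda>\<eta>. c * f \<eta>) = c * expect N r f"
  by (simp add: expect_def sum_distrib_left mult_ac)

lemma expect_add: "expect N r (\<lambda>\<eta>. f \<eta> + g \<eta>) = expect N r f + expect N r g"
  by (simp add: expect_def sum.distrib algebra_simps)

lemma expect_sum: "expect N r (\<lambda>\<eta>. \<Sum>i\<in>I. f i \<eta>) = (\<Sum>i\<in>I. expect N r (f i))"
  unfolding expect_def sum_distrib_left by (rule sum.swap)

lemma expect_single:
  assumes "x \<in> sites N"
  shows "expect N r (\<lambda>\<eta>. g (\<eta> x)) = r x * g True + (1 - r x) * g False"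
proof -
  have "expect N r (\<lambda>\<eta>. g (\<eta> x)) = (\<Sum>\<eta>\<in>configs N. \<Prod>y\<in>sites N.
      (if \<eta> y then r y else 1 - r y) * (if y = x then g (\<eta> y) else 1))"
    using assms by (simp add: expect_def nu_def prod.distrib prod.delta)
  also have "\<dots> = (\<Prod>y\<in>sites N. r y * (if y = x then g True else 1) + (1 - r y) * (if y = x then g False else 1))"
    using sum_prod_sites[of "\<lambda>y b. (if b then r y else 1 - r y) * (if y = x then g b else 1)" N]
    by simp
  also have "\<dots> = (\<Prod>y\<in>sites N. if y = x then r x * g True + (1 - r x) * g False else 1)"
    by (rule prod.cong) auto
  also have "\<dots> = r x * g True + (1 - r x) * g False"
    using assms by (simp add: prod.delta)
  finally show ?thesis .
qed

locale params =
  fixes N :: nat and r :: "int ^ 'd::finite \<Rightarrow> real"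
  assumes N1: "N \<ge> 1" and r01: "\<And>x. x \<in> sites N \<Longrightarrow> 0 < r x \<and> r x < 1"
begin

lemma nu_pos: "nu N r \<eta> > 0"
  unfolding nu_def by (rule prod_pos) (use r01 in auto)

lemma expect_mono:
  assumes "\<And>\<eta>. \<eta> \<in> configs N \<Longrightarrow> f \<eta> \<le> g \<eta>"
  shows "expect N r f \<le> expect N r g"
  unfolding expect_def using nu_pos by (intro sum_mono mult_left_mono assms) (auto intro: less_imp_le)

lemma expect_pos:
  assumes "\<And>\<eta>. \<eta> \<in> configs N \<Longrightarrow> f \<eta> > 0"
  shows "expect N r f > 0"
  unfolding expect_def using nu_pos configs_nonempty assms
  by (intro sum_pos) auto

text \<open>Exchanging the restrictions to \<open>A\<close> of two independent copies preserves their joint law.\<close>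

lemma expect_indep:
  assumes f: "local_on A f" and g: "local_on B g" and AB: "A \<inter> B = {}"
  shows "expect N r (\<lambda>\<eta>. f \<eta> * g \<eta>) = expect N r f * expect N r g"
proof -
  define mix where "mix = (\<lambda>(\<eta> :: 'd config, \<eta>' :: 'd config) x. if x \<in> A then \<eta> x else \<eta>' x)"
  define T where "T = (\<lambda>(\<eta>, \<eta>'). (mix (\<eta>, \<eta>'), mix (\<eta>', \<eta>)))"
  have mixin: "mix (\<eta>, \<eta>') \<in> configs N" if "\<eta> \<in> configs N" "\<eta>' \<in> configs N" for \<eta> \<eta>'
    using that by (auto simp: mix_def configs_def PiE_def extensional_def)
  have TT: "T (T p) = p" for p
    by (cases p) (auto simp: T_def mix_def fun_eq_iff)
  have nunu: "nu N r (mix (\<eta>, \<eta>')) * nu N r (mix (\<eta>', \<eta>)) = nu N r \<eta> * nu N r \<eta>'" for \<eta> \<eta>'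
    unfolding nu_def prod.distrib[symmetric] by (intro prod.cong) (auto simp: mix_def)
  have fm: "f (mix (\<eta>, \<eta>')) = f \<eta>" for \<eta> \<eta>'
    by (rule local_onD[OF f]) (auto simp: mix_def)
  have gm: "g (mix (\<eta>, \<eta>')) = g \<eta>'" for \<eta> \<eta>'
    by (rule local_onD[OF g]) (use AB in \<open>auto simp: mix_def\<close>)
  have "expect N r f * expect N r g =
      (\<Sum>(\<eta>, \<eta>')\<in>configs N \<times> configs N. nu N r \<eta> * nu N r \<eta>' * (f \<eta> * g \<eta>'))"
    unfolding expect_def sum_product by (simp add: sum.cartesian_product mult_ac)
  also have "\<dots> = (\<Sum>(\<eta>, \<eta>')\<in>configs N \<times> configs N. nu N r \<eta> * nu N r \<eta>' * (f \<eta> * g \<eta>))"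
    by (rule sum.reindex_bij_witness[where i = T and j = T])
       (use TT mixin nunu fm gm in \<open>auto simp: T_def\<close>)
  also have "\<dots> = (\<Sum>\<eta>\<in>configs N. nu N r \<eta> * (f \<eta> * g \<eta>) * (\<Sum>\<eta>'\<in>configs N. nu N r \<eta>'))"
    by (simp add: sum.cartesian_product[symmetric] sum_distrib_left mult_ac)
  also have "(\<Sum>\<eta>'\<in>configs N. nu N r \<eta>') = 1"
    using expect_one[of N r] unfolding expect_def by simp
  finally show ?thesis by (simp add: expect_def)
qed

lemma expect_prod_indep:
  assumes "finite I" "\<And>i. i \<in> I \<Longrightarrow> local_on (A i) (F i)"
    and "\<And>i k. i \<in> I \<Longrightarrow> k \<in> I \<Longrightarrow> i \<noteq> k \<Longrightarrow> A i \<inter> A k = {}"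
  shows "expect N r (\<lambda>\<eta>. \<Prod>i\<in>I. F i \<eta>) = (\<Prod>i\<in>I. expect N r (F i))"
  using assms
proof (induction I rule: finite_induct)
  case (insert i I)
  have "expect N r (\<lambda>\<eta>. F i \<eta> * (\<Prod>k\<in>I. F k \<eta>)) = expect N r (F i) * expect N r (\<lambda>\<eta>. \<Prod>k\<in>I. F k \<eta>)"
  proof (rule expect_indep[of "A i" _ "\<Union>k\<in>I. A k"])
    show "local_on (\<Union>k\<in>I. A k) (\<lambda>\<eta>. \<Prod>k\<in>I. F k \<eta>)"
      by (rule local_on_prod) (use insert in auto)
    show "A i \<inter> (\<Union>k\<in>I. A k) = {}" using insert.prems(2)[of i] insert.hyps(2) by auto
  qed (use insert in auto)
  with insert show ?case by simp
qed simp

section \<open>Relative entropy and the entropy inequality\<close>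

definition entropy :: "('d config \<Rightarrow> real) \<Rightarrow> real" where
  "entropy P = (\<Sum>\<eta>\<in>configs N. P \<eta> * ln (P \<eta> / nu N r \<eta>))"

text \<open>The elementary half of the Donsker-Varadhan formula. It follows pointwise from
  \<open>ln y \<le> y - 1\<close> at \<open>y = nu * exp f / (Z * P)\<close>.\<close>

lemma entropy_inequality:
  assumes P: "\<And>\<eta>. \<eta> \<in> configs N \<Longrightarrow> P \<eta> > 0" "(\<Sum>\<eta>\<in>configs N. P \<eta>) = 1"
  shows "(\<Sum>\<eta>\<in>configs N. P \<eta> * f \<eta>) \<le> entropy P + ln (expect N r (\<lambda>\<eta>. exp (f \<eta>)))"
proof -
  define Z where "Z = expect N r (\<lambda>\<eta>. exp (f \<eta>))"
  have Z: "Z > 0" unfolding Z_def by (rule expect_pos) simp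
  have "P \<eta> * f \<eta> \<le> P \<eta> * ln (P \<eta> / nu N r \<eta>) + P \<eta> * ln Z + nu N r \<eta> * exp (f \<eta>) / Z - P \<eta>"
    if "\<eta> \<in> configs N" for \<eta>
  proof -
    have p: "P \<eta> > 0" using P that by auto
    let ?y = "nu N r \<eta> * exp (f \<eta>) / (Z * P \<eta>)"
    have "ln ?y \<le> ?y - 1" using p Z nu_pos[of \<eta>] by (intro ln_le_minus_one) auto
    moreover have "ln ?y = f \<eta> - ln (P \<eta> / nu N r \<eta>) - ln Z"
      using p Z nu_pos[of \<eta>] by (simp add: ln_div ln_mult)
    ultimately have "P \<eta> * (f \<eta> - ln (P \<eta> / nu N r \<eta>) - ln Z) \<le> P \<eta> * (?y - 1)"
      using p by (intro mult_left_mono) auto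
    moreover have "P \<eta> * ?y = nu N r \<eta> * exp (f \<eta>) / Z" using p by simp
    ultimately show ?thesis by (simp add: algebra_simps)
  qed
  then have "(\<Sum>\<eta>\<in>configs N. P \<eta> * f \<eta>) \<le> (\<Sum>\<eta>\<in>configs N.
      P \<eta> * ln (P \<eta> / nu N r \<eta>) + P \<eta> * ln Z + nu N r \<eta> * exp (f \<eta>) / Z - P \<eta>)"
    by (rule sum_mono)
  also have "\<dots> = entropy P + ln Z + Z / Z - 1"
  proof -
    have "(\<Sum>\<eta>\<in>configs N. nu N r \<eta> * exp (f \<eta>) / Z) = Z / Z"
      unfolding Z_def expect_def by (rule sum_divide_distrib[symmetric])
    then show ?thesis
      using P(2) by (simp add: entropy_def sum.distrib sum_subtractf flip: sum_distrib_right)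
  qed
  finally show ?thesis using Z by (simp add: Z_def)
qed

text \<open>Functions of one colour live on disjoint sets and are independent, so their exponential
  moment factorizes. The entropy inequality is used once per colour with the factor
  \<open>\<gamma> * K\<close>; dividing by this factor compensates the \<open>K\<close> copies of
  the entropy, while the logarithm of \<open>B\<close> gains \<open>1 / K\<close>.\<close>

lemma block_entropy_inequality:
  fixes f :: "int ^ 'd \<Rightarrow> 'd config \<Rightarrow> real" and col :: "int ^ 'd \<Rightarrow> nat"
  assumes P: "\<And>\<eta>. \<eta> \<in> configs N \<Longrightarrow> P \<eta> > 0" "(\<Sum>\<eta>\<in>configs N. P \<eta>) = 1"
    and loc: "\<And>x. x \<in> sites N \<Longrightarrow> local_on (A x) (f x)"
    and col: "\<And>x. x \<in> sites N \<Longrightarrow> col x < K"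
    and dis: "\<And>x y. x \<in> sites N \<Longrightarrow> y \<in> sites N \<Longrightarrow> x \<noteq> y \<Longrightarrow> col x = col y \<Longrightarrow> A x \<inter> A y = {}"
    and g: "\<gamma> > 0"
    and B: "\<And>x. x \<in> sites N \<Longrightarrow> expect N r (\<lambda>\<eta>. exp (\<gamma> * real K * f x \<eta>)) \<le> B"
  shows "(\<Sum>x\<in>sites N. \<Sum>\<eta>\<in>configs N. P \<eta> * f x \<eta>) \<le> entropy P / \<gamma> + real (card (sites N :: (int ^ 'd) set)) * ln B / (\<gamma> * real K)"
proof -
  obtain x0 where x0: "x0 \<in> (sites N :: (int ^ 'd) set)" using sites_nonempty[OF N1] by blast
  have K: "K > 0" using col[OF x0] by simp
  let ?S = "\<lambda>c. {x \<in> sites N. col x = c}"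
  have c: "(\<Sum>\<eta>\<in>configs N. P \<eta> * (\<Sum>x\<in>?S c. \<gamma> * real K * f x \<eta>))
      \<le> entropy P + (\<Sum>x\<in>?S c. ln B)" for c
  proof -
    have "expect N r (\<lambda>\<eta>. exp (\<Sum>x\<in>?S c. \<gamma> * real K * f x \<eta>)) =
        expect N r (\<lambda>\<eta>. \<Prod>x\<in>?S c. exp (\<gamma> * real K * f x \<eta>))"
      by (simp add: exp_sum)
    also have "\<dots> = (\<Prod>x\<in>?S c. expect N r (\<lambda>\<eta>. exp (\<gamma> * real K * f x \<eta>)))"
      by (rule expect_prod_indep[where A = A]) (use dis loc in \<open>auto intro: local_on_comp\<close>)
    finally have "ln (expect N r (\<lambda>\<eta>. exp (\<Sum>x\<in>?S c. \<gamma> * real K * f x \<eta>))) =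
       (\<Sum>x\<in>?S c. ln (expect N r (\<lambda>\<eta>. exp (\<gamma> * real K * f x \<eta>))))"
      by (simp add: ln_prod expect_pos less_imp_neq[symmetric])
    also have "\<dots> \<le> (\<Sum>x\<in>?S c. ln B)"
    proof (rule sum_mono)
      fix x assume "x \<in> ?S c"
      then have "0 < expect N r (\<lambda>\<eta>. exp (\<gamma> * real K * f x \<eta>))"
        "expect N r (\<lambda>\<eta>. exp (\<gamma> * real K * f x \<eta>)) \<le> B" using B by (auto intro: expect_pos)
      then show "ln (expect N r (\<lambda>\<eta>. exp (\<gamma> * real K * f x \<eta>))) \<le> ln B" by simp
    qed
    finally show ?thesis using entropy_inequality[OF P, of "\<lambda>\<eta>. \<Sum>x\<in>?S c. \<gamma> * real K * f x \<eta>"] by simp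
  qed
  have part: "(\<Sum>c<K. \<Sum>x\<in>?S c. h x) = (\<Sum>x\<in>sites N. h x)" for h :: "int ^ 'd \<Rightarrow> real"
    by (rule sum.group) (use col in auto)
  have "\<gamma> * real K * (\<Sum>x\<in>sites N. \<Sum>\<eta>\<in>configs N. P \<eta> * f x \<eta>) =
      (\<Sum>c<K. \<Sum>x\<in>?S c. \<Sum>\<eta>\<in>configs N. P \<eta> * (\<gamma> * real K * f x \<eta>))"
    unfolding part by (simp add: sum_distrib_left mult_ac)
  also have "\<dots> = (\<Sum>c<K. \<Sum>\<eta>\<in>configs N. P \<eta> * (\<Sum>x\<in>?S c. \<gamma> * real K * f x \<eta>))"
    by (intro sum.cong refl) (subst sum.swap, simp add: sum_distrib_left)
  also have "\<dots> \<le> (\<Sum>c<K. entropy P + (\<Sum>x\<in>?S c. ln B))"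
    by (rule sum_mono) (rule c)
  also have "\<dots> = real K * entropy P + (\<Sum>x\<in>(sites N :: (int ^ 'd) set). ln B)"
    unfolding part[symmetric] by (simp add: sum.distrib)
  finally show ?thesis using g K by (simp add: field_simps)
qed

end

section \<open>Block estimates under the product weight\<close>

definition seg :: "nat \<Rightarrow> 'd \<Rightarrow> nat \<Rightarrow> int ^ 'd \<Rightarrow> (int ^ 'd::finite) set" where
  "seg N j n z = (\<lambda>k. shift N j (int k) z) ` {..<n}"

text \<open>The last, incomplete block of length \<open>n\<close> gets its own \<open>n\<close> colours, because segments starting
  in it wrap around the torus.\<close>

definition seg_color :: "nat \<Rightarrow> 'd \<Rightarrow> nat \<Rightarrow> int ^ 'd::finite \<Rightarrow> nat" where
  "seg_color N j n z = (if nat (z $ j) div n < N div n then nat (z $ j) mod n else n + nat (z $ j) mod n)"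

lemma seg_color_less: "n > 0 \<Longrightarrow> seg_color N j n z < 2 * n"
proof -
  assume "n > 0"
  then have h: "nat (z $ j) mod n < n" by simp
  have "seg_color N j n z = nat (z $ j) mod n \<or> seg_color N j n z = n + nat (z $ j) mod n"
    by (simp add: seg_color_def)
  with h show ?thesis by linarith
qed

lemma offset_unique:
  "x < n \<Longrightarrow> y < n \<Longrightarrow> (if P then x else n + x) = (if Q then y else n + y) \<Longrightarrow> x = y \<and> (P \<longleftrightarrow> Q)"
  for n x y :: nat
  by (auto split: if_splits)

text \<open>The common offset \<open>c\<close> cancels. Full blocks start at least \<open>n\<close>
  apart and end at \<open>N\<close> or before, so the difference of the two positions lies strictly
  between 0 and \<open>N\<close>, even if the offset wraps around.\<close>

lemma blocks_apart:
  fixes n N A B c k l :: nat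
  assumes "A < B" "B < N div n" "k < n" "l < n"
  shows "(n * A + c + k) mod N \<noteq> (n * B + c + l) mod N"
proof
  assume "(n * A + c + k) mod N = (n * B + c + l) mod N"
  then have "int N dvd int (n * B + c + l) - int (n * A + c + k)"
    by (metis mod_eq_dvd_iff zmod_int)
  moreover have "n * A + n \<le> n * B" "n * B + n \<le> N"
  proof -
    have "n * (A + 1) \<le> n * B" "n * (B + 1) \<le> n * (N div n)"
      using assms by (intro mult_le_mono2; simp)+
    moreover have "n * (N div n) \<le> N" by simp
    ultimately have "n * (A + 1) \<le> n * B" "n * (B + 1) \<le> N" by (blast intro: order_trans)+
    then show "n * A + n \<le> n * B" "n * B + n \<le> N" by (simp_all add: add.commute)
  qed
  then have "int (n * B + c + l) - int (n * A + c + k) > 0" "int (n * B + c + l) - int (n * A + c + k) < int N"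
    using assms(3,4) by linarith+
  ultimately show False using zdvd_imp_le by fastforce
qed

text \<open>Segments in direction \<open>j\<close> can meet only on a common line. Equal colours
  there mean equal offsets: two different full blocks are handled by \<open>blocks_apart\<close>,
  and in the incomplete block the offset already determines the site.\<close>

lemma seg_color_disjoint:
  assumes n: "n > 0" and z: "z \<in> sites N" "z' \<in> sites N" "z \<noteq> z'"
    and col: "seg_color N j n z = seg_color N j n z'"
  shows "seg N j n z \<inter> seg N j n z' = {}"
proof (rule ccontr)
  assume "\<not> ?thesis"
  then obtain k l where kl: "k < n" "l < n" and eq: "shift N j (int k) z = shift N j (int l) z'"
    by (auto simp: seg_def)
  have c: "(z $ i + (if i = j then int k else 0)) mod int N = (z' $ i + (if i = j then int l else 0)) mod int N" for i
    using arg_cong[OF eq, of "\<lambda>v. v $ i"] by (simp add: shift_nth)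
  have oth: "z $ i = z' $ i" if "i \<noteq> j" for i
    using c[of i] that z by (simp add: sites_iff)
  define a b where "a = nat (z $ j)" and "b = nat (z' $ j)"
  have ab: "z $ j = int a" "z' $ j = int b" "a < N" "b < N"
    using z(1,2) by (simp_all add: a_def b_def sites_iff nat_less_iff)
  have "a \<noteq> b" using z(3) oth ab by (auto simp: vec_eq_iff) metis
  have m: "(a + k) mod N = (b + l) mod N"
    using c[of j] ab by (simp flip: of_nat_add of_nat_mod) 
  have md: "a mod n = b mod n" "a div n < N div n \<longleftrightarrow> b div n < N div n"
    using offset_unique[OF mod_less_divisor[OF n, of a] mod_less_divisor[OF n, of b]] col
    unfolding seg_color_def a_def[symmetric] b_def[symmetric] by blast+
  have da: "a = n * (a div n) + a mod n" "b = n * (b div n) + a mod n"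
    using md(1) by (metis mult_div_mod_eq)+
  show False
  proof (cases "a div n < N div n")
    case True
    then have "b div n < N div n" using md by simp
    have "a div n \<noteq> b div n" using da \<open>a \<noteq> b\<close> by metis
    then consider "a div n < b div n" | "b div n < a div n" by linarith
    then show False
    proof cases
      case 1
      from blocks_apart[OF this \<open>b div n < N div n\<close> kl, of "a mod n"] m da show False by simp
    next
      case 2
      from blocks_apart[OF this True kl(2,1), of "a mod n"] m da show False by simp
    qed
  next
    case False
    then have "a div n = N div n" "b div n = N div n"
      using md(2) div_le_mono[of a N n] div_le_mono[of b N n] ab by auto
    then show False using da \<open>a \<noteq> b\<close> by metis
  qed
qed

text \<open>For negative \<open>x = - y\<close> the claim amounts to
  \<open>1 \<le> (1 - y + y\<^sup>2) * exp y\<close>, which follows from the quadratic lower bound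
  of the exponential.\<close>

lemma exp_le_quadratic:
  fixes x :: real
  assumes "\<bar>x\<bar> \<le> 1"
  shows "exp x \<le> 1 + x + x\<^sup>2"
proof (cases "x \<ge> 0")
  case True
  then show ?thesis using assms exp_bound[of x] by simp
next
  case False
  define y where "y = - x"
  have y: "0 \<le> y" "y \<le> 1" using False assms by (auto simp: y_def)
  have "(1 - y + y\<^sup>2) * (1 + y + y\<^sup>2 / 2) = 1 + y\<^sup>2 / 2 + y ^ 3 / 2 + y ^ 4 / 2"
    by (simp add: field_simps power2_eq_square power3_eq_cube power4_eq_xxxx)
  also have "\<dots> \<ge> 1" using y by simp
  finally have "1 \<le> (1 - y + y\<^sup>2) * (1 + y + y\<^sup>2 / 2)" .
  also have "\<dots> \<le> (1 - y + y\<^sup>2) * exp y"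
    using y exp_lower_Taylor_quadratic[of y] by (intro mult_left_mono) (auto simp: power2_eq_square)
  finally show ?thesis by (simp add: y_def exp_minus field_simps)
qed

section \<open>Exponential moments under the product weight\<close>

context params
begin

text \<open>The linear term of the quadratic bound vanishes because the variable is centred, and a
  Bernoulli variance is at most 1.\<close>

lemma exp_moment_single:
  assumes "x \<in> sites N" "\<bar>s\<bar> \<le> 1"
  shows "expect N r (\<lambda>\<eta>. exp (s * (of_bool (\<eta> x) - r x))) \<le> exp (s\<^sup>2)"
proof -
  let ?p = "r x"
  have p: "0 < ?p" "?p < 1" using r01[OF assms(1)] by auto
  have b1: "\<bar>s * (1 - ?p)\<bar> \<le> 1" "\<bar>s * (- ?p)\<bar> \<le> 1"
    using p assms(2) by (auto simp: abs_mult intro!: mult_le_one)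
  have "expect N r (\<lambda>\<eta>. exp (s * (of_bool (\<eta> x) - r x))) =
     ?p * exp (s * (1 - ?p)) + (1 - ?p) * exp (s * (- ?p))"
    using expect_single[OF assms(1), of r "\<lambda>b. exp (s * (of_bool b - r x))"] by simp
  also have "\<dots> \<le> ?p * (1 + s * (1 - ?p) + (s * (1 - ?p))\<^sup>2) + (1 - ?p) * (1 + s * (- ?p) + (s * (- ?p))\<^sup>2)"
    using p b1 by (intro add_mono mult_left_mono exp_le_quadratic) auto
  also have "\<dots> = 1 + s\<^sup>2 * (?p * (1 - ?p))"
    by (simp add: algebra_simps power2_eq_square)
  also have "\<dots> \<le> 1 + s\<^sup>2"
    using p by (simp add: mult_left_le mult_le_one)
  also have "\<dots> \<le> exp (s\<^sup>2)" by simp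
  finally show ?thesis .
qed

lemma exp_moment_sum:
  assumes Y: "\<And>k. k < q \<Longrightarrow> Y k \<in> sites N" "inj_on Y {..<q}" and s: "\<bar>s\<bar> \<le> 1"
  shows "expect N r (\<lambda>\<eta>. exp (s * (\<Sum>k<q. of_bool (\<eta> (Y k)) - r (Y k)))) \<le> exp (real q * s\<^sup>2)"
proof -
  have "expect N r (\<lambda>\<eta>. exp (s * (\<Sum>k<q. of_bool (\<eta> (Y k)) - r (Y k)))) =
     expect N r (\<lambda>\<eta>. \<Prod>k<q. exp (s * (of_bool (\<eta> (Y k)) - r (Y k))))"
    by (simp add: exp_sum sum_distrib_left)
  also have "\<dots> = (\<Prod>k<q. expect N r (\<lambda>\<eta>. exp (s * (of_bool (\<eta> (Y k)) - r (Y k)))))"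
    by (rule expect_prod_indep[where A = "\<lambda>k. {Y k}"])
       (use Y(2) in \<open>auto simp: local_on_def inj_on_def\<close>)
  also have "\<dots> \<le> (\<Prod>k<q. exp (s\<^sup>2))"
    using Y(1) s by (intro prod_mono conjI exp_moment_single less_imp_le[OF expect_pos]) auto
  also have "\<dots> = exp (real q * s\<^sup>2)" by (simp add: exp_of_nat_mult)
  finally show ?thesis .
qed

text \<open>Sum over the \<open>q + 1\<close> possible values of the mean, each one with its own optimal tilt \<open>s\<close>.\<close>

lemma exp_square_mean:
  assumes Y: "\<And>k. k < q \<Longrightarrow> Y k \<in> sites N" "inj_on Y {..<q}" and q: "q > 0"
    and a: "0 \<le> a" "a \<le> real q / 4"
  shows "expect N r (\<lambda>\<eta>. exp (a * ((\<Sum>k<q. of_bool (\<eta> (Y k))) / real q - (\<Sum>k<q. r (Y k)) / real q)\<^sup>2)) \<le> real q + 1"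
proof -
  define mb where "mb = (\<Sum>k<q. r (Y k)) / real q"
  \<comment> \<open>The Chernoff tilt: for a mean that exceeds \<open>mb\<close> by
    \<open>m\<close>, the exponent \<open>q * s\<^sup>2 - q * m * s\<close> is smallest at
    \<open>s = m / 2\<close>.\<close>
  define s where "s k = (real k / real q - mb) / 2" for k
  have rY: "0 \<le> r (Y k)" "r (Y k) \<le> 1" if "k < q" for k
    using r01[OF Y(1)[OF that]] by auto
  have "0 \<le> (\<Sum>k<q. r (Y k))" by (rule sum_nonneg) (use rY in auto)
  moreover have "(\<Sum>k<q. r (Y k)) \<le> (\<Sum>k<q. 1)" by (rule sum_mono) (use rY in auto)
  ultimately have "0 \<le> (\<Sum>k<q. r (Y k))" "(\<Sum>k<q. r (Y k)) \<le> (\<Sum>k<q. 1)" .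
  then have mb: "0 \<le> mb" "mb \<le> 1" using q by (auto simp: mb_def)
  have s1: "\<bar>s k\<bar> \<le> 1" if "k \<le> q" for k
  proof -
    have "0 \<le> real k / real q" "real k / real q \<le> 1" using that q by auto
    with mb have "real k / real q - mb \<le> 2" "mb - real k / real q \<le> 2" by linarith+
    then show ?thesis by (simp add: s_def abs_le_iff)
  qed
  let ?S = "\<lambda>\<eta>. \<Sum>k<q. of_bool (\<eta> (Y k)) - r (Y k)"
  \<comment> \<open>Chosen so that the \<open>k\<close>-th summand below equals the left-hand side
    when exactly \<open>k\<close> of the sites are occupied. After the moment bound its exponent is
    \<open>(4 * a - q) * (s k)\<^sup>2\<close>, which is not positive by the assumption on
    \<open>a\<close>.\<close>
  let ?c = "\<lambda>k. 4 * a * (s k)\<^sup>2 - 2 * real q * (s k)\<^sup>2"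
  have "exp (a * ((\<Sum>k<q. of_bool (\<eta> (Y k))) / real q - mb)\<^sup>2) \<le> (\<Sum>k\<le>q. exp (?c k) * exp (s k * ?S \<eta>))" for \<eta>
  proof -
    define c where "c = card {k. k < q \<and> \<eta> (Y k)}"
    have cs: "(\<Sum>k<q. of_bool (\<eta> (Y k))) = real c"
      by (simp add: c_def of_bool_def sum.If_cases Int_def)
    have cq: "c \<le> q" unfolding c_def using card_mono[of "{..<q}" "{k. k < q \<and> \<eta> (Y k)}"] by auto
    have "?S \<eta> = real c - real q * mb" using q by (simp add: sum_subtractf cs mb_def)
    also have "\<dots> = 2 * real q * s c" using q by (simp add: s_def field_simps)
    finally have h: "?c c + s c * ?S \<eta> = a * (2 * s c)\<^sup>2"
      by (simp add: power2_eq_square algebra_simps)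
    have e: "2 * s c = real c / real q - mb" by (simp add: s_def)
    have "exp (a * (real c / real q - mb)\<^sup>2) = exp (?c c) * exp (s c * ?S \<eta>)"
      unfolding exp_add[symmetric] h e ..
    also have "\<dots> \<le> (\<Sum>k\<le>q. exp (?c k) * exp (s k * ?S \<eta>))"
      by (rule member_le_sum) (use cq in auto)
    finally show ?thesis by (simp add: cs)
  qed
  then have "expect N r (\<lambda>\<eta>. exp (a * ((\<Sum>k<q. of_bool (\<eta> (Y k))) / real q - mb)\<^sup>2)) \<le>
     expect N r (\<lambda>\<eta>. \<Sum>k\<le>q. exp (?c k) * exp (s k * ?S \<eta>))" by (rule expect_mono)
  also have "\<dots> = (\<Sum>k\<le>q. exp (?c k) * expect N r (\<lambda>\<eta>. exp (s k * ?S \<eta>)))"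
    by (simp add: expect_sum expect_cmult)
  also have "\<dots> \<le> (\<Sum>k\<le>q. exp (?c k) * exp (real q * (s k)\<^sup>2))"
    by (intro sum_mono mult_left_mono exp_moment_sum Y s1) auto
  also have "\<dots> \<le> (\<Sum>k\<le>q. 1)"
  proof (rule sum_mono)
    fix k
    have "(4 * a - real q) * (s k)\<^sup>2 \<le> 0" using a by (intro mult_nonpos_nonneg) auto
    then show "exp (?c k) * exp (real q * (s k)\<^sup>2) \<le> 1"
      unfolding exp_add[symmetric] by (simp add: algebra_simps)
  qed
  finally show ?thesis by (simp add: mb_def)
qed

text \<open>Only even positions may start a pair. The pairs are then disjoint and the indicator is a
  product of independent factors.\<close>

definition no_pair :: "(nat \<Rightarrow> int ^ 'd) \<Rightarrow> nat \<Rightarrow> 'd config \<Rightarrow> real" where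
  "no_pair Y q \<eta> = (\<Prod>i<q. 1 - of_bool (\<eta> (Y (2 * i))) * of_bool (\<eta> (Y (2 * i + 1))))"

lemma no_pair_eq: "no_pair Y q \<eta> = of_bool (\<forall>i<q. \<not> (\<eta> (Y (2 * i)) \<and> \<eta> (Y (2 * i + 1))))"
  unfolding no_pair_def by (induction q) (auto simp: less_Suc_eq)

lemma expect_no_pair:
  assumes Y: "\<And>k. k < 2 * q \<Longrightarrow> Y k \<in> sites N" "inj_on Y {..<2 * q}"
    and d: "0 \<le> \<delta>" "\<And>x. x \<in> sites N \<Longrightarrow> \<delta> \<le> r x"
  shows "expect N r (no_pair Y q) \<le> (1 - \<delta>\<^sup>2) ^ q"
proof -
  let ?g = "\<lambda>i \<eta>. 1 - of_bool (\<eta> (Y (2 * i))) * of_bool (\<eta> (Y (2 * i + 1))) :: real"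
  have ine: "Y k \<noteq> Y l" if "k < 2 * q" "l < 2 * q" "k \<noteq> l" for k l
    using Y(2) that by (auto simp: inj_on_def)
  have e: "expect N r (?g i) = 1 - r (Y (2 * i)) * r (Y (2 * i + 1))" if "i < q" for i
  proof -
    have "expect N r (\<lambda>\<eta>. of_bool (\<eta> (Y (2 * i))) * of_bool (\<eta> (Y (2 * i + 1)))) =
       expect N r (\<lambda>\<eta>. of_bool (\<eta> (Y (2 * i)))) * expect N r (\<lambda>\<eta>. of_bool (\<eta> (Y (2 * i + 1))))"
      by (rule expect_indep[of "{Y (2 * i)}" _ "{Y (2 * i + 1)}"])
         (use ine[of "2 * i" "2 * i + 1"] that in \<open>auto simp: local_on_def\<close>)
    also have "\<dots> = r (Y (2 * i)) * r (Y (2 * i + 1))"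
      using that Y(1) by (simp add: expect_single[of _ N r of_bool])
    finally show ?thesis
      using expect_add[of N r "\<lambda>_. 1" "\<lambda>\<eta>. (-1) * (of_bool (\<eta> (Y (2 * i))) * of_bool (\<eta> (Y (2 * i + 1))))"]
      unfolding expect_cmult by simp
  qed
  have "expect N r (no_pair Y q) = (\<Prod>i<q. expect N r (?g i))"
    unfolding no_pair_def
  proof (rule expect_prod_indep[where A = "\<lambda>i. {Y (2 * i), Y (2 * i + 1)}"])
    show "{Y (2 * i), Y (2 * i + 1)} \<inter> {Y (2 * k), Y (2 * k + 1)} = {}"
      if "i \<in> {..<q}" "k \<in> {..<q}" "i \<noteq> k" for i k
    proof -
      have "2 * i \<noteq> 2 * k + 1" "2 * i + 1 \<noteq> 2 * k" by presburger+
      then show ?thesis using that ine[of "2 * i" "2 * k"] ine[of "2 * i" "2 * k + 1"]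
        ine[of "2 * i + 1" "2 * k"] ine[of "2 * i + 1" "2 * k + 1"] by auto
    qed
  qed (auto simp: local_on_def)
  also have "\<dots> \<le> (\<Prod>i<q. 1 - \<delta>\<^sup>2)"
  proof (rule prod_mono, intro conjI)
    fix i assume i: "i \<in> {..<q}"
    then have "Y (2 * i) \<in> sites N" "Y (2 * i + 1) \<in> sites N" using Y(1) by auto
    then have b: "\<delta> \<le> r (Y (2 * i))" "\<delta> \<le> r (Y (2 * i + 1))" "0 < r (Y (2 * i))" "r (Y (2 * i)) < 1"
      "0 < r (Y (2 * i + 1))" "r (Y (2 * i + 1)) < 1" using d r01 by auto
    show "0 \<le> expect N r (?g i)" using e i b by (simp add: mult_le_one)
    show "expect N r (?g i) \<le> 1 - \<delta>\<^sup>2"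
      using e i mult_mono[OF b(1,2)] b d(1) by (simp add: power2_eq_square)
  qed
  finally show ?thesis by simp
qed

text \<open>The exponential of \<open>a\<close> times an indicator is at most 1 plus
  \<open>exp a\<close> times the indicator, and the probability that none of the \<open>q\<close>
  pairs is occupied is at most \<open>exp (- (\<delta>\<^sup>2 * q))\<close>.\<close>

lemma exp_no_pair:
  assumes Y: "\<And>k. k < 2 * q \<Longrightarrow> Y k \<in> sites N" "inj_on Y {..<2 * q}"
    and d: "0 \<le> \<delta>" "\<And>x. x \<in> sites N \<Longrightarrow> \<delta> \<le> r x" and a: "a \<le> \<delta>\<^sup>2 * real q"
  shows "expect N r (\<lambda>\<eta>. exp (a * no_pair Y q \<eta>)) \<le> 2"
proof -
  obtain x0 where x0: "x0 \<in> (sites N :: (int ^ 'd) set)" using sites_nonempty[OF N1] by blast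
  then have d1: "\<delta> < 1" using d(2)[OF x0] r01[OF x0] by linarith
  have "expect N r (\<lambda>\<eta>. exp (a * no_pair Y q \<eta>)) \<le> expect N r (\<lambda>\<eta>. 1 + exp a * no_pair Y q \<eta>)"
    by (rule expect_mono) (simp add: no_pair_eq)
  also have "\<dots> = 1 + exp a * expect N r (no_pair Y q)"
    by (simp add: expect_add expect_cmult)
  also have "\<dots> \<le> 1 + exp a * exp (- (\<delta>\<^sup>2 * real q))"
  proof -
    have "expect N r (no_pair Y q) \<le> (1 - \<delta>\<^sup>2) ^ q" by (rule expect_no_pair) (use Y d in auto)
    also have "\<dots> \<le> exp (- \<delta>\<^sup>2) ^ q"
      using exp_ge_add_one_self[of "- \<delta>\<^sup>2"] d1 d(1)
      by (intro power_mono) (auto simp: power_le_one)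
    also have "\<dots> = exp (- (\<delta>\<^sup>2 * real q))" by (simp add: exp_of_nat_mult[symmetric] mult.commute)
    finally show ?thesis by simp
  qed
  also have "\<dots> \<le> 2" unfolding exp_add[symmetric] using a by simp
  finally show ?thesis .
qed

section \<open>Observables of one segment\<close>

definition occ :: "'d \<Rightarrow> int ^ 'd \<Rightarrow> nat \<Rightarrow> 'd config \<Rightarrow> real" where
  "occ j z k \<eta> = of_bool (\<eta> (shift N j (int k) z))"

text \<open>Segments of length \<open>6 q + 4\<close> consist of \<open>2 q\<close> auxiliary sites, where a pair of particles is
  looked for, then the four sites \<open>x - e, x, x + e, x + 2 e\<close> on which the rate and the current
  of a bond depend, then four blocks of length \<open>q\<close>, one for each of these sites.\<close>

definition bmean :: "'d \<Rightarrow> nat \<Rightarrow> nat \<Rightarrow> int ^ 'd \<Rightarrow> 'd config \<Rightarrow> real" where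
  "bmean j q i z \<eta> = (\<Sum>a<q. occ j z (2 * q + 4 + i * q + a) \<eta>) / real q"

text \<open>What the replacement leaves behind on a segment: deviations of block means from a
  reference density \<open>rr z\<close>, and the failure to find a pair. Both have exponential
  moments that the entropy inequality can afford.\<close>

definition psi :: "'d \<Rightarrow> nat \<Rightarrow> (int ^ 'd \<Rightarrow> real) \<Rightarrow> int ^ 'd \<Rightarrow> 'd config \<Rightarrow> real" where
  "psi j q rr z \<eta> = (\<Sum>i<4. (bmean j q i z \<eta> - rr z)\<^sup>2) + no_pair (\<lambda>k. shift N j (int k) z) q \<eta>"

lemma local_occ: "k < n \<Longrightarrow> local_on (seg N j n z) (occ j z k)"
  by (auto simp: local_on_def occ_def seg_def)

lemma block_index: "i < 4 \<Longrightarrow> a < q \<Longrightarrow> 2 * q + 4 + i * q + a < 6 * q + 4" for i a q :: nat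
proof -
  assume i: "i < 4" "a < q"
  then have "i * q \<le> 3 * q" by (intro mult_le_mono1) simp
  with i show ?thesis by linarith
qed

lemma local_bmean: "i < 4 \<Longrightarrow> local_on (seg N j (6 * q + 4) z) (bmean j q i z)"
proof -
  assume i: "i < 4"
  have l: "local_on (seg N j (6 * q + 4) z) (occ j z (2 * q + 4 + i * q + a))" if "a < q" for a
    by (rule local_occ) (rule block_index[OF i that])
  show ?thesis
    unfolding local_on_def bmean_def
    by (intro allI impI arg_cong2[where f = "(/)"] sum.cong refl local_onD[OF l]) auto
qed

lemma local_no_pair:
  "2 * q \<le> n \<Longrightarrow> local_on (seg N j n z) (no_pair (\<lambda>k. shift N j (int k) z) q)"
proof -
  assume n: "2 * q \<le> n"
  have e: "\<eta> (shift N j (int k) z) = \<eta>' (shift N j (int k) z)"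
    if "\<forall>x\<in>seg N j n z. \<eta> x = \<eta>' x" "k < 2 * q" for \<eta> \<eta>' k
    using that n by (auto simp: seg_def)
  show ?thesis
    unfolding local_on_def no_pair_def
  proof (intro allI impI prod.cong refl)
    fix \<eta> \<eta>' :: "'d config" and i assume h: "\<forall>x\<in>seg N j n z. \<eta> x = \<eta>' x" "i \<in> {..<q}"
    then show "1 - of_bool (\<eta> (shift N j (int (2 * i)) z)) * of_bool (\<eta> (shift N j (int (2 * i + 1)) z)) =
      (1 - of_bool (\<eta>' (shift N j (int (2 * i)) z)) * of_bool (\<eta>' (shift N j (int (2 * i + 1)) z)) :: real)"
      using e[OF h(1), of "2 * i"] e[OF h(1), of "2 * i + 1"] by simp
  qed
qed

text \<open>Here the length of the blocks pays. With \<open>K = 2 * n \<le> 20 * q\<close> colours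
  the value of \<open>\<gamma>\<close> gives
  \<open>\<gamma> * K \<le> \<delta>\<^sup>2 * q / 8\<close>, small enough both for
  \<open>exp_square_mean\<close> and for \<open>exp_no_pair\<close>. The factor 5 counts four block
  means and one indicator.\<close>

lemma psi_bound:
  assumes P: "\<And>\<eta>. \<eta> \<in> configs N \<Longrightarrow> P \<eta> > 0" "(\<Sum>\<eta>\<in>configs N. P \<eta>) = 1"
    and q: "q \<ge> 1" "6 * q + 4 \<le> N"
    and \<delta>: "\<delta> > 0" "\<And>x. x \<in> sites N \<Longrightarrow> \<delta> \<le> r x" and \<gamma>: "\<gamma> = \<delta>\<^sup>2 / 160"
    and \<theta>: "\<And>z k. z \<in> sites N \<Longrightarrow> k < 6 * q + 4 \<Longrightarrow> \<bar>r (shift N j (int k) z) - rr z\<bar> \<le> \<theta>"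
      "40 * \<gamma> * real q * \<theta>\<^sup>2 \<le> 1"
  shows "(\<Sum>z\<in>sites N. \<Sum>\<eta>\<in>configs N. P \<eta> * psi j q rr z \<eta>)
    \<le> 5 * (entropy P / \<gamma> + real (N ^ CARD('d)) * ln (3 * (real q + 1)) / (\<gamma> * real (2 * (6 * q + 4))))"
proof -
  obtain x0 where x0: "x0 \<in> (sites N :: (int ^ 'd) set)" using sites_nonempty[OF N1] by blast
  then have d1: "\<delta> < 1" using \<delta>(2)[OF x0] r01[OF x0] by linarith
  define n where "n = 6 * q + 4"
  define K where "K = 2 * n"
  have n0: "n > 0" by (simp add: n_def)
  have g0: "\<gamma> > 0" using \<delta> by (simp add: \<gamma>)
  have dd: "\<delta>\<^sup>2 \<le> 1" using \<delta> d1 by (simp add: power_le_one)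
  have "real K \<le> 20 * real q" using q by (simp add: K_def n_def)
  then have gKq: "\<gamma> * real K \<le> \<gamma> * (20 * real q)" using g0 by (intro mult_left_mono) auto
  also have "\<dots> = \<delta>\<^sup>2 * real q / 8" by (simp add: \<gamma>)
  finally have gK: "\<gamma> * real K \<le> \<delta>\<^sup>2 * real q / 8" .
  have "\<delta>\<^sup>2 * real q \<le> 1 * real q" using dd by (intro mult_right_mono) auto
  with gK have gK': "2 * (\<gamma> * real K) \<le> real q / 4" by simp
  let ?Y = "\<lambda>z k. shift N j (int k) z"
  have inj: "inj_on (\<lambda>k. ?Y z (m + k)) {..<l}" if "m + l \<le> n" for z m l
    using that q by (auto simp: inj_on_def n_def shift_inj)
  have b1: "(\<Sum>z\<in>sites N. \<Sum>\<eta>\<in>configs N. P \<eta> * f z \<eta>)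
      \<le> entropy P / \<gamma> + real (N ^ CARD('d)) * ln (3 * (real q + 1)) / (\<gamma> * real K)"
    if "\<And>z. z \<in> sites N \<Longrightarrow> local_on (seg N j n z) (f z)"
      "\<And>z. z \<in> sites N \<Longrightarrow> expect N r (\<lambda>\<eta>. exp (\<gamma> * real K * f z \<eta>)) \<le> 3 * (real q + 1)" for f
    unfolding card_sites[where ?'d = 'd, symmetric]
  proof (rule block_entropy_inequality[OF P, where A = "seg N j n" and col = "seg_color N j n"])
    show "seg N j n x \<inter> seg N j n y = {}"
      if "x \<in> sites N" "y \<in> sites N" "x \<noteq> y" "seg_color N j n x = seg_color N j n y" for x y
      using seg_color_disjoint[OF n0] that by blast
  qed (use that n0 g0 in \<open>auto simp: K_def seg_color_less\<close>)
  have sq: "(\<Sum>z\<in>sites N. \<Sum>\<eta>\<in>configs N. P \<eta> * (bmean j q i z \<eta> - rr z)\<^sup>2)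
      \<le> entropy P / \<gamma> + real (N ^ CARD('d)) * ln (3 * (real q + 1)) / (\<gamma> * real K)" if i: "i < 4" for i
  proof (rule b1)
    show "local_on (seg N j n z) (\<lambda>\<eta>. (bmean j q i z \<eta> - rr z)\<^sup>2)" for z
      unfolding n_def by (rule local_on_comp[OF local_bmean[OF i], of _ _ _ "\<lambda>m. (m - rr z)\<^sup>2"])
    fix z :: "int ^ 'd" assume z: "z \<in> sites N"
    define Y where "Y a = ?Y z ((2 * q + 4 + i * q) + a)" for a
    have iq: "2 * q + 4 + i * q + q \<le> n"
    proof -
      have "i * q \<le> 3 * q" using i by (intro mult_le_mono1) simp
      then show ?thesis by (simp add: n_def)
    qed
    have Y: "\<And>k. k < q \<Longrightarrow> Y k \<in> sites N" "inj_on Y {..<q}"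
      unfolding Y_def using N1 inj[OF iq, of z] by simp_all
    define mb where "mb = (\<Sum>k<q. r (Y k)) / real q"
    have "\<bar>mb - rr z\<bar> = \<bar>(\<Sum>k<q. r (Y k) - rr z)\<bar> / real q"
    proof -
      have "mb - rr z = (\<Sum>k<q. r (Y k) - rr z) / real q"
        using q by (simp add: mb_def sum_subtractf diff_divide_distrib)
      then show ?thesis by simp
    qed
    also have "\<dots> \<le> (\<Sum>k<q. \<theta>) / real q"
    proof (intro divide_right_mono order_trans[OF sum_abs] sum_mono)
      fix k assume "k \<in> {..<q}"
      then show "\<bar>r (Y k) - rr z\<bar> \<le> \<theta>"
        unfolding Y_def by (intro \<theta>(1)[OF z] block_index i) auto
    qed auto
    also have "\<dots> = \<theta>" using q by simp
    finally have mbr: "(mb - rr z)\<^sup>2 \<le> \<theta>\<^sup>2"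
      by (intro abs_le_square_iff[THEN iffD1]) simp
    have k1: "2 * (\<gamma> * real K) * \<theta>\<^sup>2 \<le> 1"
    proof -
      have "2 * (\<gamma> * real K) \<le> 40 * \<gamma> * real q"
        using gKq by simp
      then have "2 * (\<gamma> * real K) * \<theta>\<^sup>2 \<le> 40 * \<gamma> * real q * \<theta>\<^sup>2"
        by (rule mult_right_mono) simp
      with \<theta>(2) show ?thesis by simp
    qed
    have m: "bmean j q i z \<eta> = (\<Sum>k<q. of_bool (\<eta> (Y k))) / real q" for \<eta>
      by (simp add: bmean_def occ_def Y_def)
    \<comment> \<open>Recentring at the true mean \<open>mb\<close> of the block doubles the
      coefficient of the square; by the second assumption on \<open>\<theta>\<close> the remaining
      constant is at most 1, which yields \<open>exp 1\<close>.\<close>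
    have "expect N r (\<lambda>\<eta>. exp (\<gamma> * real K * (bmean j q i z \<eta> - rr z)\<^sup>2)) \<le>
       expect N r (\<lambda>\<eta>. exp 1 * exp (2 * (\<gamma> * real K) * ((\<Sum>k<q. of_bool (\<eta> (Y k))) / real q - mb)\<^sup>2))"
    proof (rule expect_mono)
      fix \<eta>
      have "(bmean j q i z \<eta> - rr z)\<^sup>2 \<le> 2 * (bmean j q i z \<eta> - mb)\<^sup>2 + 2 * (mb - rr z)\<^sup>2"
        using sum_squares_ge_zero[of "bmean j q i z \<eta> - mb - (mb - rr z)" 0]
        by (simp add: power2_eq_square algebra_simps)
      with mbr have "(bmean j q i z \<eta> - rr z)\<^sup>2 \<le> 2 * (bmean j q i z \<eta> - mb)\<^sup>2 + 2 * \<theta>\<^sup>2" by linarith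
      then have "\<gamma> * real K * (bmean j q i z \<eta> - rr z)\<^sup>2 \<le>
          \<gamma> * real K * (2 * (bmean j q i z \<eta> - mb)\<^sup>2 + 2 * \<theta>\<^sup>2)"
        using g0 by (intro mult_left_mono) auto
      also have "\<dots> \<le> 1 + 2 * (\<gamma> * real K) * (bmean j q i z \<eta> - mb)\<^sup>2"
        using k1 by (simp add: algebra_simps)
      finally show "exp (\<gamma> * real K * (bmean j q i z \<eta> - rr z)\<^sup>2) \<le>
         exp 1 * exp (2 * (\<gamma> * real K) * ((\<Sum>k<q. of_bool (\<eta> (Y k))) / real q - mb)\<^sup>2)"
        unfolding exp_add[symmetric] m by simp
    qed
    also have "\<dots> \<le> exp 1 * (real q + 1)"
      unfolding expect_cmult mb_def
      by (intro mult_left_mono exp_square_mean Y) (use q g0 gK' in auto)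
    also have "\<dots> \<le> 3 * (real q + 1)"
      using exp_le by (intro mult_right_mono) auto
    finally show "expect N r (\<lambda>\<eta>. exp (\<gamma> * real K * (bmean j q i z \<eta> - rr z)\<^sup>2)) \<le> 3 * (real q + 1)" .
  qed
  have np: "(\<Sum>z\<in>sites N. \<Sum>\<eta>\<in>configs N. P \<eta> * no_pair (?Y z) q \<eta>)
      \<le> entropy P / \<gamma> + real (N ^ CARD('d)) * ln (3 * (real q + 1)) / (\<gamma> * real K)"
  proof (rule b1)
    fix z :: "int ^ 'd"
    show "local_on (seg N j n z) (no_pair (?Y z) q)" by (rule local_no_pair) (simp add: n_def)
    have "expect N r (\<lambda>\<eta>. exp (\<gamma> * real K * no_pair (?Y z) q \<eta>)) \<le> 2"
    proof (rule exp_no_pair[where \<delta> = \<delta>])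
      show "inj_on (?Y z) {..<2 * q}" using inj[of 0 "2 * q" z] by (simp add: n_def)
      have "\<delta>\<^sup>2 * real q / 8 \<le> \<delta>\<^sup>2 * real q" by simp
      then show "\<gamma> * real K \<le> \<delta>\<^sup>2 * real q" using gK by linarith
    qed (use N1 \<delta> in auto)
    also have "\<dots> \<le> 3 * (real q + 1)" by simp
    finally show "expect N r (\<lambda>\<eta>. exp (\<gamma> * real K * no_pair (?Y z) q \<eta>)) \<le> 3 * (real q + 1)" .
  qed
  have "(\<Sum>z\<in>sites N. \<Sum>\<eta>\<in>configs N. P \<eta> * psi j q rr z \<eta>) =
      (\<Sum>i<4. \<Sum>z\<in>sites N. \<Sum>\<eta>\<in>configs N. P \<eta> * (bmean j q i z \<eta> - rr z)\<^sup>2)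
      + (\<Sum>z\<in>sites N. \<Sum>\<eta>\<in>configs N. P \<eta> * no_pair (?Y z) q \<eta>)"
    by (simp add: psi_def algebra_simps sum.distrib lessThan_nat_numeral lessThan_Suc)
  also have "\<dots> \<le> (\<Sum>i<4::nat. entropy P / \<gamma> + real (N ^ CARD('d)) * ln (3 * (real q + 1)) / (\<gamma> * real K))
     + (entropy P / \<gamma> + real (N ^ CARD('d)) * ln (3 * (real q + 1)) / (\<gamma> * real K))"
    by (intro add_mono sum_mono np sq) auto
  finally show ?thesis by (simp add: K_def n_def)
qed

end

section \<open>Words and mobile pairs\<close>

text \<open>The exchanges that have positive rate whatever the configuration is outside the word.\<close>

inductive move :: "bool list \<Rightarrow> bool list \<Rightarrow> bool" where
  move1: "move (u @ [True, True, False] @ v) (u @ [True, False, True] @ v)"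
| move2: "move (u @ [True, False, True] @ v) (u @ [False, True, True] @ v)"

abbreviation linked :: "bool list \<Rightarrow> bool list \<Rightarrow> bool" where
  "linked \<equiv> equivclp move"

lemma move_context: "move a b \<Longrightarrow> move (u @ a @ v) (u @ b @ v)"
proof (induction rule: move.induct)
  case (move1 x y)
  then show ?case using move.move1[of "u @ x" "y @ v"] by simp
next
  case (move2 x y)
  then show ?case using move.move2[of "u @ x" "y @ v"] by simp
qed

lemma linked_context: "linked a b \<Longrightarrow> linked (u @ a @ v) (u @ b @ v)"
proof (induction rule: equivclp_induct)
  case (step y z)
  then have "move (u @ y @ v) (u @ z @ v) \<or> move (u @ z @ v) (u @ y @ v)"
    by (auto intro: move_context)
  then show ?case using step.IH by (rule equivclp_into_equivclp[rotated])
qed simp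

lemma linked_left: "linked a b \<Longrightarrow> linked (u @ a) (u @ b)"
  using linked_context[of a b u "[]"] by simp


text \<open>Two moves carry a pair over a hole, 110 to 101 to 011. Over a particle nothing has to
  happen, because three particles read the same either way.\<close>

lemma pair_commutes_letter: "linked ([True, True] @ [b] @ v) ([b] @ [True, True] @ v)"
proof (cases b)
  case False
  have "linked ([True, True, False] @ v) ([True, False, True] @ v)"
    using move1[of "[]" v] by (simp add: r_into_equivclp)
  also have "linked ([True, False, True] @ v) ([False, True, True] @ v)"
    using move2[of "[]" v] by (simp add: r_into_equivclp)
  finally show ?thesis using False by simp
qed simp

lemma pair_commutes: "linked ([True, True] @ u @ v) (u @ [True, True] @ v)"
proof (induction u)
  case (Cons b u)
  have "linked ([True, True] @ [b] @ (u @ v)) ([b] @ [True, True] @ (u @ v))"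
    by (rule pair_commutes_letter)
  also have "linked ([b] @ [True, True] @ u @ v) ([b] @ u @ [True, True] @ v)"
    by (rule linked_left[OF Cons.IH])
  finally show ?case by simp
qed simp

text \<open>The pair is brought next to the two letters, where one of its particles is the outer
  neighbour that the exchange requires, and is sent back.\<close>

lemma swap_behind_pair:
  "linked ([True, True] @ u @ [False, True] @ v) ([True, True] @ u @ [True, False] @ v)"
proof -
  have "linked ([True, True] @ u @ [False, True] @ v) (u @ [True, True] @ [False, True] @ v)"
    by (rule pair_commutes)
  also have "linked (u @ [True, True] @ [False, True] @ v) (u @ [True, True] @ [True, False] @ v)"
    using converse_r_into_equivclp[of move, OF move1[of "u @ [True]" v]] by simp
  also have "linked (u @ [True, True] @ [True, False] @ v) ([True, True] @ u @ [True, False] @ v)"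
    by (rule equivclp_sym[OF pair_commutes])
  finally show ?thesis .
qed

lemma false_commutes_behind_pair:
  "linked ([True, True] @ u @ [False] @ replicate k True @ v) ([True, True] @ u @ replicate k True @ [False] @ v)"
proof (induction k arbitrary: u)
  case (Suc k)
  have "linked ([True, True] @ u @ [False, True] @ (replicate k True @ v)) ([True, True] @ u @ [True, False] @ (replicate k True @ v))"
    by (rule swap_behind_pair)
  also have "linked ([True, True] @ u @ [True, False] @ (replicate k True @ v))
     ([True, True] @ (u @ [True]) @ replicate k True @ [False] @ v)"
    using Suc[of "u @ [True]"] by simp
  finally show ?case by simp
qed simp

text \<open>Insertion sort behind the pair: the pair steps over the head letter, the tail is sorted
  by induction, the pair steps back, and a leading hole is passed through the particles. As the
  normal form depends only on the number of particles, the dynamics is irreducible on such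
  words.\<close>

lemma linked_canonical:
  "linked ([True, True] @ w) ([True, True] @ replicate (count_list w True) True @ replicate (count_list w False) False)"
proof (induction w)
  case (Cons b w)
  let ?k = "count_list w True" and ?l = "count_list w False"
  have "linked ([True, True] @ [b] @ w) ([b] @ [True, True] @ w)"
    by (rule pair_commutes_letter)
  also have "linked \<dots> ([b] @ [True, True] @ replicate ?k True @ replicate ?l False)"
    by (rule linked_left[OF Cons.IH])
  also have "linked \<dots> ([True, True] @ [b] @ replicate ?k True @ replicate ?l False)"
    by (rule equivclp_sym[OF pair_commutes_letter])
  also have "linked \<dots> ([True, True] @ replicate (count_list (b # w) True) True @ replicate (count_list (b # w) False) False)"
    using false_commutes_behind_pair[of "[]" ?k "replicate ?l False"] by (cases b) auto
  finally show ?case by simp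
qed simp

lemma linked_permuted:
  assumes "mset w = mset w'"
  shows "linked ([True, True] @ w) ([True, True] @ w')"
proof -
  have "count_list w b = count_list w' b" for b
    using assms by (metis count_mset)
  with linked_canonical[of w'] have "linked ([True, True] @ w')
      ([True, True] @ replicate (count_list w True) True @ replicate (count_list w False) False)"
    by simp
  then show ?thesis by (rule equivclp_trans[OF linked_canonical equivclp_sym])
qed

definition has_pair :: "bool list \<Rightarrow> bool" where
  "has_pair u \<longleftrightarrow> (\<exists>a b. u = a @ [True, True] @ b)"

text \<open>The pair may stand anywhere in \<open>u\<close>. The letters of \<open>u\<close> behind
  it take part in the sorting and are restored, since both words have the same normal form.\<close>

lemma linked_behind_good:
  assumes "has_pair u" "mset v = mset v'"
  shows "linked (u @ v) (u @ v')"
proof -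
  obtain a b where u: "u = a @ [True, True] @ b" using assms(1) by (auto simp: has_pair_def)
  have "linked ([True, True] @ (b @ v)) ([True, True] @ (b @ v'))"
    by (rule linked_permuted) (use assms(2) in simp)
  from linked_left[OF this, of a] show ?thesis by (simp add: u)
qed

lemma linked_length: "linked a b \<Longrightarrow> length a = length b"
  by (induction rule: equivclp_induct) (auto elim!: move.cases)

section \<open>Replacement by block averages\<close>

definition swap :: "nat \<Rightarrow> nat \<Rightarrow> 'a list \<Rightarrow> 'a list" where
  "swap p p' w = w[p := w ! p', p' := w ! p]"

lemma length_swap [simp]: "length (swap p p' w) = length w"
  by (simp add: swap_def)

lemma nth_swap:
  assumes "p < length w" "p' < length w"
  shows "swap p p' w ! k = (if k = p then w ! p' else if k = p' then w ! p else w ! k)"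
  using assms by (auto simp: swap_def nth_list_update)

lemma swap_swap [simp]:
  assumes "p < length w" "p' < length w"
  shows "swap p p' (swap p p' w) = w"
  by (rule nth_equalityI) (use assms in \<open>auto simp: nth_swap\<close>)

text \<open>The occupied outer neighbour recorded here makes the rate of the corresponding bond at
  least 1, whatever the configuration outside the word.\<close>

lemma move_swap:
  assumes "move w w'"
  obtains i where "i + 1 < length w" "w' = swap i (i + 1) w"
    "(i \<ge> 1 \<and> w ! (i - 1)) \<or> (i + 2 < length w \<and> w ! (i + 2))"
  using assms
proof cases
  case (move1 u v)
  show ?thesis
    by (rule that[of "length u + 1"]) (auto simp: move1 swap_def nth_append list_update_append)
next
  case (move2 u v)
  show ?thesis
    by (rule that[of "length u"]) (auto simp: move2 swap_def nth_append list_update_append)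
qed

text \<open>The complement of \<open>no_pair\<close>, read on words; pairs count only at even
  positions, as they do there.\<close>

definition good :: "nat \<Rightarrow> bool list \<Rightarrow> bool" where
  "good q w \<longleftrightarrow> (\<exists>i<q. w ! (2 * i) \<and> w ! (2 * i + 1))"

lemma good_swap:
  assumes "2 * q \<le> p" "2 * q \<le> p'" "p < length w" "p' < length w"
  shows "good q (swap p p' w) \<longleftrightarrow> good q w"
proof -
  have "swap p p' w ! k = w ! k" if "k < 2 * q" for k
    using that assms by (auto simp: nth_swap)
  then show ?thesis unfolding good_def by (intro ex_cong) auto
qed

lemma good_linked_swap:
  assumes g: "good q w" and p: "2 * q \<le> p" "2 * q \<le> p'" "p < length w" "p' < length w"
  shows "linked w (swap p p' w)"
proof -
  let ?u = "take (2 * q) w"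
  obtain i where i: "i < q" "w ! (2 * i)" "w ! (2 * i + 1)" using g by (auto simp: good_def)
  have "?u = take (2 * i) ?u @ drop (2 * i) ?u" by (rule append_take_drop_id[symmetric])
  also have "drop (2 * i) ?u = ?u ! (2 * i) # ?u ! (2 * i + 1) # drop (2 * i + 2) ?u"
    using i p Cons_nth_drop_Suc[of "2 * i" ?u] Cons_nth_drop_Suc[of "2 * i + 1" ?u] by simp
  finally have "has_pair ?u" using i unfolding has_pair_def by auto
  moreover have "mset (drop (2 * q) w) = mset (drop (2 * q) (swap p p' w))"
  proof -
    have "mset (take (2 * q) w) + mset (drop (2 * q) w) = mset w"
      by (metis append_take_drop_id mset_append)
    moreover have "mset (take (2 * q) (swap p p' w)) + mset (drop (2 * q) (swap p p' w)) = mset (swap p p' w)"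
      by (metis append_take_drop_id mset_append)
    moreover have "mset (swap p p' w) = mset w"
      unfolding swap_def using p mset_swap[of p' w p] by simp
    moreover have "take (2 * q) (swap p p' w) = ?u"
      unfolding swap_def using p by simp
    ultimately show ?thesis by (metis add_left_cancel)
  qed
  ultimately have "linked (?u @ drop (2 * q) w) (?u @ drop (2 * q) (swap p p' w))"
    by (rule linked_behind_good)
  moreover have "?u @ drop (2 * q) (swap p p' w) = swap p p' w"
    using append_take_drop_id[of "2 * q" "swap p p' w"] p by (simp add: swap_def)
  ultimately show ?thesis by simp
qed

definition words :: "nat \<Rightarrow> bool list set" where
  "words n = {w. length w = n}"

lemma finite_words: "finite (words n)"
  using finite_lists_length_eq[of "UNIV :: bool set" n] by (simp add: words_def)

lemma card_words: "card (words n) = 2 ^ n"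
  using card_lists_length_eq[of "UNIV :: bool set" n] by (simp add: words_def)

text \<open>One path is chosen for each of the finitely many pairs of linked words of length
  \<open>n\<close>, and \<open>M\<close> is the largest length; it depends on \<open>n\<close>
  only.\<close>

lemma linked_bounded:
  "\<exists>M. \<forall>w w'. length w = n \<and> linked w w' \<longrightarrow> (\<exists>m\<le>M. (symclp move ^^ m) w w')"
proof -
  let ?S = "{p \<in> words n \<times> words n. linked (fst p) (snd p)}"
  have "\<forall>p\<in>?S. \<exists>m. (symclp move ^^ m) (fst p) (snd p)"
    by (auto simp: equivclp_def dest: rtranclp_imp_relpowp)
  then obtain m where m: "\<forall>p\<in>?S. (symclp move ^^ m p) (fst p) (snd p)"
    by (rule bchoice[THEN exE])
  have fin: "finite ?S" by (rule finite_subset[of _ "words n \<times> words n"]) (auto simp: finite_words)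
  show ?thesis
  proof (rule exI[of _ "Max (m ` ?S)"], intro allI impI)
    fix w w' assume h: "length w = n \<and> linked w w'"
    then have p: "(w, w') \<in> ?S" using linked_length[of w w'] by (simp add: words_def)
    then have "m (w, w') \<le> Max (m ` ?S)" using fin by (intro Max_ge) auto
    with m p show "\<exists>k\<le>Max (m ` ?S). (symclp move ^^ k) w w'" by (intro exI[of _ "m (w, w')"]) force
  qed
qed

lemma relpowp_symclp_move_length: "(symclp move ^^ m) w w' \<Longrightarrow> length w' = length w"
  by (metis equivclp_def linked_length relpowp_imp_rtranclp)

text \<open>Here \<open>v\<close>, \<open>v'\<close> are the weights of two configurations and
  \<open>g\<close>, \<open>g'\<close> the densities of a law. Young's inequality with parameter
  \<open>a\<close>, applied to \<open>sqrt g' - sqrt g\<close> times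
  \<open>sqrt g + sqrt g'\<close>, separates a piece of the Dirichlet form from the masses
  \<open>v * g\<close> and \<open>v' * g'\<close>; the change of the weight itself costs
  \<open>b\<close>.\<close>

lemma sqrt_exchange_bound:
  fixes v v' g g' a b :: real
  assumes "v > 0" "v' > 0" "g \<ge> 0" "g' \<ge> 0" "a > 0" "\<bar>v / v' - 1\<bar> \<le> b" "b \<le> 1"
  shows "\<bar>v * g - v' * g'\<bar> \<le> a * (v * (sqrt g' - sqrt g)\<^sup>2) + v * g / (2 * a) + (1 / a + b) * (v' * g')"
proof -
  have r: "v / v' \<le> 2" "\<bar>v / v' - 1\<bar> \<le> b" using assms by (auto simp: abs_le_iff)
  then have "v / v' * (v' * g') \<le> 2 * (v' * g')" "\<bar>v / v' - 1\<bar> * (v' * g') \<le> b * (v' * g')"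
    using assms by (intro mult_right_mono; simp)+
  moreover have "v / v' * (v' * g') = v * g'" using assms by simp
  moreover have "\<bar>v - v'\<bar> = \<bar>v / v' - 1\<bar> * v'"
    using assms by (simp add: abs_mult_pos left_diff_distrib)
  ultimately have v: "v * g' \<le> 2 * (v' * g')" "\<bar>v - v'\<bar> * g' \<le> b * (v' * g')"
    by (simp_all add: mult.assoc)
  define s t where "s = sqrt g" and "t = sqrt g'"
  have st: "g = s\<^sup>2" "g' = t\<^sup>2" "s \<ge> 0" "t \<ge> 0" using assms by (auto simp: s_def t_def)
  have "\<bar>g - g'\<bar> = \<bar>t - s\<bar> * (s + t)"
    using st by (simp add: power2_eq_square square_diff_square_factored abs_mult abs_minus_commute)
  also have "\<dots> \<le> a * (t - s)\<^sup>2 + (s + t)\<^sup>2 / (4 * a)"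
  proof -
    have "0 \<le> (2 * a * \<bar>t - s\<bar> - (s + t))\<^sup>2 / (4 * a)" using assms by simp
    also have "\<dots> = a * (t - s)\<^sup>2 + (s + t)\<^sup>2 / (4 * a) - \<bar>t - s\<bar> * (s + t)"
      using assms by (simp add: power2_diff power_mult_distrib field_simps) (simp add: power2_eq_square algebra_simps)
    finally show ?thesis by simp
  qed
  also have "(s + t)\<^sup>2 / (4 * a) \<le> (g + g') / (2 * a)"
  proof -
    have "(s + t)\<^sup>2 \<le> 2 * (g + g')"
      using zero_le_power2[of "s - t"] by (simp add: st power2_eq_square algebra_simps)
    then show ?thesis using assms by (simp add: field_simps)
  qed
  finally have "\<bar>g - g'\<bar> \<le> a * (t - s)\<^sup>2 + (g + g') / (2 * a)" by simp
  then have "v * \<bar>g - g'\<bar> \<le> v * (a * (t - s)\<^sup>2 + (g + g') / (2 * a))"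
    using assms by (intro mult_left_mono) auto
  also have "\<dots> = a * (v * (t - s)\<^sup>2) + v * g / (2 * a) + v * g' / (2 * a)"
    by (simp add: algebra_simps add_divide_distrib)
  also have "v * g' / (2 * a) \<le> 1 / a * (v' * g')"
    using v(1) assms by (simp add: field_simps)
  finally have 1: "v * \<bar>g - g'\<bar> \<le> a * (v * (t - s)\<^sup>2) + v * g / (2 * a) + 1 / a * (v' * g')" by simp
  have "\<bar>v * g - v' * g'\<bar> = \<bar>v * (g - g') + (v - v') * g'\<bar>" by (simp add: algebra_simps)
  also have "\<dots> \<le> v * \<bar>g - g'\<bar> + \<bar>v - v'\<bar> * g'"
    using assms by (intro order_trans[OF abs_triangle_ineq]) (simp add: abs_mult)
  finally show ?thesis using 1 v(2) by (simp add: s_def t_def algebra_simps)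
qed

section \<open>The price of one exchange\<close>

context params
begin

definition word_of :: "nat \<Rightarrow> 'd \<Rightarrow> int ^ 'd \<Rightarrow> 'd config \<Rightarrow> bool list" where
  "word_of n j z \<eta> = map (\<lambda>k. \<eta> (shift N j (int k) z)) [0..<n]"

lemma length_word_of [simp]: "length (word_of n j z \<eta>) = n"
  by (simp add: word_of_def)

lemma nth_word_of: "k < n \<Longrightarrow> word_of n j z \<eta> ! k = \<eta> (shift N j (int k) z)"
  by (simp add: word_of_def)

definition word_prob :: "('d config \<Rightarrow> real) \<Rightarrow> nat \<Rightarrow> 'd \<Rightarrow> int ^ 'd \<Rightarrow> bool list \<Rightarrow> real" where
  "word_prob P n j z w = (\<Sum>\<eta>\<in>{\<eta> \<in> configs N. word_of n j z \<eta> = w}. P \<eta>)"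

lemma sum_words:
  "(\<Sum>\<eta>\<in>configs N. P \<eta> * F (word_of n j z \<eta>)) = (\<Sum>w\<in>words n. F w * word_prob P n j z w)"
proof -
  have "(\<Sum>w\<in>words n. F w * word_prob P n j z w) =
      (\<Sum>w\<in>words n. \<Sum>\<eta>\<in>{\<eta> \<in> configs N. word_of n j z \<eta> = w}. P \<eta> * F (word_of n j z \<eta>))"
    unfolding word_prob_def sum_distrib_left by (intro sum.cong refl) (auto simp: mult.commute)
  also have "\<dots> = (\<Sum>\<eta>\<in>configs N. P \<eta> * F (word_of n j z \<eta>))"
    by (rule sum.group) (auto simp: finite_words, simp add: words_def)
  finally show ?thesis ..
qed

text \<open>The contribution of one bond to the Dirichlet form of the square root of the density
  \<open>P / nu\<close>. In general \<open>nu\<close> is not reversible, so the weight is the one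
  before the exchange.\<close>

definition diss :: "('d config \<Rightarrow> real) \<Rightarrow> int ^ 'd \<Rightarrow> 'd \<Rightarrow> real" where
  "diss P x j = (\<Sum>\<eta>\<in>configs N. nu N r \<eta> * bond_rate N x j \<eta> *
     (sqrt (P (bond_swap N x j \<eta>) / nu N r (bond_swap N x j \<eta>)) - sqrt (P \<eta> / nu N r \<eta>))\<^sup>2)"

lemma diss_nonneg: "diss P x j \<ge> 0"
  unfolding diss_def using nu_pos bond_rate_bounds by (intro sum_nonneg mult_nonneg_nonneg) (auto intro: less_imp_le)

lemma word_of_bond_swap:
  assumes "i + 1 < n" "n \<le> N"
  shows "word_of n j z (bond_swap N (shift N j (int i) z) j \<eta>) = swap i (i + 1) (word_of n j z \<eta>)"
proof (rule nth_equalityI)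
  fix k assume "k < length (word_of n j z (bond_swap N (shift N j (int i) z) j \<eta>))"
  then have k: "k < n" by simp
  have "shift N j (int k) z = shift N j (int i + 1) z \<longleftrightarrow> k = i + 1"
    using k assms by (subst shift_inj) auto
  moreover have "shift N j (int k) z = shift N j (int i) z \<longleftrightarrow> k = i"
    using k assms by (subst shift_inj) auto
  ultimately show "word_of n j z (bond_swap N (shift N j (int i) z) j \<eta>) ! k = swap i (i + 1) (word_of n j z \<eta>) ! k"
    using k assms by (auto simp: nth_word_of nth_swap bond_swap_apply shift_shift add.commute)
qed simp

end

text \<open>\<open>P\<close> stands for the law at a fixed time. The assumption \<open>ratio\<close>
  says that one exchange hardly changes the local equilibrium; for a smooth profile
  \<open>\<beta>\<close> can be taken of order \<open>1 / N\<close>.\<close>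

locale near_exchangeable = params N r
  for N :: nat and r :: "int ^ 'd::finite \<Rightarrow> real" +
  fixes P :: "'d config \<Rightarrow> real" and \<beta> :: real
  assumes N3: "N \<ge> 3" and Ppos: "\<And>\<eta>. \<eta> \<in> configs N \<Longrightarrow> P \<eta> > 0" and Psum: "(\<Sum>\<eta>\<in>configs N. P \<eta>) = 1"
    and ratio: "\<And>x j \<eta>. x \<in> sites N \<Longrightarrow> \<eta> \<in> configs N \<Longrightarrow> \<bar>nu N r (bond_swap N x j \<eta>) / nu N r \<eta> - 1\<bar> \<le> \<beta>"
    and \<beta>1: "\<beta> \<le> 1"
begin

lemma partial_sum_le_1: "(\<Sum>\<eta>\<in>{\<eta> \<in> configs N. Q \<eta>}. P \<eta>) \<le> 1"
  unfolding Psum[symmetric] by (rule sum_mono2) (auto intro: less_imp_le Ppos)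

text \<open>The bond exchange maps the configurations that show \<open>w\<close> onto those that
  show the exchanged word, and \<open>free\<close> makes its rate at least 1 there, so
  \<open>sqrt_exchange_bound\<close> controls each difference. The number \<open>3 / 2\<close> is
  \<open>1 / 2 + 1\<close>, the coefficients of two masses that are at most 1.\<close>

lemma swap_cost:
  assumes i: "i + 1 < n" "n \<le> N" and w: "length w = n" and a: "a > 0"
    and free: "(i \<ge> 1 \<and> w ! (i - 1)) \<or> (i + 2 < n \<and> w ! (i + 2))"
  shows "\<bar>word_prob P n j z w - word_prob P n j z (swap i (i + 1) w)\<bar>
    \<le> a * diss P (shift N j (int i) z) j + (3 / (2 * a) + \<beta>)"
proof -
  let ?x = "shift N j (int i) z"
  let ?W = "{\<eta> \<in> configs N. word_of n j z \<eta> = w}"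
  have x: "?x \<in> sites N" using N1 by simp
  have re: "word_prob P n j z (swap i (i + 1) w) = (\<Sum>\<eta>\<in>?W. P (bond_swap N ?x j \<eta>))"
    unfolding word_prob_def
    by (rule sum.reindex_bij_witness[where i = "bond_swap N ?x j" and j = "bond_swap N ?x j"])
       (use i w N1 x in \<open>auto simp: word_of_bond_swap\<close>)
  have br: "bond_rate N ?x j \<eta> \<ge> 1" if "\<eta> \<in> ?W" for \<eta>
    using free
  proof
    assume h: "i \<ge> 1 \<and> w ! (i - 1)"
    then have "\<eta> (shift N j (int (i - 1)) z)" using that i by (auto simp: nth_word_of)
    with h show ?thesis by (simp add: bond_rate_shift shift_shift of_nat_diff)
  next
    assume h: "i + 2 < n \<and> w ! (i + 2)"
    then have "\<eta> (shift N j (int (i + 2)) z)" using that nth_word_of[of "i + 2" n j z \<eta>] by simp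
    then show ?thesis by (simp add: bond_rate_shift shift_shift add.commute)
  qed
  let ?d = "\<lambda>\<eta>. nu N r \<eta> * bond_rate N ?x j \<eta> *
     (sqrt (P (bond_swap N ?x j \<eta>) / nu N r (bond_swap N ?x j \<eta>)) - sqrt (P \<eta> / nu N r \<eta>))\<^sup>2"
  have d0: "?d \<eta> \<ge> 0" for \<eta>
    using nu_pos[of \<eta>] bond_rate_bounds[of N ?x j \<eta>] by simp
  have pt: "\<bar>P \<eta> - P (bond_swap N ?x j \<eta>)\<bar> \<le> a * ?d \<eta> + P \<eta> / (2 * a) + (1 / a + \<beta>) * P (bond_swap N ?x j \<eta>)"
    if \<eta>: "\<eta> \<in> ?W" for \<eta>
  proof -
    let ?e = "bond_swap N ?x j \<eta>" and ?s = "sqrt (P (bond_swap N ?x j \<eta>) / nu N r (bond_swap N ?x j \<eta>)) - sqrt (P \<eta> / nu N r \<eta>)"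
    have c: "\<eta> \<in> configs N" "?e \<in> configs N" using \<eta> x N1 by auto
    have "\<bar>nu N r \<eta> * (P \<eta> / nu N r \<eta>) - nu N r ?e * (P ?e / nu N r ?e)\<bar> \<le>
      a * (nu N r \<eta> * ?s\<^sup>2) + nu N r \<eta> * (P \<eta> / nu N r \<eta>) / (2 * a)
        + (1 / a + \<beta>) * (nu N r ?e * (P ?e / nu N r ?e))"
      using ratio[OF x c(2), of j] Ppos[OF c(1)] Ppos[OF c(2)] a \<beta>1 nu_pos
      by (intro sqrt_exchange_bound) (auto intro!: divide_nonneg_pos less_imp_le)
    moreover have "nu N r \<eta> * 1 * ?s\<^sup>2 \<le> ?d \<eta>"
      using br[OF \<eta>] nu_pos[of \<eta>] by (intro mult_right_mono mult_left_mono) auto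
    then have "a * (nu N r \<eta> * ?s\<^sup>2) \<le> a * ?d \<eta>" using a by (intro mult_left_mono) auto
    ultimately show ?thesis using nu_pos[of \<eta>] nu_pos[of ?e] by (simp add: less_imp_neq[symmetric])
  qed
  have "\<bar>word_prob P n j z w - word_prob P n j z (swap i (i + 1) w)\<bar> \<le> (\<Sum>\<eta>\<in>?W. \<bar>P \<eta> - P (bond_swap N ?x j \<eta>)\<bar>)"
    unfolding re unfolding word_prob_def sum_subtractf[symmetric] by (rule sum_abs)
  also have "\<dots> \<le> (\<Sum>\<eta>\<in>?W. a * ?d \<eta> + P \<eta> / (2 * a) + (1 / a + \<beta>) * P (bond_swap N ?x j \<eta>))"
    by (rule sum_mono) (rule pt)
  also have "\<dots> = a * (\<Sum>\<eta>\<in>?W. ?d \<eta>) + (\<Sum>\<eta>\<in>?W. P \<eta>) / (2 * a) + (1 / a + \<beta>) * (\<Sum>\<eta>\<in>?W. P (bond_swap N ?x j \<eta>))"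
    by (simp only: sum.distrib sum_distrib_left sum_divide_distrib)
  also have "\<dots> \<le> a * diss P ?x j + 1 / (2 * a) + (1 / a + \<beta>) * 1"
  proof (intro add_mono mult_left_mono divide_right_mono)
    show "(\<Sum>\<eta>\<in>?W. ?d \<eta>) \<le> diss P ?x j"
      unfolding diss_def by (rule sum_mono2) (use d0 in auto)
    show "(\<Sum>\<eta>\<in>?W. P (bond_swap N ?x j \<eta>)) \<le> 1"
      unfolding re[symmetric] word_prob_def by (rule partial_sum_le_1)
    obtain \<eta> where e: "\<eta> \<in> (configs N :: 'd config set)" using configs_nonempty by blast
    have "0 \<le> \<beta>" using ratio[OF x e, of j] by (meson abs_ge_zero order_trans)
    then show "0 \<le> 1 / a + \<beta>" using a by simp
  qed (use a partial_sum_le_1 in auto)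
  also have "1 / (2 * a) = 3 / (2 * a) - 1 / a" using a by (simp add: field_simps)
  finally show ?thesis by simp
qed

text \<open>All bonds that start in the segment are included, so that one quantity dominates the
  price of every move, wherever it takes place in the word.\<close>

definition cost :: "nat \<Rightarrow> real \<Rightarrow> 'd \<Rightarrow> int ^ 'd \<Rightarrow> real" where
  "cost n a j z = a * (\<Sum>k<n. diss P (shift N j (int k) z) j) + (3 / (2 * a) + \<beta>)"

lemma \<beta>0: "\<beta> \<ge> 0"
proof -
  obtain \<eta> where e: "\<eta> \<in> (configs N :: 'd config set)" using configs_nonempty by blast
  obtain x where x: "x \<in> (sites N :: (int ^ 'd) set)" using sites_nonempty[OF N1] by blast
  show ?thesis using ratio[OF x e] by (meson abs_ge_zero order_trans)
qed

lemma cost_nonneg: "a > 0 \<Longrightarrow> cost n a j z \<ge> 0"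
  unfolding cost_def using \<beta>0 by (intro add_nonneg_nonneg mult_nonneg_nonneg sum_nonneg diss_nonneg) auto

lemma move_cost:
  assumes "move w w'" "length w = n" "n \<le> N" "a > 0"
  shows "\<bar>word_prob P n j z w - word_prob P n j z w'\<bar> \<le> cost n a j z"
  using assms(1)
proof (rule move_swap)
  fix i assume i: "i + 1 < length w" "w' = swap i (i + 1) w"
    "(i \<ge> 1 \<and> w ! (i - 1)) \<or> (i + 2 < length w \<and> w ! (i + 2))"
  have "diss P (shift N j (int i) z) j \<le> (\<Sum>k<n. diss P (shift N j (int k) z) j)"
    by (rule member_le_sum) (use i assms diss_nonneg in auto)
  then have "a * diss P (shift N j (int i) z) j \<le> a * (\<Sum>k<n. diss P (shift N j (int k) z) j)"
    using assms(4) by (intro mult_left_mono) auto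
  moreover have "\<bar>word_prob P n j z w - word_prob P n j z (swap i (i + 1) w)\<bar>
    \<le> a * diss P (shift N j (int i) z) j + (3 / (2 * a) + \<beta>)"
    by (rule swap_cost) (use i assms in auto)
  ultimately show ?thesis unfolding cost_def i(2) by linarith
qed

lemma linked_cost:
  assumes "(symclp move ^^ m) w w'" "length w = n" "n \<le> N" "a > 0"
  shows "\<bar>word_prob P n j z w - word_prob P n j z w'\<bar> \<le> real m * cost n a j z"
  using assms(1)
proof (induction m arbitrary: w')
  case (Suc m)
  then obtain v where v: "(symclp move ^^ m) w v" "symclp move v w'" by auto
  have l: "length v = n" "length w' = n"
    using relpowp_symclp_move_length[OF v(1)] relpowp_symclp_move_length[OF Suc.prems] assms(2) by auto
  have "\<bar>word_prob P n j z v - word_prob P n j z w'\<bar> \<le> cost n a j z"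
    using v(2)
  proof (rule symclpE)
    assume "move v w'"
    then show ?thesis by (rule move_cost) (use l assms in auto)
  next
    assume "move w' v"
    then have "\<bar>word_prob P n j z w' - word_prob P n j z v\<bar> \<le> cost n a j z"
      by (rule move_cost) (use l assms in auto)
    then show ?thesis by (simp add: abs_minus_commute)
  qed
  with Suc.IH[OF v(1)] show ?case by (simp add: algebra_simps)
qed simp

text \<open>Exchanging two letters is an involution that preserves goodness, so it can be shifted
  from \<open>F\<close> to the word probabilities. Good words reach their exchanged words in at most
  \<open>M\<close> moves, and \<open>2 ^ n\<close> is the crude number of words.\<close>

lemma exchange_words:
  fixes F :: "bool list \<Rightarrow> real"
  assumes M: "\<And>w w'. length w = n \<Longrightarrow> linked w w' \<Longrightarrow> \<exists>m\<le>M. (symclp move ^^ m) w w'"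
    and n: "n \<le> N" and a: "a > 0"
    and p: "2 * q \<le> p" "2 * q \<le> p'" "p < n" "p' < n"
    and F: "\<And>w. length w = n \<Longrightarrow> \<bar>F w\<bar> \<le> 1"
  shows "\<bar>(\<Sum>\<eta>\<in>configs N. P \<eta> * (of_bool (good q (word_of n j z \<eta>)) * F (word_of n j z \<eta>))) -
     (\<Sum>\<eta>\<in>configs N. P \<eta> * (of_bool (good q (word_of n j z \<eta>)) * F (swap p p' (word_of n j z \<eta>))))\<bar>
     \<le> 2 ^ n * (real M * cost n a j z)"
proof -
  let ?p = "word_prob P n j z" and ?g = "\<lambda>w. of_bool (good q w) :: real"
  have "(\<Sum>w\<in>words n. ?g w * F (swap p p' w) * ?p w) = (\<Sum>w\<in>words n. ?g w * F w * ?p (swap p p' w))"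
    by (rule sum.reindex_bij_witness[where i = "swap p p'" and j = "swap p p'"])
       (use p in \<open>auto simp: words_def good_swap\<close>)
  then have "(\<Sum>\<eta>\<in>configs N. P \<eta> * (?g (word_of n j z \<eta>) * F (word_of n j z \<eta>))) -
     (\<Sum>\<eta>\<in>configs N. P \<eta> * (?g (word_of n j z \<eta>) * F (swap p p' (word_of n j z \<eta>))))
     = (\<Sum>w\<in>words n. ?g w * F w * (?p w - ?p (swap p p' w)))"
    using sum_words[of P "\<lambda>w. ?g w * F w" n j z] sum_words[of P "\<lambda>w. ?g w * F (swap p p' w)" n j z]
    by (simp add: right_diff_distrib sum_subtractf)
  also have "\<bar>\<dots>\<bar> \<le> (\<Sum>w\<in>words n. real M * cost n a j z)"
  proof (rule order_trans[OF sum_abs], rule sum_mono)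
    fix w assume w: "w \<in> words n"
    show "\<bar>?g w * F w * (?p w - ?p (swap p p' w))\<bar> \<le> real M * cost n a j z"
    proof (cases "good q w")
      case True
      then have "linked w (swap p p' w)"
        by (rule good_linked_swap) (use w p in \<open>auto simp: words_def\<close>)
      then obtain m where m: "m \<le> M" "(symclp move ^^ m) w (swap p p' w)"
        using M w by (auto simp: words_def)
      have "\<bar>?p w - ?p (swap p p' w)\<bar> \<le> real m * cost n a j z"
        by (rule linked_cost[OF m(2)]) (use w n a in \<open>auto simp: words_def\<close>)
      also have "\<dots> \<le> real M * cost n a j z"
        using m(1) cost_nonneg[OF a] by (intro mult_right_mono) auto
      finally have 1: "\<bar>?p w - ?p (swap p p' w)\<bar> \<le> real M * cost n a j z" .
      have "\<bar>?g w * F w\<bar> \<le> 1" using F w by (simp add: words_def)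
      then have "\<bar>?g w * F w\<bar> * \<bar>?p w - ?p (swap p p' w)\<bar> \<le> 1 * (real M * cost n a j z)"
        using 1 by (intro mult_mono) auto
      then show ?thesis by (simp add: abs_mult)
    qed (use cost_nonneg[OF a] in auto)
  qed
  also have "\<dots> = 2 ^ n * (real M * cost n a j z)" by (simp add: card_words)
  finally show ?thesis .
qed

end

section \<open>Replacement on one segment\<close>

locale replacement = near_exchangeable N r P \<beta>
  for N :: nat and r :: "int ^ 'd::finite \<Rightarrow> real" and P \<beta> +
  fixes q n M :: nat and a \<rho> :: real and j :: 'd and z :: "int ^ 'd"
  assumes q: "q \<ge> 1" and n: "n = 6 * q + 4" and nN: "n \<le> N" and a: "a > 0"
    and \<rho>: "0 \<le> \<rho>" "\<rho> \<le> 1"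
    and M: "\<And>w w'. length w = n \<Longrightarrow> linked w w' \<Longrightarrow> \<exists>m\<le>M. (symclp move ^^ m) w w'"
begin

definition E :: "(bool list \<Rightarrow> real) \<Rightarrow> real" where
  "E F = (\<Sum>\<eta>\<in>configs N. P \<eta> * (of_bool (good q (word_of n j z \<eta>)) * F (word_of n j z \<eta>)))"

definition err :: real where
  "err = 2 ^ n * (real M * cost n a j z)"

text \<open>All letters of the segment are centred at the same \<open>\<rho>\<close>, although the
  density varies along it: an exchange then turns a centred letter exactly into another one. The
  variation is paid for by \<open>\<theta>\<close> in \<open>psi_bound\<close>.\<close>

definition dev :: "nat \<Rightarrow> bool list \<Rightarrow> real" where
  "dev c w = of_bool (w ! c) - \<rho>"

definition mdev :: "nat \<Rightarrow> bool list \<Rightarrow> real" where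
  "mdev i w = (\<Sum>b<q. dev (2 * q + 4 + i * q + b) w) / real q"

lemma abs_dev: "\<bar>dev c w\<bar> \<le> 1"
  using \<rho> by (auto simp: dev_def)

lemma abs_mdev: "\<bar>mdev i w\<bar> \<le> 1"
proof -
  have "\<bar>\<Sum>b<q. dev (2 * q + 4 + i * q + b) w\<bar> \<le> (\<Sum>b<q. 1)"
    by (rule order_trans[OF sum_abs sum_mono]) (rule abs_dev)
  then show ?thesis using q by (simp add: mdev_def)
qed

lemma E_diff: "E (\<lambda>w. F w - G w) = E F - E G"
  by (simp add: E_def algebra_simps sum_subtractf)

lemma block_pos: "i < 4 \<Longrightarrow> b < q \<Longrightarrow> 2 * q + 4 + i * q + b < n"
  unfolding n by (rule block_index)

lemma block_sep:
  assumes "i \<noteq> k" "b < q" "b' < q"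
  shows "2 * q + 4 + i * q + b \<noteq> 2 * q + 4 + k * q + b'"
proof
  assume "2 * q + 4 + i * q + b = 2 * q + 4 + k * q + b'"
  then have "(b + i * q) div q = (b' + k * q) div q" by (simp add: add.commute)
  then show False using assms q by simp
qed

text \<open>\<open>F\<close> does not notice an exchange of the letter \<open>c\<close> with a
  letter of block \<open>i\<close>, so the exchange only moves \<open>dev\<close> to that letter.
  Averaging over the block yields the mean at the price of a single \<open>err\<close>.\<close>

lemma replace_by_mean:
  assumes i: "i < 4" and c: "c < 4"
    and F: "\<And>w. length w = n \<Longrightarrow> \<bar>F w\<bar> \<le> 1"
    and inv: "\<And>w b. length w = n \<Longrightarrow> b < q \<Longrightarrow> F (swap (2 * q + c) (2 * q + 4 + i * q + b) w) = F w"
  shows "\<bar>E (\<lambda>w. F w * dev (2 * q + c) w) - E (\<lambda>w. F w * mdev i w)\<bar> \<le> err"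
proof -
  let ?c = "2 * q + c" and ?b = "\<lambda>b. 2 * q + 4 + i * q + b"
  have cn: "?c < n" using c by (simp add: n)
  have 1: "\<bar>E (\<lambda>w. F w * dev ?c w) - E (\<lambda>w. F w * dev (?b b) w)\<bar> \<le> err" if b: "b < q" for b
  proof -
    have "\<bar>E (\<lambda>w. F w * dev ?c w) - E (\<lambda>w. F (swap ?c (?b b) w) * dev ?c (swap ?c (?b b) w))\<bar> \<le> err"
      unfolding E_def err_def
    proof (rule exchange_words)
      show "\<bar>F w * dev ?c w\<bar> \<le> 1" if "length w = n" for w
        using F[OF that] abs_dev by (simp add: abs_mult mult_le_one)
    qed (use M nN a block_pos[OF i b] cn in auto)
    also have "E (\<lambda>w. F (swap ?c (?b b) w) * dev ?c (swap ?c (?b b) w)) = E (\<lambda>w. F w * dev (?b b) w)"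
      unfolding E_def using inv[OF _ b] block_pos[OF i b] cn by (simp add: dev_def nth_swap)
    finally show ?thesis .
  qed
  have "E (\<lambda>w. F w * mdev i w) = (\<Sum>b<q. E (\<lambda>w. F w * dev (?b b) w)) / real q"
    unfolding E_def mdev_def
    by (subst sum.swap) (simp add: sum_distrib_left sum_divide_distrib algebra_simps)
  then have "E (\<lambda>w. F w * dev ?c w) - E (\<lambda>w. F w * mdev i w) =
      (\<Sum>b<q. E (\<lambda>w. F w * dev ?c w) - E (\<lambda>w. F w * dev (?b b) w)) / real q"
    using q by (simp add: sum_subtractf diff_divide_distrib)
  also have "\<bar>\<dots>\<bar> \<le> (\<Sum>b<q. err) / real q"
    unfolding abs_divide abs_of_nat
    by (intro divide_right_mono order_trans[OF sum_abs] sum_mono 1) auto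
  also have "\<dots> = err" using q by simp
  finally show ?thesis .
qed

lemma dev_swap:
  assumes "length w = n" "p < n" "p' < n" "c \<noteq> p" "c \<noteq> p'"
  shows "dev c (swap p p' w) = dev c w"
  using assms by (simp add: dev_def nth_swap)

text \<open>Both letters are replaced by the mean of the same block, which cancels.\<close>

lemma E_linear:
  assumes "c < 4" "c' < 4"
  shows "\<bar>E (\<lambda>w. dev (2 * q + c) w - dev (2 * q + c') w)\<bar> \<le> 2 * err"
  using replace_by_mean[of 0 c "\<lambda>_. 1"] replace_by_mean[of 0 c' "\<lambda>_. 1"] assms
  by (simp add: E_diff)

text \<open>The two letters go to different blocks, 0 and 1: the second replacement then leaves the
  mean produced by the other one intact, as the invariance hypothesis of
  \<open>replace_by_mean\<close> demands. The product of the means is bounded by the sum of their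
  squares.\<close>

lemma E_product:
  assumes c: "c < 4" "c' < 4" "c \<noteq> c'"
    and G: "\<And>w. length w = n \<Longrightarrow> \<bar>G w\<bar> \<le> 1"
    and inv: "\<And>w i b. length w = n \<Longrightarrow> i < 4 \<Longrightarrow> b < q \<Longrightarrow> G (swap (2 * q + c) (2 * q + 4 + i * q + b) w) = G w"
      "\<And>w i b. length w = n \<Longrightarrow> i < 4 \<Longrightarrow> b < q \<Longrightarrow> G (swap (2 * q + c') (2 * q + 4 + i * q + b) w) = G w"
  shows "\<bar>E (\<lambda>w. G w * dev (2 * q + c) w * dev (2 * q + c') w)\<bar>
    \<le> E (\<lambda>w. (mdev 0 w)\<^sup>2 + (mdev 1 w)\<^sup>2) + 2 * err"
proof -
  have 1: "\<bar>E (\<lambda>w. (G w * dev (2 * q + c') w) * dev (2 * q + c) w) - E (\<lambda>w. (G w * dev (2 * q + c') w) * mdev 0 w)\<bar> \<le> err"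
  proof (rule replace_by_mean)
    show "\<bar>G w * dev (2 * q + c') w\<bar> \<le> 1" if "length w = n" for w
      using G[OF that] abs_dev by (simp add: abs_mult mult_le_one)
    show "G (swap (2 * q + c) (2 * q + 4 + 0 * q + b) w) * dev (2 * q + c') (swap (2 * q + c) (2 * q + 4 + 0 * q + b) w) =
        G w * dev (2 * q + c') w" if "length w = n" "b < q" for w b
      using inv(1)[of w 0 b] that c block_pos[of 0 b] by (simp add: dev_swap n)
  qed (use c in auto)
  have 2: "\<bar>E (\<lambda>w. (G w * mdev 0 w) * dev (2 * q + c') w) - E (\<lambda>w. (G w * mdev 0 w) * mdev 1 w)\<bar> \<le> err"
  proof (rule replace_by_mean)
    show "\<bar>G w * mdev 0 w\<bar> \<le> 1" if "length w = n" for w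
      using G[OF that] abs_mdev by (simp add: abs_mult mult_le_one)
    fix w :: "bool list" and b assume w: "length w = n" "b < q"
    have "mdev 0 (swap (2 * q + c') (2 * q + 4 + 1 * q + b) w) = mdev 0 w"
      unfolding mdev_def
      by (intro arg_cong2[where f = "(/)"] sum.cong refl dev_swap)
         (use w c block_sep[of 0 1 _ b] block_pos[of 1 b] in \<open>auto simp: n\<close>)
    then show "G (swap (2 * q + c') (2 * q + 4 + 1 * q + b) w) * mdev 0 (swap (2 * q + c') (2 * q + 4 + 1 * q + b) w) = G w * mdev 0 w"
      using inv(2)[of w 1 b] w by simp
  qed (use c in auto)
  have 3: "\<bar>E (\<lambda>w. (G w * mdev 0 w) * mdev 1 w)\<bar> \<le> E (\<lambda>w. (mdev 0 w)\<^sup>2 + (mdev 1 w)\<^sup>2)"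
    unfolding E_def
  proof (rule order_trans[OF sum_abs], rule sum_mono)
    fix \<eta> :: "'d config" assume e: "\<eta> \<in> configs N"
    let ?w = "word_of n j z \<eta>"
    have "\<bar>G ?w\<bar> * (\<bar>mdev 0 ?w\<bar> * \<bar>mdev 1 ?w\<bar>) \<le> 1 * (\<bar>mdev 0 ?w\<bar> * \<bar>mdev 1 ?w\<bar>)"
      using G[of ?w] by (intro mult_right_mono) auto
    also have "\<dots> \<le> (mdev 0 ?w)\<^sup>2 + (mdev 1 ?w)\<^sup>2"
    proof -
      have "2 * (\<bar>mdev 0 ?w\<bar> * \<bar>mdev 1 ?w\<bar>) \<le> (mdev 0 ?w)\<^sup>2 + (mdev 1 ?w)\<^sup>2"
        using zero_le_power2[of "\<bar>mdev 0 ?w\<bar> - \<bar>mdev 1 ?w\<bar>"] by (simp add: power2_diff)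
      moreover have "0 \<le> \<bar>mdev 0 ?w\<bar> * \<bar>mdev 1 ?w\<bar>" by simp
      ultimately show ?thesis by linarith
    qed
    finally have "\<bar>(G ?w * mdev 0 ?w) * mdev 1 ?w\<bar> \<le> (mdev 0 ?w)\<^sup>2 + (mdev 1 ?w)\<^sup>2"
      by (simp add: abs_mult mult.assoc)
    then show "\<bar>P \<eta> * (of_bool (good q ?w) * (G ?w * mdev 0 ?w * mdev 1 ?w))\<bar> \<le>
       P \<eta> * (of_bool (good q ?w) * ((mdev 0 ?w)\<^sup>2 + (mdev 1 ?w)\<^sup>2))"
      using Ppos[OF e] by (auto simp: abs_mult)
  qed
  have "E (\<lambda>w. G w * dev (2 * q + c) w * dev (2 * q + c') w) = E (\<lambda>w. (G w * dev (2 * q + c') w) * dev (2 * q + c) w)"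
    by (simp add: mult_ac)
  moreover have "E (\<lambda>w. (G w * dev (2 * q + c') w) * mdev 0 w) = E (\<lambda>w. (G w * mdev 0 w) * dev (2 * q + c') w)"
    by (simp add: mult_ac)
  ultimately show ?thesis using 1 2 3 by linarith
qed


lemma good_bad_split:
  assumes F: "\<And>w. length w = n \<Longrightarrow> \<bar>F w\<bar> \<le> 1"
  shows "\<bar>\<Sum>\<eta>\<in>configs N. P \<eta> * F (word_of n j z \<eta>)\<bar> \<le> \<bar>E F\<bar> +
    (\<Sum>\<eta>\<in>configs N. P \<eta> * no_pair (\<lambda>k. shift N j (int k) z) q \<eta>)"
proof -
  have np: "no_pair (\<lambda>k. shift N j (int k) z) q \<eta> = 1 - of_bool (good q (word_of n j z \<eta>))" for \<eta>
  proof -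
    have "2 * i + 1 < n" "2 * i < n" if "i < q" for i using that by (simp_all add: n)
    then have "good q (word_of n j z \<eta>) \<longleftrightarrow> (\<exists>i<q. \<eta> (shift N j (int (2 * i)) z) \<and> \<eta> (shift N j (int (2 * i + 1)) z))"
      unfolding good_def by (intro ex_cong1) (auto simp: nth_word_of)
    then show ?thesis unfolding no_pair_eq by auto
  qed
  have "(\<Sum>\<eta>\<in>configs N. P \<eta> * F (word_of n j z \<eta>)) = E F + (\<Sum>\<eta>\<in>configs N. P \<eta> * ((1 - of_bool (good q (word_of n j z \<eta>))) * F (word_of n j z \<eta>)))"
    unfolding E_def sum.distrib[symmetric] by (simp add: algebra_simps)
  moreover have "\<bar>\<Sum>\<eta>\<in>configs N. P \<eta> * ((1 - of_bool (good q (word_of n j z \<eta>))) * F (word_of n j z \<eta>))\<bar>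
     \<le> (\<Sum>\<eta>\<in>configs N. P \<eta> * no_pair (\<lambda>k. shift N j (int k) z) q \<eta>)"
  proof (rule order_trans[OF sum_abs], rule sum_mono)
    fix \<eta> :: "'d config" assume e: "\<eta> \<in> configs N"
    show "\<bar>P \<eta> * ((1 - of_bool (good q (word_of n j z \<eta>))) * F (word_of n j z \<eta>))\<bar> \<le> P \<eta> * no_pair (\<lambda>k. shift N j (int k) z) q \<eta>"
      unfolding np using Ppos[OF e] F[of "word_of n j z \<eta>"] by (auto simp: abs_mult)
  qed
  ultimately show ?thesis by linarith
qed

lemma E_means_le_psi:
  assumes "rr z = \<rho>"
  shows "E (\<lambda>w. (mdev 0 w)\<^sup>2 + (mdev 1 w)\<^sup>2) + (\<Sum>\<eta>\<in>configs N. P \<eta> * no_pair (\<lambda>k. shift N j (int k) z) q \<eta>)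
    \<le> (\<Sum>\<eta>\<in>configs N. P \<eta> * psi j q rr z \<eta>)"
  unfolding E_def sum.distrib[symmetric]
proof (rule sum_mono)
  fix \<eta> :: "'d config" assume e: "\<eta> \<in> configs N"
  let ?w = "word_of n j z \<eta>"
  have m: "mdev i ?w = bmean j q i z \<eta> - rr z" if "i < 4" for i
  proof -
    have "dev (2 * q + 4 + i * q + b) ?w = occ j z (2 * q + 4 + i * q + b) \<eta> - \<rho>" if "b < q" for b
      using block_pos[OF \<open>i < 4\<close> that] by (simp add: dev_def occ_def nth_word_of)
    then show ?thesis using q by (simp add: mdev_def bmean_def assms sum_subtractf diff_divide_distrib)
  qed
  have "of_bool (good q ?w) * ((mdev 0 ?w)\<^sup>2 + (mdev 1 ?w)\<^sup>2) \<le> (mdev 0 ?w)\<^sup>2 + (mdev 1 ?w)\<^sup>2"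
    by simp
  also have "\<dots> \<le> (\<Sum>i<4. (bmean j q i z \<eta> - rr z)\<^sup>2)"
    using m[of 0] m[of 1] by (simp add: lessThan_nat_numeral lessThan_Suc)
  finally have "of_bool (good q ?w) * ((mdev 0 ?w)\<^sup>2 + (mdev 1 ?w)\<^sup>2) + no_pair (\<lambda>k. shift N j (int k) z) q \<eta> \<le> psi j q rr z \<eta>"
    by (simp add: psi_def)
  then have "P \<eta> * (of_bool (good q ?w) * ((mdev 0 ?w)\<^sup>2 + (mdev 1 ?w)\<^sup>2) + no_pair (\<lambda>k. shift N j (int k) z) q \<eta>) \<le> P \<eta> * psi j q rr z \<eta>"
    using Ppos[OF e] by (intro mult_left_mono) auto
  then show "P \<eta> * (of_bool (good q ?w) * ((mdev 0 ?w)\<^sup>2 + (mdev 1 ?w)\<^sup>2)) + P \<eta> * no_pair (\<lambda>k. shift N j (int k) z) q \<eta>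
     \<le> P \<eta> * psi j q rr z \<eta>"
    by (simp add: algebra_simps)
qed

end

context params
begin

definition avg :: "('d config \<Rightarrow> real) \<Rightarrow> ('d config \<Rightarrow> real) \<Rightarrow> real" where
  "avg P f = (\<Sum>\<eta>\<in>configs N. P \<eta> * f \<eta>)"

lemma avg_add: "avg P (\<lambda>\<eta>. f \<eta> + g \<eta>) = avg P f + avg P g"
  by (simp add: avg_def algebra_simps sum.distrib)

lemma avg_diff: "avg P (\<lambda>\<eta>. f \<eta> - g \<eta>) = avg P f - avg P g"
  by (simp add: avg_def algebra_simps sum_subtractf)

lemma avg_cmult: "avg P (\<lambda>\<eta>. c * f \<eta>) = c * avg P f"
  by (simp add: avg_def sum_distrib_left mult_ac)

lemma avg_sum: "avg P (\<lambda>\<eta>. \<Sum>i\<in>I. f i \<eta>) = (\<Sum>i\<in>I. avg P (f i))"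
  unfolding avg_def sum_distrib_left by (rule sum.swap)

definition dv :: "'d \<Rightarrow> int ^ 'd \<Rightarrow> int \<Rightarrow> 'd config \<Rightarrow> real" where
  "dv j x k \<eta> = of_bool (\<eta> (shift N j k x)) - r x"

text \<open>Such a difference moves a linear term from one site to another; its average is
  controlled by the same bound as that of a product of centred variables.\<close>

definition dv_lin :: "'d \<Rightarrow> int ^ 'd \<Rightarrow> int \<Rightarrow> int \<Rightarrow> 'd config \<Rightarrow> real" where
  "dv_lin j x k l \<eta> = dv j x k \<eta> - dv j x l \<eta>"

definition dv2 :: "'d \<Rightarrow> int ^ 'd \<Rightarrow> int \<Rightarrow> int \<Rightarrow> 'd config \<Rightarrow> real" where
  "dv2 j x k l \<eta> = dv j x k \<eta> * dv j x l \<eta>"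

definition dv3 :: "'d \<Rightarrow> int ^ 'd \<Rightarrow> int \<Rightarrow> int \<Rightarrow> int \<Rightarrow> 'd config \<Rightarrow> real" where
  "dv3 j x k l m \<eta> = dv j x m \<eta> * dv j x k \<eta> * dv j x l \<eta>"

end

context replacement
begin

definition bnd :: real where
  "bnd = avg P (psi j q (\<lambda>z. r (shift N j (2 * int q + 1) z)) z) + 2 * err"

lemma word_bound:
  assumes F: "\<And>w. length w = n \<Longrightarrow> \<bar>F w\<bar> \<le> 1"
    and EF: "\<bar>E F\<bar> \<le> E (\<lambda>w. (mdev 0 w)\<^sup>2 + (mdev 1 w)\<^sup>2) + 2 * err"
    and rho: "\<rho> = r (shift N j (2 * int q + 1) z)"
  shows "\<bar>avg P (\<lambda>\<eta>. F (word_of n j z \<eta>))\<bar> \<le> bnd"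
  using good_bad_split[OF F] EF E_means_le_psi[of "\<lambda>z. r (shift N j (2 * int q + 1) z)"] rho
  unfolding bnd_def avg_def by fastforce

lemma E_means_nonneg: "0 \<le> E (\<lambda>w. (mdev 0 w)\<^sup>2 + (mdev 1 w)\<^sup>2)"
  unfolding E_def by (intro sum_nonneg mult_nonneg_nonneg less_imp_le[OF Ppos]) auto

end

section \<open>Averages of local products around one site\<close>

context near_exchangeable
begin

context
  fixes q n M :: nat and a :: real and j :: 'd and x :: "int ^ 'd"
  assumes q: "q \<ge> 1" and n: "n = 6 * q + 4" and nN: "n \<le> N" and a: "a > 0"
    and M: "\<And>w w'. length w = n \<Longrightarrow> linked w w' \<Longrightarrow> \<exists>m\<le>M. (symclp move ^^ m) w w'"
    and x: "x \<in> sites N"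
begin

text \<open>The offset \<open>2 * q + 1\<close> makes \<open>x\<close> the second of the four middle
  letters, so the letter \<open>c\<close> of these sits at distance \<open>int c - 1\<close> from
  \<open>x\<close>.\<close>

definition start :: "int ^ 'd" where
  "start = shift N j (- (2 * int q + 1)) x"

interpretation R: replacement N r P \<beta> q n M a "r x" j "start"
  by standard (use q n nN a M r01[OF x] in auto)

lemma start_center: "shift N j (2 * int q + 1) start = x"
  by (simp add: start_def shift_shift shift_0[OF x])

lemma dev_eq_dv: "c < 4 \<Longrightarrow> R.dev (2 * q + c) (word_of n j start \<eta>) = dv j x (int c - 1) \<eta>"
  by (simp add: R.dev_def dv_def nth_word_of n start_def shift_shift)

definition site_bound :: real where
  "site_bound = avg P (psi j q (\<lambda>z. r (shift N j (2 * int q + 1) z)) start) + 2 * (2 ^ n * (real M * cost n a j start))"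

lemma bnd_eq: "R.bnd = site_bound"
  by (simp add: R.bnd_def site_bound_def R.err_def)

lemma site_lin:
  assumes "c < 4" "c' < 4"
  shows "\<bar>avg P (dv_lin j x (int c - 1) (int c' - 1))\<bar> \<le> site_bound"
proof -
  have "\<bar>avg P (\<lambda>\<eta>. R.dev (2 * q + c) (word_of n j start \<eta>) - R.dev (2 * q + c') (word_of n j start \<eta>))\<bar> \<le> R.bnd"
    by (rule R.word_bound)
       (use R.E_linear[OF assms] R.E_means_nonneg start_center in \<open>auto simp: R.dev_def\<close>)
  then show ?thesis using assms by (simp add: dev_eq_dv dv_lin_def[abs_def] bnd_eq)
qed

lemma site_quad:
  assumes c: "c < 4" "c' < 4" "c \<noteq> c'"
  shows "\<bar>avg P (dv2 j x (int c - 1) (int c' - 1))\<bar> \<le> site_bound"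
proof -
  have "\<bar>avg P (\<lambda>\<eta>. 1 * R.dev (2 * q + c) (word_of n j start \<eta>) * R.dev (2 * q + c') (word_of n j start \<eta>))\<bar> \<le> R.bnd"
  proof (rule R.word_bound)
    show "\<bar>R.E (\<lambda>w. 1 * R.dev (2 * q + c) w * R.dev (2 * q + c') w)\<bar> \<le> R.E (\<lambda>w. (R.mdev 0 w)\<^sup>2 + (R.mdev 1 w)\<^sup>2) + 2 * R.err"
      by (rule R.E_product) (use c in auto)
    show "\<bar>1 * R.dev (2 * q + c) w * R.dev (2 * q + c') w\<bar> \<le> 1" for w
      using R.abs_dev by (simp add: abs_mult mult_le_one)
  qed (simp add: start_center)
  then show ?thesis using c by (simp add: dev_eq_dv dv2_def[abs_def] bnd_eq)
qed

lemma site_cubic: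
  assumes c: "c < 4" "c' < 4" "c'' < 4" "c \<noteq> c'" "c'' \<noteq> c" "c'' \<noteq> c'"
  shows "\<bar>avg P (dv3 j x (int c - 1) (int c' - 1) (int c'' - 1))\<bar> \<le> site_bound"
proof -
  have "\<bar>avg P (\<lambda>\<eta>. R.dev (2 * q + c'') (word_of n j start \<eta>) * R.dev (2 * q + c) (word_of n j start \<eta>) * R.dev (2 * q + c') (word_of n j start \<eta>))\<bar> \<le> R.bnd"
  proof (rule R.word_bound)
    show "\<bar>R.E (\<lambda>w. R.dev (2 * q + c'') w * R.dev (2 * q + c) w * R.dev (2 * q + c') w)\<bar> \<le> R.E (\<lambda>w. (R.mdev 0 w)\<^sup>2 + (R.mdev 1 w)\<^sup>2) + 2 * R.err"
      by (rule R.E_product; (intro R.dev_swap R.abs_dev)?)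
         (use c R.block_pos in \<open>auto simp: n\<close>)
    show "\<bar>R.dev (2 * q + c'') w * R.dev (2 * q + c) w * R.dev (2 * q + c') w\<bar> \<le> 1" for w
      using R.abs_dev by (simp add: abs_mult mult_le_one)
  qed (simp add: start_center)
  then show ?thesis using c by (simp add: dev_eq_dv dv3_def[abs_def] bnd_eq)
qed

end

end

section \<open>Current and mobility around the local density\<close>

context params
begin

text \<open>The function whose discrete gradient is the current, see \<open>curr_gradient\<close>.\<close>

definition curr :: "'d \<Rightarrow> int ^ 'd \<Rightarrow> 'd config \<Rightarrow> real" where
  "curr j x \<eta> = (let b = (\<lambda>k. of_bool (\<eta> (shift N j k x))) in b 0 * b 1 + b 0 * b (-1) - b (-1) * b 1)"

text \<open>The quadratic variation of a bond. At constant density \<open>r\<close> its mean is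
  \<open>4 * r\<^sup>2 * (1 - r)\<close>.\<close>

definition mob :: "'d \<Rightarrow> int ^ 'd \<Rightarrow> 'd config \<Rightarrow> real" where
  "mob j x \<eta> = bond_rate N x j \<eta> * (of_bool (\<eta> (shift N j 0 x)) - of_bool (\<eta> (shift N j 1 x)))\<^sup>2"

definition curr_rem :: "'d \<Rightarrow> int ^ 'd \<Rightarrow> 'd config \<Rightarrow> real" where
  "curr_rem j x \<eta> = dv2 j x 0 1 \<eta> + dv2 j x 0 (-1) \<eta> - dv2 j x (-1) 1 \<eta>"

definition mob_rem :: "'d \<Rightarrow> int ^ 'd \<Rightarrow> 'd config \<Rightarrow> real" where
  "mob_rem j x \<eta> = 2 * r x * (1 - r x) * (dv_lin j x (-1) 0 \<eta> + dv_lin j x 2 0 \<eta>)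
     + 2 * r x * (1 - 2 * r x) * dv_lin j x 1 0 \<eta>
     + (1 - 2 * r x) * (dv2 j x (-1) 0 \<eta> + dv2 j x (-1) 1 \<eta> + dv2 j x 2 0 \<eta> + dv2 j x 2 1 \<eta>)
     - 4 * r x * dv2 j x 0 1 \<eta> - 2 * (dv3 j x 0 1 (-1) \<eta> + dv3 j x 0 1 2 \<eta>)"

text \<open>The constant is the mean of \<open>curr\<close> at constant density \<open>r x\<close>,
  and the linear coefficient is its derivative. The linear contributions of the two neighbours
  cancel among the three products, so that only \<open>x\<close> remains.\<close>

lemma curr_expand: "curr j x \<eta> = (r x)\<^sup>2 + 2 * r x * dv j x 0 \<eta> + curr_rem j x \<eta>"
  by (simp add: curr_def curr_rem_def dv2_def dv_def Let_def power2_eq_square algebra_simps)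

text \<open>Here four sites share the linear part, with total coefficient
  \<open>8 * r x - 12 * (r x)\<^sup>2\<close>, the derivative of the mean. Collecting it at
  \<open>x\<close> creates the differences \<open>dv_lin\<close> in \<open>mob_rem\<close>.\<close>

lemma mob_expand:
  "mob j x \<eta> = 4 * (r x)\<^sup>2 * (1 - r x) + (8 * r x - 12 * (r x)\<^sup>2) * dv j x 0 \<eta> + mob_rem j x \<eta>"
proof -
  define o0 o1 om o2 where "o0 = (of_bool (\<eta> (shift N j 0 x)) :: real)" and "o1 = (of_bool (\<eta> (shift N j 1 x)) :: real)"
    and "om = (of_bool (\<eta> (shift N j (-1) x)) :: real)" and "o2 = (of_bool (\<eta> (shift N j 2 x)) :: real)"
  have sq: "(o0 - o1)\<^sup>2 = o0 + o1 - 2 * o0 * o1" by (auto simp: o0_def o1_def)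
  have "mob j x \<eta> = (om + o2) * (o0 + o1 - 2 * o0 * o1)"
    unfolding sq[symmetric] by (simp add: mob_def bond_rate_shift o0_def o1_def om_def o2_def)
  also have "\<dots> = 4 * (r x)\<^sup>2 * (1 - r x) + (8 * r x - 12 * (r x)\<^sup>2) * (o0 - r x) + mob_rem j x \<eta>"
    unfolding mob_rem_def dv_lin_def dv2_def dv3_def dv_def
    unfolding o0_def[symmetric] o1_def[symmetric] om_def[symmetric] o2_def[symmetric]
    by (simp add: power2_eq_square algebra_simps)
  finally show ?thesis by (simp add: dv_def o0_def)
qed

end

context near_exchangeable
begin

lemma curr_rem_bound:
  assumes "q \<ge> 1" "n = 6 * q + 4" "n \<le> N" "a > 0" "x \<in> sites N"
    "\<And>w w'. length w = n \<Longrightarrow> linked w w' \<Longrightarrow> \<exists>m\<le>M. (symclp move ^^ m) w w'"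
  shows "\<bar>avg P (curr_rem j x)\<bar> \<le> 3 * site_bound q n M a j x"
proof -
  note s = site_quad[OF assms(1,2,3,4) assms(6) assms(5)]
  have "avg P (curr_rem j x) = avg P (dv2 j x 0 1) + avg P (dv2 j x 0 (-1)) - avg P (dv2 j x (-1) 1)"
    unfolding curr_rem_def[abs_def] by (simp add: avg_add avg_diff)
  then show ?thesis
    using s[of 1 2 j] s[of 1 0 j] s[of 0 2 j] by simp
qed

text \<open>Four of the five groups of terms cost 4 site bounds each and one costs 2; the total 18
  is rounded up to 20.\<close>

lemma mob_rem_bound:
  assumes "q \<ge> 1" "n = 6 * q + 4" "n \<le> N" "a > 0" "x \<in> sites N"
    "\<And>w w'. length w = n \<Longrightarrow> linked w w' \<Longrightarrow> \<exists>m\<le>M. (symclp move ^^ m) w w'"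
  shows "\<bar>avg P (mob_rem j x)\<bar> \<le> 20 * site_bound q n M a j x"
proof -
  let ?B = "site_bound q n M a j x"
  note s = site_quad[OF assms(1,2,3,4) assms(6) assms(5)]
  note l = site_lin[OF assms(1,2,3,4) assms(6) assms(5)]
  note t = site_cubic[OF assms(1,2,3,4) assms(6) assms(5)]
  have c: "\<bar>k * y\<bar> \<le> K * B" if "\<bar>k\<bar> \<le> K" "\<bar>y\<bar> \<le> B" for k y K B :: real
    unfolding abs_mult using that by (intro mult_mono) auto
  have r: "0 < r x" "r x < 1" using r01[OF assms(5)] by auto
  have k: "\<bar>2 * r x * (1 - r x)\<bar> \<le> 2" "\<bar>2 * r x * (1 - 2 * r x)\<bar> \<le> 2" "\<bar>1 - 2 * r x\<bar> \<le> 1" "\<bar>4 * r x\<bar> \<le> 4"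
  proof -
    have "r x * (1 - r x) \<le> 1 * 1" using r by (intro mult_mono) auto
    moreover have "0 \<le> r x * (1 - r x)" using r by simp
    ultimately show "\<bar>2 * r x * (1 - r x)\<bar> \<le> 2" by (simp add: mult.assoc)
    have "\<bar>r x * (1 - 2 * r x)\<bar> \<le> 1 * 1" unfolding abs_mult using r by (intro mult_mono) auto
    then show "\<bar>2 * r x * (1 - 2 * r x)\<bar> \<le> 2" by (simp add: mult.assoc abs_mult)
  qed (use r in auto)
  have "avg P (mob_rem j x) = 2 * r x * (1 - r x) * (avg P (dv_lin j x (-1) 0) + avg P (dv_lin j x 2 0))
     + 2 * r x * (1 - 2 * r x) * avg P (dv_lin j x 1 0)
     + (1 - 2 * r x) * (avg P (dv2 j x (-1) 0) + avg P (dv2 j x (-1) 1) + avg P (dv2 j x 2 0) + avg P (dv2 j x 2 1))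
     - 4 * r x * avg P (dv2 j x 0 1) - 2 * (avg P (dv3 j x 0 1 (-1)) + avg P (dv3 j x 0 1 2))"
    unfolding mob_rem_def[abs_def] by (simp add: avg_add avg_diff avg_cmult)
  moreover have "\<bar>2 * r x * (1 - r x) * (avg P (dv_lin j x (-1) 0) + avg P (dv_lin j x 2 0))\<bar> \<le> 2 * (2 * ?B)"
    using l[of 0 1 j] l[of 3 1 j] by (intro c k) simp
  moreover have "\<bar>2 * r x * (1 - 2 * r x) * avg P (dv_lin j x 1 0)\<bar> \<le> 2 * ?B"
    using l[of 2 1 j] by (intro c k) simp
  moreover have "\<bar>(1 - 2 * r x) * (avg P (dv2 j x (-1) 0) + avg P (dv2 j x (-1) 1) + avg P (dv2 j x 2 0) + avg P (dv2 j x 2 1))\<bar> \<le> 1 * (4 * ?B)"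
    using s[of 0 1 j] s[of 0 2 j] s[of 3 1 j] s[of 3 2 j] by (intro c k) simp
  moreover have "\<bar>4 * r x * avg P (dv2 j x 0 1)\<bar> \<le> 4 * ?B"
    using s[of 1 2 j] by (intro c k) simp
  moreover have "\<bar>2 * (avg P (dv3 j x 0 1 (-1)) + avg P (dv3 j x 0 1 2))\<bar> \<le> 2 * (2 * ?B)"
    using t[of 1 2 0 j] t[of 1 2 3 j] by (intro c) simp_all
  moreover have "?B \<ge> 0" by (rule order_trans[OF abs_ge_zero s[of 0 1 j]]) simp_all
  ultimately show ?thesis by linarith
qed

definition total_diss :: "'d \<Rightarrow> real" where
  "total_diss j = (\<Sum>x\<in>sites N. diss P x j)"

text \<open>Passing from the site to the start of its segment is a bijection of the torus. Each bond
  belongs to \<open>n\<close> of these segments, whence \<open>n * total_diss\<close>.\<close>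

lemma total_bound:
  assumes q: "q \<ge> 1" "n = 6 * q + 4" "n \<le> N" and a: "a > 0"
    and \<delta>: "\<delta> > 0" "\<And>x. x \<in> sites N \<Longrightarrow> \<delta> \<le> r x" and \<gamma>: "\<gamma> = \<delta>\<^sup>2 / 160"
    and \<theta>: "\<And>x k. x \<in> sites N \<Longrightarrow> \<bar>k\<bar> < int n \<Longrightarrow> \<bar>r (shift N j k x) - r x\<bar> \<le> \<theta>"
      "40 * \<gamma> * real q * \<theta>\<^sup>2 \<le> 1"
    and M: "\<And>w w'. length w = n \<Longrightarrow> linked w w' \<Longrightarrow> \<exists>m\<le>M. (symclp move ^^ m) w w'"
  shows "(\<Sum>x\<in>sites N. site_bound q n M a j x) \<le>
    5 * (entropy P / \<gamma> + real (N ^ CARD('d)) * ln (3 * (real q + 1)) / (\<gamma> * real (2 * n)))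
    + 2 * (2 ^ n * (real M * (a * (real n * total_diss j) + real (N ^ CARD('d)) * (3 / (2 * a) + \<beta>))))"
proof -
  let ?rr = "\<lambda>z. r (shift N j (2 * int q + 1) z)"
  have s: "site_bound q n M a j x = avg P (psi j q ?rr (shift N j (- (2 * int q + 1)) x))
     + 2 * (2 ^ n * (real M * cost n a j (shift N j (- (2 * int q + 1)) x)))" if "x \<in> sites N" for x
    using site_bound_def[OF q a M that] start_def[OF q a M that] by simp
  have "(\<Sum>x\<in>sites N. site_bound q n M a j x) =
     (\<Sum>x\<in>sites N. avg P (psi j q ?rr (shift N j (- (2 * int q + 1)) x))
     + 2 * (2 ^ n * (real M * cost n a j (shift N j (- (2 * int q + 1)) x))))"
    by (rule sum.cong) (use s in auto)
  also have "\<dots> = (\<Sum>z\<in>sites N. avg P (psi j q ?rr z) + 2 * (2 ^ n * (real M * cost n a j z)))"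
    by (rule sum_shift[OF N1])
  also have "\<dots> = (\<Sum>z\<in>sites N. avg P (psi j q ?rr z)) + 2 * (2 ^ n * (real M * (\<Sum>z\<in>sites N. cost n a j z)))"
    by (simp add: sum.distrib sum_distrib_left)
  also have "(\<Sum>z\<in>sites N. cost n a j z) = a * (real n * total_diss j) + real (N ^ CARD('d)) * (3 / (2 * a) + \<beta>)"
  proof -
    have "(\<Sum>z\<in>sites N. \<Sum>k<n. diss P (shift N j (int k) z) j) = real n * total_diss j"
      by (subst sum.swap) (simp add: sum_shift[OF N1, of "\<lambda>x. diss P x j"] total_diss_def)
    then show ?thesis
      by (simp add: cost_def sum.distrib card_sites flip: sum_distrib_left)
  qed
  also have "(\<Sum>z\<in>sites N. avg P (psi j q ?rr z)) \<le>
     5 * (entropy P / \<gamma> + real (N ^ CARD('d)) * ln (3 * (real q + 1)) / (\<gamma> * real (2 * n)))"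
    unfolding avg_def q(2)
  proof (rule psi_bound[OF Ppos Psum q(1) _ \<delta> \<gamma> _ \<theta>(2)])
    fix z :: "int ^ 'd" and k assume z: "z \<in> sites N" and k: "k < 6 * q + 4"
    have "\<bar>r (shift N j (int k - (2 * int q + 1)) (shift N j (2 * int q + 1) z)) - ?rr z\<bar> \<le> \<theta>"
      by (rule \<theta>(1)) (use N1 q k in auto)
    then show "\<bar>r (shift N j (int k) z) - ?rr z\<bar> \<le> \<theta>" by (simp add: shift_shift)
  qed (use q in auto)
  finally show ?thesis by simp
qed

end

section \<open>Entropy production\<close>

text \<open>The inequality \<open>ln y \<le> y - 1\<close> is used for the quotient of the square
  roots. What it gains over the tangent bound \<open>g' - g\<close> is the square that becomes the
  Dirichlet form.\<close>

lemma ln_gap_bound: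
  fixes g g' :: real
  assumes "g > 0" "g' > 0"
  shows "g * (ln g' - ln g) \<le> g' - g - (sqrt g' - sqrt g)\<^sup>2"
proof -
  define s t where "s = sqrt g" and "t = sqrt g'"
  have st: "s > 0" "t > 0" "g = s * s" "g' = t * t" using assms by (auto simp: s_def t_def)
  have "ln (t / s) \<le> t / s - 1" by (rule ln_le_minus_one) (use st in auto)
  then have "2 * s * s * (ln t - ln s) \<le> 2 * s * s * (t / s - 1)"
    using st by (intro mult_left_mono) (auto simp: ln_div)
  also have "\<dots> = t * t - s * s - (t - s)\<^sup>2"
    using st by (simp add: field_simps power2_eq_square)
  finally show ?thesis
    using st by (simp add: ln_mult algebra_simps)
qed

lemma exp_third_order:
  fixes z :: real
  assumes "\<bar>z\<bar> \<le> 1"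
  shows "\<bar>exp z - 1 - z - z\<^sup>2 / 2\<bar> \<le> 2 * \<bar>z\<bar> ^ 3"
proof -
  have "\<bar>exp z - (\<Sum>i\<le>2. z ^ i / fact i)\<bar> \<le> exp \<bar>z\<bar> * \<bar>z\<bar> ^ 3 / 2"
    using Taylor_exp_field[of z 2] by (simp add: fact_numeral eval_nat_numeral)
  also have "(\<Sum>i\<le>2. z ^ i / fact i) = 1 + z + z\<^sup>2 / 2"
    by (simp add: eval_nat_numeral atMost_Suc)
  also have "exp \<bar>z\<bar> * \<bar>z\<bar> ^ 3 / 2 \<le> 2 * \<bar>z\<bar> ^ 3"
  proof -
    have "exp \<bar>z\<bar> \<le> exp 1" using assms by simp
    also have "\<dots> \<le> 3" by (rule exp_le)
    finally have "exp \<bar>z\<bar> * \<bar>z\<bar> ^ 3 \<le> 3 * \<bar>z\<bar> ^ 3"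
      by (intro mult_right_mono) auto
    moreover have "0 \<le> \<bar>z\<bar> ^ 3" by simp
    ultimately show ?thesis by linarith
  qed
  finally show ?thesis by (simp add: algebra_simps)
qed

lemma cube_scaling: "m \<noteq> 0 \<Longrightarrow> m\<^sup>2 * (2 * (2 * (c / m) ^ 3)) = 4 * c ^ 3 / m" for m c :: real
  by (simp add: field_simps power2_eq_square power3_eq_cube)

lemma exp_first_order:
  fixes z :: real
  assumes "\<bar>z\<bar> \<le> 1"
  shows "\<bar>exp z - 1\<bar> \<le> 2 * \<bar>z\<bar>"
proof -
  have "z\<^sup>2 \<le> \<bar>z\<bar>" using mult_right_mono[OF assms, of "\<bar>z\<bar>"] by (simp add: power2_eq_square)
  then show ?thesis using exp_le_quadratic[OF assms] exp_ge_add_one_self[of z] by linarith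
qed

section \<open>The defect of invariance of the local equilibrium\<close>

context params
begin

text \<open>The chemical potential of the site. In this parameter the product weight is an
  exponential family, so an exchange multiplies \<open>nu\<close> by the exponential of a potential
  difference.\<close>

definition chem :: "int ^ 'd \<Rightarrow> real" where
  "chem x = ln (r x / (1 - r x))"

lemma nu_ex_ratio:
  assumes N: "N \<ge> 2" and x: "x \<in> sites N"
  shows "nu N r (bond_swap N x j \<eta>) / nu N r \<eta> = exp ((of_bool (\<eta> x) - of_bool (\<eta> (shift N j 1 x))) * (chem (shift N j 1 x) - chem x))"
proof -
  let ?y = "shift N j 1 x"
  let ?w = "\<lambda>b u. if b then r u else 1 - r u"
  have y: "?y \<in> sites N" "?y \<noteq> x" using N1 shift_ne[OF x, of 1 j] N by auto
  have split: "nu N r \<zeta> = ?w (\<zeta> x) x * (?w (\<zeta> ?y) ?y * (\<Prod>u\<in>sites N - {x} - {?y}. ?w (\<zeta> u) u))" for \<zeta>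
    unfolding nu_def using x y by (simp add: prod.remove[of "sites N" x] prod.remove[of "sites N - {x}" ?y])
  have rest: "(\<Prod>u\<in>sites N - {x} - {?y}. ?w (bond_swap N x j \<eta> u) u) = (\<Prod>u\<in>sites N - {x} - {?y}. ?w (\<eta> u) u)"
    by (rule prod.cong) (auto simp: bond_swap_apply)
  define R where "R = (\<Prod>u\<in>sites N - {x} - {?y}. ?w (\<eta> u) u)"
  have R: "R > 0" unfolding R_def by (rule prod_pos) (use r01 in auto)
  have b: "0 < r x" "r x < 1" "0 < r ?y" "r ?y < 1" using r01[OF x] r01[OF y(1)] by auto
  have q: "nu N r (bond_swap N x j \<eta>) / nu N r \<eta> = (?w (\<eta> ?y) x * ?w (\<eta> x) ?y) / (?w (\<eta> x) x * ?w (\<eta> ?y) ?y)"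
    unfolding split rest R_def[symmetric] using R y(2) by (simp add: bond_swap_apply)
  have c: "exp (chem u) = r u / (1 - r u)" if "0 < r u" "r u < 1" for u
    unfolding chem_def using that by simp
  show ?thesis
    unfolding q using b by (auto simp: exp_diff c field_simps)
qed

text \<open>As the generator is symmetric for the counting measure, the quotient is its adjoint with
  respect to \<open>nu\<close>, applied to the constant 1; it would vanish if \<open>nu\<close> were
  invariant.\<close>

lemma generator_nu_sum:
  assumes N: "N \<ge> 3"
  shows "generator N (nu N r) \<eta> / nu N r \<eta> =
    (\<Sum>x\<in>sites N. \<Sum>j\<in>UNIV. bond_rate N x j \<eta> *
      (exp ((of_bool (\<eta> x) - of_bool (\<eta> (shift N j 1 x))) * (chem (shift N j 1 x) - chem x)) - 1))"
proof -
  have "bond_rate N x j \<eta> * (nu N r (bond_swap N x j \<eta>) - nu N r \<eta>) / nu N r \<eta> = bond_rate N x j \<eta> *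
      (exp ((of_bool (\<eta> x) - of_bool (\<eta> (shift N j 1 x))) * (chem (shift N j 1 x) - chem x)) - 1)"
    if "x \<in> sites N" for x j
    using nu_ex_ratio[of x j \<eta>] nu_pos[of \<eta>] N that by (simp add: diff_divide_distrib right_diff_distrib flip: times_divide_eq_right)
  then show ?thesis
    unfolding generator_bonds[OF N] sum_divide_distrib by (intro sum.cong refl) auto
qed

text \<open>The gradient property of the rates. It allows a second summation by parts, after which
  the current meets second differences of the potential and the factor \<open>N\<^sup>2\<close> is
  compensated.\<close>

lemma curr_gradient:
  "bond_rate N x j \<eta> * (of_bool (\<eta> (shift N j 0 x)) - of_bool (\<eta> (shift N j 1 x))) = curr j x \<eta> - curr j (shift N j 1 x) \<eta>"
proof -
  define o0 o1 om o2 where "o0 = (of_bool (\<eta> (shift N j 0 x)) :: real)" and "o1 = (of_bool (\<eta> (shift N j 1 x)) :: real)"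
    and "om = (of_bool (\<eta> (shift N j (-1) x)) :: real)" and "o2 = (of_bool (\<eta> (shift N j 2 x)) :: real)"
  have "curr j x \<eta> = o0 * o1 + o0 * om - om * o1" "curr j (shift N j 1 x) \<eta> = o1 * o2 + o1 * o0 - o0 * o2"
    by (simp_all only: curr_def Let_def shift_shift o0_def o1_def om_def o2_def) simp_all
  then show ?thesis
    unfolding bond_rate_shift o0_def[symmetric] o1_def[symmetric] om_def[symmetric] o2_def[symmetric]
    by (simp add: algebra_simps)
qed

lemma summation_by_parts:
  "(\<Sum>x\<in>sites N. bond_rate N x j \<eta> * (of_bool (\<eta> (shift N j 0 x)) - of_bool (\<eta> (shift N j 1 x))) * (chem (shift N j 1 x) - chem x))
   = (\<Sum>x\<in>sites N. curr j x \<eta> * (chem (shift N j 1 x) + chem (shift N j (-1) x) - 2 * chem x))"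
proof -
  have "(\<Sum>x\<in>sites N. curr j (shift N j 1 x) \<eta> * (chem (shift N j 1 x) - chem x)) =
     (\<Sum>x\<in>sites N. curr j (shift N j 1 x) \<eta> * (chem (shift N j 1 x) - chem (shift N j (-1) (shift N j 1 x))))"
    by (intro sum.cong refl) (simp add: shift_shift shift_0)
  also have "\<dots> = (\<Sum>x\<in>sites N. curr j x \<eta> * (chem x - chem (shift N j (-1) x)))"
    by (rule sum_shift[OF N1, of "\<lambda>x. curr j x \<eta> * (chem x - chem (shift N j (-1) x))"])
  finally show ?thesis
    unfolding curr_gradient left_diff_distrib sum_subtractf
    by (simp add: algebra_simps sum.distrib sum_subtractf sum_distrib_left)
qed

definition lap :: "'d \<Rightarrow> int ^ 'd \<Rightarrow> real" where
  "lap j x = (real N)\<^sup>2 * (chem (shift N j 1 x) + chem (shift N j (-1) x) - 2 * chem x)"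

definition grd :: "'d \<Rightarrow> int ^ 'd \<Rightarrow> real" where
  "grd j x = (real N)\<^sup>2 * (chem (shift N j 1 x) - chem x)\<^sup>2"

definition drift :: "'d config \<Rightarrow> real" where
  "drift \<eta> = (\<Sum>x\<in>sites N. \<Sum>j\<in>UNIV. lap j x * curr j x \<eta> + grd j x / 2 * mob j x \<eta>)"

text \<open>Potential differences are of order \<open>1 / N\<close>. The first order of the
  exponential becomes \<open>lap\<close> by summation by parts, the second order is
  \<open>grd\<close>, and the third order times \<open>N\<^sup>2\<close> leaves
  \<open>4 * \<Lambda> ^ 3 / N\<close> per bond.\<close>

lemma generator_nu_expand:
  assumes N: "N \<ge> 3" and \<Lambda>: "\<And>x j. x \<in> sites N \<Longrightarrow> \<bar>chem (shift N j 1 x) - chem x\<bar> \<le> \<Lambda> / real N"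
    "\<Lambda> / real N \<le> 1"
  shows "\<bar>(real N)\<^sup>2 * (generator N (nu N r) \<eta> / nu N r \<eta>) - drift \<eta>\<bar>
    \<le> real (N ^ CARD('d)) * (4 * real CARD('d) * \<Lambda> ^ 3 / real N)"
proof -
  let ?z = "\<lambda>x j. (of_bool (\<eta> x) - of_bool (\<eta> (shift N j 1 x))) * (chem (shift N j 1 x) - chem x)"
  have N0: "real N > 0" using N by simp
  have L0: "\<Lambda> / real N \<ge> 0"
    using \<Lambda>(1) sites_nonempty[OF N1] by (meson abs_ge_zero ex_in_conv order_trans)
  have zb: "\<bar>?z x j\<bar> \<le> \<Lambda> / real N" if "x \<in> sites N" for x j
  proof -
    have "\<bar>?z x j\<bar> \<le> 1 * (\<Lambda> / real N)"
      unfolding abs_mult using \<Lambda>(1)[OF that] by (intro mult_mono) auto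
    then show ?thesis by simp
  qed
  have d: "drift \<eta> = (\<Sum>x\<in>sites N. \<Sum>j\<in>UNIV. (real N)\<^sup>2 * (bond_rate N x j \<eta> * (?z x j + (?z x j)\<^sup>2 / 2)))"
  proof -
    have "(\<Sum>x\<in>sites N. lap j x * curr j x \<eta>) = (\<Sum>x\<in>sites N. (real N)\<^sup>2 * (bond_rate N x j \<eta> * ?z x j))" for j
    proof -
      have "(\<Sum>x\<in>sites N. lap j x * curr j x \<eta>) = (real N)\<^sup>2 *
        (\<Sum>x\<in>sites N. curr j x \<eta> * (chem (shift N j 1 x) + chem (shift N j (-1) x) - 2 * chem x))"
        by (simp add: lap_def sum_distrib_left mult_ac)
      also have "\<dots> = (\<Sum>x\<in>sites N. (real N)\<^sup>2 * (bond_rate N x j \<eta> * ?z x j))"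
        unfolding summation_by_parts[symmetric] sum_distrib_left by (intro sum.cong refl) (simp add: shift_0 mult_ac)
      finally show ?thesis .
    qed
    moreover have "grd j x / 2 * mob j x \<eta> = (real N)\<^sup>2 * (bond_rate N x j \<eta> * ((?z x j)\<^sup>2 / 2))" if "x \<in> sites N" for x j
      using that by (simp add: grd_def mob_def shift_0 power_mult_distrib)
    ultimately have "drift \<eta> = (\<Sum>j\<in>UNIV. \<Sum>x\<in>sites N. (real N)\<^sup>2 * (bond_rate N x j \<eta> * ?z x j)
        + (real N)\<^sup>2 * (bond_rate N x j \<eta> * ((?z x j)\<^sup>2 / 2)))"
      unfolding drift_def by (subst sum.swap) (simp add: sum.distrib)
    also have "\<dots> = (\<Sum>j\<in>UNIV. \<Sum>x\<in>sites N. (real N)\<^sup>2 * (bond_rate N x j \<eta> * (?z x j + (?z x j)\<^sup>2 / 2)))"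
      by (simp add: algebra_simps)
    finally show ?thesis by (subst sum.swap) simp
  qed
  have e: "(real N)\<^sup>2 * (generator N (nu N r) \<eta> / nu N r \<eta>) - drift \<eta> =
    (\<Sum>x\<in>sites N. \<Sum>j\<in>UNIV. (real N)\<^sup>2 * (bond_rate N x j \<eta> * (exp (?z x j) - 1 - ?z x j - (?z x j)\<^sup>2 / 2)))"
    unfolding d generator_nu_sum[OF N] by (simp add: sum_distrib_left right_diff_distrib distrib_left sum_subtractf sum.distrib)
  have "\<bar>(real N)\<^sup>2 * (generator N (nu N r) \<eta> / nu N r \<eta>) - drift \<eta>\<bar> \<le>
      (\<Sum>x\<in>(sites N :: (int ^ 'd) set). \<Sum>j\<in>(UNIV :: 'd set). (real N)\<^sup>2 * (2 * (2 * (\<Lambda> / real N) ^ 3)))"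
    unfolding e
  proof (intro order_trans[OF sum_abs] sum_mono)
    fix x :: "int ^ 'd" and j :: 'd assume x: "x \<in> sites N"
    have "\<bar>exp (?z x j) - 1 - ?z x j - (?z x j)\<^sup>2 / 2\<bar> \<le> 2 * \<bar>?z x j\<bar> ^ 3"
      by (rule exp_third_order) (use zb[OF x, of j] \<Lambda>(2) in linarith)
    also have "\<dots> \<le> 2 * (\<Lambda> / real N) ^ 3"
      using zb[OF x, of j] by (intro mult_left_mono power_mono) auto
    finally have "\<bar>bond_rate N x j \<eta>\<bar> * \<bar>exp (?z x j) - 1 - ?z x j - (?z x j)\<^sup>2 / 2\<bar> \<le> 2 * (2 * (\<Lambda> / real N) ^ 3)"
      using bond_rate_bounds[of N x j \<eta>] by (intro mult_mono) auto
    then show "\<bar>(real N)\<^sup>2 * (bond_rate N x j \<eta> * (exp (?z x j) - 1 - ?z x j - (?z x j)\<^sup>2 / 2))\<bar>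
       \<le> (real N)\<^sup>2 * (2 * (2 * (\<Lambda> / real N) ^ 3))"
      unfolding abs_mult by (simp add: mult_left_mono)
  qed
  also have "\<dots> = real (N ^ CARD('d)) * (4 * real CARD('d) * \<Lambda> ^ 3 / real N)"
  proof -
    have "(real N)\<^sup>2 * (2 * (2 * (\<Lambda> / real N) ^ 3)) = 4 * \<Lambda> ^ 3 / real N"
      by (rule cube_scaling) (use N0 in simp)
    moreover have "(\<Sum>x\<in>(sites N :: (int ^ 'd) set). \<Sum>j\<in>(UNIV :: 'd set). c) = real (N ^ CARD('d)) * (real CARD('d) * c)" for c
      by (simp add: card_sites)
    ultimately show ?thesis by (simp only: times_divide_eq_right mult.assoc mult.left_commute)
  qed
  finally show ?thesis .
qed

lemma drift_expand:
  "drift \<eta> = (\<Sum>x\<in>sites N. \<Sum>j\<in>UNIV. lap j x * (r x)\<^sup>2 + grd j x / 2 * (4 * (r x)\<^sup>2 * (1 - r x)))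
    + (\<Sum>x\<in>sites N. (\<Sum>j\<in>UNIV. lap j x * (2 * r x) + grd j x / 2 * (8 * r x - 12 * (r x)\<^sup>2)) * (of_bool (\<eta> x) - r x))
    + (\<Sum>x\<in>sites N. \<Sum>j\<in>UNIV. lap j x * curr_rem j x \<eta> + grd j x / 2 * mob_rem j x \<eta>)"
proof -
  have "lap j x * curr j x \<eta> + grd j x / 2 * mob j x \<eta> =
     (lap j x * (r x)\<^sup>2 + grd j x / 2 * (4 * (r x)\<^sup>2 * (1 - r x)))
     + (lap j x * (2 * r x) + grd j x / 2 * (8 * r x - 12 * (r x)\<^sup>2)) * (of_bool (\<eta> x) - r x)
     + (lap j x * curr_rem j x \<eta> + grd j x / 2 * mob_rem j x \<eta>)" if "x \<in> sites N" for x j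
    unfolding curr_expand mob_expand dv_def shift_0[OF that] by (simp add: algebra_simps)
  then show ?thesis
    unfolding drift_def sum_distrib_right by (simp add: sum.distrib)
qed

lemma sum_generator_nu: "N \<ge> 3 \<Longrightarrow> (\<Sum>\<eta>\<in>configs N. generator N (nu N r) \<eta>) = 0"
  using generator_symmetric[of N "\<lambda>_. 1" "nu N r"] by (simp add: generator_def)

end

section \<open>Entropy dissipation and entropy production\<close>

context near_exchangeable
begin

text \<open>For \<open>P = nu * g\<close> the generator is moved onto \<open>ln g\<close>, where
  \<open>ln_gap_bound\<close> applies bond by bond. The plain differences of \<open>g\<close>
  recombine to its generator, which is moved back onto \<open>nu\<close>.\<close>

lemma entropy_dissipation:
  "(\<Sum>\<eta>\<in>configs N. generator N P \<eta> * ln (P \<eta> / nu N r \<eta>)) \<le>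
    avg P (\<lambda>\<eta>. generator N (nu N r) \<eta> / nu N r \<eta>) - (\<Sum>j\<in>UNIV. total_diss j)"
proof -
  define g where "g \<eta> = P \<eta> / nu N r \<eta>" for \<eta>
  have g: "g \<eta> > 0" "P \<eta> = nu N r \<eta> * g \<eta>" if "\<eta> \<in> configs N" for \<eta>
    using Ppos[OF that] nu_pos[of \<eta>] by (auto simp: g_def)
  have "(\<Sum>\<eta>\<in>configs N. generator N P \<eta> * ln (g \<eta>)) = (\<Sum>\<eta>\<in>configs N. P \<eta> * generator N (\<lambda>\<eta>. ln (g \<eta>)) \<eta>)"
    by (rule generator_symmetric[OF N3, symmetric])
  also have "\<dots> \<le> (\<Sum>\<eta>\<in>configs N. nu N r \<eta> * generator N g \<eta> - (\<Sum>x\<in>sites N. \<Sum>j\<in>UNIV. nu N r \<eta> * bond_rate N x j \<eta> * (sqrt (g (bond_swap N x j \<eta>)) - sqrt (g \<eta>))\<^sup>2))"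
  proof (rule sum_mono)
    fix \<eta> :: "'d config" assume e: "\<eta> \<in> configs N"
    have "P \<eta> * generator N (\<lambda>\<eta>. ln (g \<eta>)) \<eta> = (\<Sum>x\<in>sites N. \<Sum>j\<in>UNIV. nu N r \<eta> * bond_rate N x j \<eta> * (g \<eta> * (ln (g (bond_swap N x j \<eta>)) - ln (g \<eta>))))"
      unfolding generator_bonds[OF N3] g(2)[OF e] sum_distrib_left by (simp add: mult_ac)
    also have "\<dots> \<le> (\<Sum>x\<in>sites N. \<Sum>j\<in>UNIV. nu N r \<eta> * bond_rate N x j \<eta> * (g (bond_swap N x j \<eta>) - g \<eta> - (sqrt (g (bond_swap N x j \<eta>)) - sqrt (g \<eta>))\<^sup>2))"
      using nu_pos[of \<eta>] bond_rate_bounds(1)[of N _ _ \<eta>] e N1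
      by (intro sum_mono mult_left_mono ln_gap_bound g) (auto intro: less_imp_le)
    also have "\<dots> = nu N r \<eta> * generator N g \<eta> - (\<Sum>x\<in>sites N. \<Sum>j\<in>UNIV. nu N r \<eta> * bond_rate N x j \<eta> * (sqrt (g (bond_swap N x j \<eta>)) - sqrt (g \<eta>))\<^sup>2)"
      unfolding generator_bonds[OF N3] sum_distrib_left by (simp add: algebra_simps sum_subtractf sum.distrib)
    finally show "P \<eta> * generator N (\<lambda>\<eta>. ln (g \<eta>)) \<eta> \<le> nu N r \<eta> * generator N g \<eta> - (\<Sum>x\<in>sites N. \<Sum>j\<in>UNIV. nu N r \<eta> * bond_rate N x j \<eta> * (sqrt (g (bond_swap N x j \<eta>)) - sqrt (g \<eta>))\<^sup>2)" .
  qed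
  also have "\<dots> = (\<Sum>\<eta>\<in>configs N. generator N (nu N r) \<eta> * g \<eta>) - (\<Sum>j\<in>UNIV. total_diss j)"
  proof -
    have "(\<Sum>\<eta>\<in>configs N. \<Sum>x\<in>sites N. \<Sum>j\<in>UNIV. nu N r \<eta> * bond_rate N x j \<eta> * (sqrt (g (bond_swap N x j \<eta>)) - sqrt (g \<eta>))\<^sup>2)
       = (\<Sum>x\<in>sites N. \<Sum>j\<in>UNIV. diss P x j)"
      unfolding diss_def g_def[symmetric] by (subst sum.swap, rule sum.cong[OF refl], rule sum.swap)
    also have "\<dots> = (\<Sum>j\<in>UNIV. total_diss j)"
      unfolding total_diss_def by (rule sum.swap)
    finally show ?thesis
      using generator_symmetric[OF N3, of "nu N r" g] by (simp add: sum_subtractf)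
  qed
  also have "(\<Sum>\<eta>\<in>configs N. generator N (nu N r) \<eta> * g \<eta>) = avg P (\<lambda>\<eta>. generator N (nu N r) \<eta> / nu N r \<eta>)"
    by (simp add: avg_def g_def mult_ac)
  finally show ?thesis by (simp add: g_def)
qed

lemma avg_mono: "(\<And>\<eta>. \<eta> \<in> configs N \<Longrightarrow> f \<eta> \<le> g \<eta>) \<Longrightarrow> avg P f \<le> avg P g"
  unfolding avg_def by (intro sum_mono mult_left_mono less_imp_le[OF Ppos]) auto

lemma avg_const [simp]: "avg P (\<lambda>_. c) = c"
  using Psum by (simp add: avg_def flip: sum_distrib_right)

lemma avg_abs_le:
  assumes "\<And>\<eta>. \<eta> \<in> configs N \<Longrightarrow> \<bar>f \<eta>\<bar> \<le> c"
  shows "\<bar>avg P f\<bar> \<le> c"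
proof -
  have "f \<eta> \<le> c" "- c \<le> f \<eta>" if "\<eta> \<in> configs N" for \<eta>
    using assms[OF that] by auto
  then have "avg P f \<le> avg P (\<lambda>_. c)" "avg P (\<lambda>_. - c) \<le> avg P f"
    by (blast intro: avg_mono)+
  then show ?thesis by (simp add: abs_le_iff)
qed

text \<open>The replacement bounds thus hold for the reference weight too, with vanishing entropy
  and Dirichlet form. This controls the remainder in the identity that is subtracted in
  \<open>entropy_production\<close>.\<close>

lemma near_exchangeable_nu: "near_exchangeable N r (nu N r) \<beta>"
proof
  show "(\<Sum>\<eta>\<in>configs N. nu N r \<eta>) = 1" using expect_one[of N r] unfolding expect_def by simp
qed (use N3 nu_pos ratio \<beta>1 in auto)

text \<open>The number 13 is 3 from \<open>curr_rem_bound\<close> plus half of the 20 from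
  \<open>mob_rem_bound\<close>.\<close>

lemma remainder_bound:
  assumes G: "\<And>x j. x \<in> sites N \<Longrightarrow> \<bar>lap j x\<bar> \<le> G" "\<And>x j. x \<in> sites N \<Longrightarrow> \<bar>grd j x\<bar> \<le> G"
    and q: "q \<ge> 1" "n = 6 * q + 4" "n \<le> N" and a: "a > 0"
    and M: "\<And>w w'. length w = n \<Longrightarrow> linked w w' \<Longrightarrow> \<exists>m\<le>M. (symclp move ^^ m) w w'"
  shows "\<bar>avg P (\<lambda>\<eta>. \<Sum>x\<in>sites N. \<Sum>j\<in>UNIV. lap j x * curr_rem j x \<eta> + grd j x / 2 * mob_rem j x \<eta>)\<bar>
    \<le> 13 * G * (\<Sum>j\<in>UNIV. \<Sum>x\<in>sites N. site_bound q n M a j x)"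
proof -
  have "\<bar>avg P (\<lambda>\<eta>. \<Sum>x\<in>sites N. \<Sum>j\<in>UNIV. lap j x * curr_rem j x \<eta> + grd j x / 2 * mob_rem j x \<eta>)\<bar>
    = \<bar>\<Sum>x\<in>sites N. \<Sum>j\<in>UNIV. lap j x * avg P (curr_rem j x) + grd j x / 2 * avg P (mob_rem j x)\<bar>"
    by (simp only: avg_sum avg_add avg_cmult)
  also have "\<dots> \<le> (\<Sum>x\<in>sites N. \<Sum>j\<in>UNIV. 13 * G * site_bound q n M a j x)"
  proof (intro order_trans[OF sum_abs] sum_mono)
    fix x :: "int ^ 'd" and j :: 'd assume x: "x \<in> sites N"
    have "\<bar>lap j x * avg P (curr_rem j x)\<bar> \<le> G * (3 * site_bound q n M a j x)"
      unfolding abs_mult using curr_rem_bound[OF q a x M, of j] G(1)[OF x, of j] by (intro mult_mono) auto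
    moreover have "\<bar>grd j x / 2 * avg P (mob_rem j x)\<bar> \<le> G / 2 * (20 * site_bound q n M a j x)"
      unfolding abs_mult using mob_rem_bound[OF q a x M, of j] G(2)[OF x, of j] by (intro mult_mono) auto
    ultimately show "\<bar>lap j x * avg P (curr_rem j x) + grd j x / 2 * avg P (mob_rem j x)\<bar> \<le> 13 * G * site_bound q n M a j x"
      by linarith
  qed
  also have "\<dots> = 13 * G * (\<Sum>j\<in>UNIV. \<Sum>x\<in>sites N. site_bound q n M a j x)"
    by (subst sum.swap) (simp add: sum_distrib_left)
  finally show ?thesis .
qed

lemma entropy_nu: "entropy (nu N r) = 0"
  using nu_pos by (simp add: entropy_def less_imp_neq[symmetric])

lemma diss_nu: "near_exchangeable.total_diss N r (nu N r) j = 0"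
proof -
  interpret V: near_exchangeable N r "nu N r" \<beta> by (rule near_exchangeable_nu)
  show ?thesis using nu_pos by (simp add: V.total_diss_def diss_def less_imp_neq[symmetric])
qed

text \<open>The average of the production vanishes under \<open>nu\<close>; subtracting this identity removes the
  constant \<open>K\<close> without any summation by parts. The weight \<open>a\<close> is chosen such that the cost of the
  replacement is absorbed by the Dirichlet form.\<close>

theorem entropy_production:
  assumes \<Lambda>: "\<And>x j. x \<in> sites N \<Longrightarrow> \<bar>chem (shift N j 1 x) - chem x\<bar> \<le> \<Lambda> / real N" "\<Lambda> / real N \<le> 1"
    and G: "\<And>x j. x \<in> sites N \<Longrightarrow> \<bar>lap j x\<bar> \<le> G" "\<And>x j. x \<in> sites N \<Longrightarrow> \<bar>grd j x\<bar> \<le> G" "G > 0"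
    and \<phi>: "\<And>x. x \<in> sites N \<Longrightarrow> \<bar>(\<Sum>j\<in>UNIV. lap j x * (2 * r x) + grd j x / 2 * (8 * r x - 12 * (r x)\<^sup>2)) - l x\<bar> \<le> \<phi>"
    and q: "q \<ge> 1" "n = 6 * q + 4" "n \<le> N"
    and \<delta>: "\<delta> > 0" "\<And>x. x \<in> sites N \<Longrightarrow> \<delta> \<le> r x" and \<gamma>: "\<gamma> = \<delta>\<^sup>2 / 160"
    and \<theta>: "\<And>x j k. x \<in> sites N \<Longrightarrow> \<bar>k\<bar> < int n \<Longrightarrow> \<bar>r (shift N j k x) - r x\<bar> \<le> \<theta>"
      "40 * \<gamma> * real q * \<theta>\<^sup>2 \<le> 1"
    and M: "\<And>w w'. length w = n \<Longrightarrow> linked w w' \<Longrightarrow> \<exists>m\<le>M. (symclp move ^^ m) w w'" "M \<ge> 1"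
  shows "(real N)\<^sup>2 * (\<Sum>\<eta>\<in>configs N. generator N P \<eta> * ln (P \<eta> / nu N r \<eta>))
      - avg P (\<lambda>\<eta>. \<Sum>x\<in>sites N. l x * (of_bool (\<eta> x) - r x))
    \<le> 65 * G * real CARD('d) / \<gamma> * entropy P + real (N ^ CARD('d)) *
       (8 * real CARD('d) * \<Lambda> ^ 3 / real N + 2 * \<phi> + 130 * G * real CARD('d) * (ln (3 * (real q + 1)) / (\<gamma> * real (2 * n)))
        + 52 * G * real CARD('d) * (2 ^ n * real M) * (39 * G * (2 ^ n * real M) * real n / (real N)\<^sup>2 + \<beta>))"
proof -
  interpret V: near_exchangeable N r "nu N r" \<beta> by (rule near_exchangeable_nu)
  define W where "W = 2 ^ n * real M"
  have W: "W > 0" using M(2) by (simp add: W_def)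
  \<comment> \<open>With this weight \<open>13 * G * (2 * W * a * n)\<close> equals
    \<open>N\<^sup>2\<close>, the factor of the Dirichlet form in the entropy production.\<close>
  define a where "a = (real N)\<^sup>2 / (26 * G * W * real n)"
  have N0: "real N > 0" using N1 by simp
  have n0: "real n > 0" using q by simp
  have a: "a > 0" using N0 n0 W G(3) by (simp add: a_def)
  define Nd where "Nd = real (N ^ CARD('d))"
  define \<phi>' where "\<phi>' x = (\<Sum>j\<in>UNIV. lap j x * (2 * r x) + grd j x / 2 * (8 * r x - 12 * (r x)\<^sup>2)) - l x" for x
  define K where "K = (\<Sum>x\<in>sites N. \<Sum>j\<in>UNIV. lap j x * (r x)\<^sup>2 + grd j x / 2 * (4 * (r x)\<^sup>2 * (1 - r x)))"
  define Rm where "Rm \<eta> = (\<Sum>x\<in>sites N. \<Sum>j\<in>UNIV. lap j x * curr_rem j x \<eta> + grd j x / 2 * mob_rem j x \<eta>)" for \<eta>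
  define Ln where "Ln \<eta> = (\<Sum>x\<in>sites N. \<phi>' x * (of_bool (\<eta> x) - r x))" for \<eta>
  define ls where "ls \<eta> = (\<Sum>x\<in>sites N. l x * (of_bool (\<eta> x) - r x))" for \<eta>
  define gen where "gen \<eta> = (real N)\<^sup>2 * (generator N (nu N r) \<eta> / nu N r \<eta>)" for \<eta>
  define Er where "Er = Nd * (4 * real CARD('d) * \<Lambda> ^ 3 / real N)"
  have drift: "drift \<eta> - ls \<eta> = K + Ln \<eta> + Rm \<eta>" for \<eta>
    unfolding drift_expand K_def Ln_def Rm_def ls_def \<phi>'_def by (simp add: left_diff_distrib sum_subtractf)
  have gd: "\<bar>gen \<eta> - drift \<eta>\<bar> \<le> Er" for \<eta>
    unfolding gen_def Er_def Nd_def by (rule generator_nu_expand[OF N3 \<Lambda>])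
  have up: "gen \<eta> - ls \<eta> \<le> K + Ln \<eta> + Rm \<eta> + Er" and lo: "K + Ln \<eta> + Rm \<eta> - Er \<le> gen \<eta> - ls \<eta>" for \<eta>
    using gd[of \<eta>] drift[of \<eta>] by (auto simp: abs_le_iff)
  have nu0: "avg (nu N r) (\<lambda>\<eta>. gen \<eta> - ls \<eta>) = 0"
  proof -
    have "avg (nu N r) gen = (real N)\<^sup>2 * (\<Sum>\<eta>\<in>configs N. generator N (nu N r) \<eta>)"
      unfolding avg_def gen_def sum_distrib_left using nu_pos by (intro sum.cong refl) (simp add: less_imp_neq[symmetric])
    also have "\<dots> = 0" by (simp add: sum_generator_nu[OF N3])
    finally have "avg (nu N r) gen = 0" .
    moreover have "avg (nu N r) (\<lambda>\<eta>. of_bool (\<eta> x) - r x) = 0" if "x \<in> sites N" for x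
      using expect_single[OF that, of r "\<lambda>b. of_bool b - r x"]
      unfolding avg_def expect_def by (simp add: algebra_simps)
    then have "avg (nu N r) ls = 0"
      unfolding ls_def[abs_def] by (simp add: avg_sum avg_cmult)
    ultimately show ?thesis by (simp add: avg_diff)
  qed
  have Lb: "\<bar>Ln \<eta>\<bar> \<le> Nd * \<phi>" for \<eta>
  proof -
    have "\<bar>Ln \<eta>\<bar> \<le> (\<Sum>x\<in>(sites N :: (int ^ 'd) set). \<phi> * 1)"
      unfolding Ln_def
    proof (intro order_trans[OF sum_abs] sum_mono)
      fix x :: "int ^ 'd" assume x: "x \<in> sites N"
      have "\<bar>of_bool (\<eta> x) - r x\<bar> \<le> 1" using r01[OF x] by auto
      then show "\<bar>\<phi>' x * (of_bool (\<eta> x) - r x)\<bar> \<le> \<phi> * 1"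
        unfolding abs_mult using \<phi>[OF x] by (intro mult_mono) (auto simp: \<phi>'_def)
    qed
    then show ?thesis by (simp add: card_sites Nd_def)
  qed
  let ?SP = "\<Sum>j\<in>UNIV. \<Sum>x\<in>sites N. site_bound q n M a j x"
  let ?SV = "\<Sum>j\<in>UNIV. \<Sum>x\<in>sites N. V.site_bound q n M a j x"
  have rP: "\<bar>avg P Rm\<bar> \<le> 13 * G * ?SP"
    unfolding Rm_def[abs_def] by (rule remainder_bound[OF G(1,2) q a M(1)])
  have rV: "\<bar>avg (nu N r) Rm\<bar> \<le> 13 * G * ?SV"
    unfolding Rm_def[abs_def] by (rule V.remainder_bound[OF G(1,2) q a M(1)])
  have "avg P (\<lambda>\<eta>. gen \<eta> - ls \<eta>) \<le> avg P (\<lambda>\<eta>. K + Ln \<eta> + Rm \<eta> + Er)"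
    by (rule avg_mono) (rule up)
  also have "\<dots> = K + avg P Ln + avg P Rm + Er" by (simp add: avg_add)
  finally have 1: "avg P (\<lambda>\<eta>. gen \<eta> - ls \<eta>) \<le> K + avg P Ln + avg P Rm + Er" .
  have "avg (nu N r) (\<lambda>\<eta>. K + Ln \<eta> + Rm \<eta> - Er) \<le> 0"
    unfolding nu0[symmetric] by (rule V.avg_mono) (rule lo)
  then have 2: "K + avg (nu N r) Ln + avg (nu N r) Rm - Er \<le> 0" by (simp add: avg_add avg_diff)
  have "\<bar>avg P Ln\<bar> \<le> Nd * \<phi>" "\<bar>avg (nu N r) Ln\<bar> \<le> Nd * \<phi>"
    using Lb by (auto intro: avg_abs_le V.avg_abs_le)
  with 1 2 rP rV have 3: "avg P (\<lambda>\<eta>. gen \<eta> - ls \<eta>) \<le> 2 * (Nd * \<phi>) + 2 * Er + 13 * G * ?SP + 13 * G * ?SV"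
    by linarith
  define L where "L = ln (3 * (real q + 1)) / (\<gamma> * real (2 * n))"
  define h where "h = entropy P / \<gamma>"
  define X where "X = Nd * ln (3 * (real q + 1)) / (\<gamma> * real (2 * n))"
  define Y where "Y = Nd * (3 / (2 * a) + \<beta>)"
  define D where "D = (\<Sum>j\<in>UNIV. total_diss j)"
  have "?SP \<le> (\<Sum>j\<in>(UNIV :: 'd set). 5 * (entropy P / \<gamma> + X) + 2 * W * (a * (real n * total_diss j) + Y))"
    by (rule sum_mono, rule order_trans[OF total_bound[OF q a \<delta> \<gamma> \<theta> M(1)]]) (auto simp: X_def Y_def W_def Nd_def)
  also have "\<dots> = real CARD('d) * (5 * (entropy P / \<gamma> + X) + 2 * W * Y) + 2 * W * a * real n * D"
    by (simp add: D_def sum.distrib sum_distrib_left algebra_simps)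
  finally have "13 * G * ?SP \<le> 13 * G * (real CARD('d) * (5 * (entropy P / \<gamma> + X) + 2 * W * Y) + 2 * W * a * real n * D)"
    using G(3) by (intro mult_left_mono) auto
  then have SP: "13 * G * ?SP \<le> 13 * G * (real CARD('d) * (5 * (h + X) + 2 * W * Y)) + 13 * G * (2 * W * a * real n * D)"
    unfolding h_def distrib_left[of "13 * G"] .
  have "?SV \<le> (\<Sum>j\<in>(UNIV :: 'd set). 5 * X + 2 * W * Y)"
    by (rule sum_mono, rule order_trans[OF V.total_bound[OF q a \<delta> \<gamma> \<theta> M(1)]])
       (auto simp: X_def Y_def W_def Nd_def entropy_nu diss_nu)
  then have SV: "13 * G * ?SV \<le> 13 * G * (real CARD('d) * (5 * X + 2 * W * Y))"
    using G(3) by (intro mult_left_mono) auto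
  have aD: "13 * G * (2 * W * a * real n * D) = (real N)\<^sup>2 * D"
    using W G(3) n0 by (simp add: a_def field_simps)
  have "(real N)\<^sup>2 * (\<Sum>\<eta>\<in>configs N. generator N P \<eta> * ln (P \<eta> / nu N r \<eta>)) \<le>
     (real N)\<^sup>2 * (avg P (\<lambda>\<eta>. generator N (nu N r) \<eta> / nu N r \<eta>) - D)"
    unfolding D_def by (intro mult_left_mono entropy_dissipation) auto
  also have "\<dots> = avg P gen - (real N)\<^sup>2 * D"
    unfolding gen_def[abs_def] avg_cmult by (simp add: right_diff_distrib)
  finally have "(real N)\<^sup>2 * (\<Sum>\<eta>\<in>configs N. generator N P \<eta> * ln (P \<eta> / nu N r \<eta>)) - avg P ls \<le>
      avg P (\<lambda>\<eta>. gen \<eta> - ls \<eta>) - (real N)\<^sup>2 * D" by (simp add: avg_diff)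
  also have "\<dots> \<le> 2 * (Nd * \<phi>) + 2 * Er + 13 * G * (real CARD('d) * (5 * (h + X) + 2 * W * Y))
      + 13 * G * (real CARD('d) * (5 * X + 2 * W * Y))"
    using 3 SP SV aD by linarith
  \<comment> \<open>65 is 13 times 5, and 130 is its double because \<open>P\<close> and
    \<open>nu\<close> both pay for the block terms; 52 is 13 times 2, again for both; 39 comes from
    \<open>3 / (2 * a)\<close> with the 26 in \<open>a\<close>.\<close>
  also have "\<dots> = 65 * G * real CARD('d) / \<gamma> * entropy P + Nd *
       (8 * real CARD('d) * \<Lambda> ^ 3 / real N + 2 * \<phi> + 130 * G * real CARD('d) * L
        + 52 * G * real CARD('d) * W * (39 * G * W * real n / (real N)\<^sup>2 + \<beta>))"
  proof -
    define b c e where "b = 39 * G * W * real n / (real N)\<^sup>2 + \<beta>" and "c = real CARD('d)"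
      and "e = 4 * c * \<Lambda> ^ 3 / real N"
    have "3 / (2 * a) = 39 * G * W * real n / (real N)\<^sup>2"
      unfolding a_def by simp
    then have Y: "Y = Nd * b" by (simp add: Y_def b_def)
    have X: "X = Nd * L" by (simp add: X_def L_def)
    have e: "Er = Nd * e" "8 * c * \<Lambda> ^ 3 / real N = 2 * e" by (simp_all add: Er_def e_def c_def)
    have h: "65 * G * c / \<gamma> * entropy P = 65 * G * c * h" by (simp add: h_def)
    show ?thesis
      unfolding b_def[symmetric] c_def[symmetric] X Y e h by (simp add: algebra_simps)
  qed
  finally show ?thesis unfolding ls_def Nd_def W_def L_def .
qed

end

section \<open>The porous medium equation\<close>

text \<open>The regularity class unfolded into named derivatives: \<open>g\<close> is the gradient,
  \<open>H i\<close> the gradient of its component \<open>i\<close>, \<open>h\<close> the time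
  derivative. In \<open>pde\<close> the Laplacian of the square is expanded by the product
  rule.\<close>

locale pme_solution =
  fixes \<rho> :: "real \<Rightarrow> real ^ 'd::finite \<Rightarrow> real" and g :: "real \<Rightarrow> real ^ 'd \<Rightarrow> real ^ 'd"
    and H :: "'d \<Rightarrow> real \<Rightarrow> real ^ 'd \<Rightarrow> real ^ 'd" and h :: "real \<Rightarrow> real ^ 'd \<Rightarrow> real" and \<delta> :: real
  assumes per: "\<And>t. t \<ge> 0 \<Longrightarrow> torus_fun (\<rho> t)"
    and cont_rho: "continuous_on ({0..} \<times> UNIV) (\<lambda>(t, u). \<rho> t u)"
    and cont_g: "\<And>i. continuous_on ({0..} \<times> UNIV) (\<lambda>(t, u). g t u $ i)"
    and cont_H: "\<And>i. continuous_on ({0..} \<times> UNIV) (\<lambda>(t, u). H i t u $ i)"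
    and cont_h: "continuous_on ({0..} \<times> UNIV) (\<lambda>(t, u). h t u)"
    and grad: "\<And>t u. t \<ge> 0 \<Longrightarrow> GDERIV (\<rho> t) u :> g t u"
    and hess: "\<And>t u i. t \<ge> 0 \<Longrightarrow> GDERIV (\<lambda>u. g t u $ i) u :> H i t u"
    and time: "\<And>t u. t \<ge> 0 \<Longrightarrow> ((\<lambda>s. \<rho> s u) has_real_derivative h t u) (at t within {0..})"
    and pde: "\<And>t u. t \<ge> 0 \<Longrightarrow> h t u = (\<Sum>i\<in>UNIV. 2 * (g t u $ i)\<^sup>2 + 2 * \<rho> t u * H i t u $ i)"
    and \<delta>: "\<delta> > 0" and init: "\<And>u. \<delta> \<le> \<rho> 0 u \<and> \<rho> 0 u \<le> 1 - \<delta>"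

lemma GDERIV_line:
  fixes f :: "real ^ 'd \<Rightarrow> real"
  assumes "GDERIV f (u + s *\<^sub>R axis i 1) :> D"
  shows "((\<lambda>s. f (u + s *\<^sub>R axis i 1)) has_real_derivative D $ i) (at s)"
proof -
  have "((\<lambda>s. u + s *\<^sub>R axis i 1) has_derivative (\<lambda>y. y *\<^sub>R axis i 1)) (at s)"
    by (auto intro!: derivative_eq_intros)
  from has_derivative_compose[OF this assms[unfolded gderiv_def]]
  show ?thesis by (simp add: has_field_derivative_def inner_axis' mult_commute_abs)
qed

lemma pme_solution_exists:
  fixes \<rho> :: "real \<Rightarrow> real ^ 'd \<Rightarrow> real"
  assumes \<epsilon>: "\<epsilon> > 0" and sol: "smooth_pme_solution \<epsilon> \<rho>\<^sub>0 \<rho>"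
    and \<delta>: "\<delta> > 0" "\<And>u. \<delta> \<le> \<rho>\<^sub>0 u \<and> \<rho>\<^sub>0 u \<le> 1 - \<delta>"
  obtains g H h where "pme_solution \<rho> g H h \<delta>"
proof -
  from sol have reg: "parabolic_holder (nat \<lfloor>2 + \<epsilon>\<rfloor>) (frac (2 + \<epsilon>)) \<rho>" and per: "\<forall>t\<ge>0. torus_fun (\<rho> t)"
    and ini: "\<rho> 0 = \<rho>\<^sub>0"
    and eq: "\<And>t u. t \<ge> 0 \<Longrightarrow> ((\<lambda>s. \<rho> s u) has_real_derivative laplacian (\<lambda>v. (\<rho> t v)\<^sup>2) u) (at t within {0..})"
    by (auto simp: smooth_pme_solution_def parabolic_holder_torus_def)
  define \<alpha> where "\<alpha> = frac (2 + \<epsilon>)"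
  \<comment> \<open>The exponent \<open>2 + \<epsilon>\<close> may reach 3 and beyond, so the order
    is only known to be at least 2. This is why \<open>cont\<close> and \<open>first\<close> are
    shown for every order.\<close>
  have "nat \<lfloor>2 + \<epsilon>\<rfloor> \<ge> 2" using \<epsilon> by linarith
  then have "nat \<lfloor>2 + \<epsilon>\<rfloor> = Suc (Suc (nat \<lfloor>2 + \<epsilon>\<rfloor> - 2))" by simp
  then obtain k where k: "nat \<lfloor>2 + \<epsilon>\<rfloor> = Suc (Suc k)" by blast
  have cont: "continuous_on ({0..} \<times> UNIV) (\<lambda>(t, u). f t u)" if "parabolic_holder m \<alpha> f"
    for m and f :: "real \<Rightarrow> real ^ 'd \<Rightarrow> real"
    using that by (cases m; cases "m - 1") auto
  have first: "\<exists>g. (\<forall>t\<ge>0. \<forall>u. GDERIV (f t) u :> g t u) \<and> (\<forall>i. \<exists>m. parabolic_holder m \<alpha> (\<lambda>t u. g t u $ i))"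
    if "parabolic_holder (Suc m) \<alpha> f" for m and f :: "real \<Rightarrow> real ^ 'd \<Rightarrow> real"
  proof (cases m)
    case 0
    then obtain g where "\<forall>t\<ge>0. \<forall>u. GDERIV (f t) u :> g t u" "\<forall>i. parabolic_holder 0 \<alpha> (\<lambda>t u. g t u $ i)"
      using \<open>parabolic_holder (Suc m) \<alpha> f\<close> by auto
    then show ?thesis by (intro exI[of _ g] conjI allI exI[of _ 0]) auto
  next
    case (Suc l)
    then obtain g where "\<forall>t\<ge>0. \<forall>u. GDERIV (f t) u :> g t u" "\<forall>i. parabolic_holder (Suc l) \<alpha> (\<lambda>t u. g t u $ i)"
      using \<open>parabolic_holder (Suc m) \<alpha> f\<close> by auto
    then show ?thesis by (intro exI[of _ g] conjI allI exI[of _ "Suc l"]) auto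
  qed
  from reg k have reg': "parabolic_holder (Suc (Suc k)) \<alpha> \<rho>" by (simp add: \<alpha>_def)
  then obtain g h where g: "\<forall>t\<ge>0. \<forall>u. GDERIV (\<rho> t) u :> g t u" "\<forall>i. parabolic_holder (Suc k) \<alpha> (\<lambda>t u. g t u $ i)"
    and h: "\<forall>t\<ge>0. \<forall>u. ((\<lambda>s. \<rho> s u) has_real_derivative h t u) (at t within {0..})" "parabolic_holder k \<alpha> h"
    by auto
  have "\<forall>i. \<exists>Hi. (\<forall>t\<ge>0. \<forall>u. GDERIV (\<lambda>u. g t u $ i) u :> Hi t u) \<and> (\<forall>l. \<exists>m. parabolic_holder m \<alpha> (\<lambda>t u. Hi t u $ l))"
    using first g(2) by blast
  then obtain H where H: "\<And>i t u. t \<ge> 0 \<Longrightarrow> GDERIV (\<lambda>u. g t u $ i) u :> H i t u"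
    "\<And>i l. \<exists>m. parabolic_holder m \<alpha> (\<lambda>t u. H i t u $ l)"
    by metis
  have lap: "laplacian (\<lambda>v. (\<rho> t v)\<^sup>2) u = (\<Sum>i\<in>UNIV. 2 * (g t u $ i)\<^sup>2 + 2 * \<rho> t u * H i t u $ i)" if t: "t \<ge> 0" for t u
    unfolding laplacian_def
  proof (rule sum.cong[OF refl])
    fix i :: 'd
    have d1: "((\<lambda>s. \<rho> t (v + s *\<^sub>R axis i 1)) has_real_derivative g t v $ i) (at 0)" for v
      using GDERIV_line[of "\<rho> t" v 0 i "g t v"] g(1) t by simp
    have d2: "((\<lambda>s. g t (v + s *\<^sub>R axis i 1) $ i) has_real_derivative H i t v $ i) (at 0)" for v
      using GDERIV_line[of "\<lambda>u. g t u $ i" v 0 i "H i t v"] H(1)[OF t] by simp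
    have "((\<lambda>s. (\<rho> t (v + s *\<^sub>R axis i 1))\<^sup>2) has_real_derivative 2 * \<rho> t v * g t v $ i) (at 0)" for v
      by (auto intro!: derivative_eq_intros d1)
    then have "partial_deriv i (\<lambda>v. (\<rho> t v)\<^sup>2) = (\<lambda>v. 2 * \<rho> t v * g t v $ i)"
      unfolding partial_deriv_def by (auto simp: DERIV_imp_deriv)
    moreover have "((\<lambda>s. 2 * \<rho> t (u + s *\<^sub>R axis i 1) * g t (u + s *\<^sub>R axis i 1) $ i) has_real_derivative
        2 * (g t u $ i)\<^sup>2 + 2 * \<rho> t u * H i t u $ i) (at 0)"
      by (auto intro!: derivative_eq_intros d1 d2 simp: power2_eq_square)
    ultimately show "partial_deriv i (partial_deriv i (\<lambda>v. (\<rho> t v)\<^sup>2)) u = 2 * (g t u $ i)\<^sup>2 + 2 * \<rho> t u * H i t u $ i"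
      by (simp add: partial_deriv_def DERIV_imp_deriv)
  qed
  have "pme_solution \<rho> g H h \<delta>"
  proof
    fix t :: real and u :: "real ^ 'd" assume t: "t \<ge> 0"
    have le: "at_right t \<le> at t within {0..}" by (rule at_le) (use t in auto)
    \<comment> \<open>The two time derivatives are identified through the limit from the right,
      which is available at time 0 as well.\<close>
    have "((\<lambda>s. \<rho> s u) has_real_derivative h t u) (at_right t)"
      "((\<lambda>s. \<rho> s u) has_real_derivative laplacian (\<lambda>v. (\<rho> t v)\<^sup>2) u) (at_right t)"
      using h(1) eq[OF t, of u] t by (auto intro!: DERIV_subset[of _ _ _ "{0..}" "{t<..}"])
    then have "h t u = laplacian (\<lambda>v. (\<rho> t v)\<^sup>2) u"
      unfolding has_field_derivative_iff by (rule tendsto_unique[rotated]) simp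
    then show "h t u = (\<Sum>i\<in>UNIV. 2 * (g t u $ i)\<^sup>2 + 2 * \<rho> t u * H i t u $ i)"
      by (simp add: lap[OF t])
  next
    show "continuous_on ({0..} \<times> UNIV) (\<lambda>(t, u). H i t u $ i)" for i
      using H(2)[of i i] cont by blast
  qed (use per g h H(1) \<delta> ini cont[OF reg'] cont[OF h(2)] cont[OF g(2)[rule_format]] in auto)
  then show thesis by (rule that)
qed

section \<open>The comparison principle\<close>

lemma torus_representative:
  fixes v :: "real ^ 'd"
  assumes "torus_fun f"
  obtains w where "w \<in> cbox 0 (\<chi> i. 1)" "f v = f w"
proof -
  define w where "w = (\<chi> i. frac (v $ i))"
  have "v = w + (\<chi> i. of_int ((\<chi> i. \<lfloor>v $ i\<rfloor>) $ i))"
    by (simp add: vec_eq_iff w_def frac_def)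
  then have "f v = f w" using assms unfolding torus_fun_def by metis
  moreover have "w \<in> cbox 0 (\<chi> i. 1)"
    by (simp add: w_def mem_box_cart less_imp_le frac_lt_1)
  ultimately show thesis using that by blast
qed

text \<open>By periodicity all touching times are seen on a compact set, the product of
  \<open>{0..t0}\<close> and the closed unit cube, where the projection to time attains its minimum.
  The bound at that time is the limit of the bounds at earlier times.\<close>

lemma first_touching:
  fixes V :: "real \<Rightarrow> real ^ 'd \<Rightarrow> real"
  assumes cont: "continuous_on ({0..} \<times> UNIV) (\<lambda>(t, u). V t u)"
    and per: "\<And>t. t \<ge> 0 \<Longrightarrow> torus_fun (V t)"
    and ini: "\<And>u. V 0 u > c" and t0: "t0 \<ge> 0" "V t0 u0 \<le> c"
  obtains t u where "0 < t" "t \<le> t0" "V t u = c" "\<And>v. V t v \<ge> c" "\<And>s v. 0 \<le> s \<Longrightarrow> s < t \<Longrightarrow> V s v > c"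
proof -
  let ?D = "{0..t0} \<times> cbox 0 (\<chi> i. 1) :: (real \<times> (real ^ 'd)) set"
  let ?K = "?D \<inter> (\<lambda>(t, u). V t u) -` {..c}"
  have "compact ?D" by (intro compact_Times) auto
  moreover have "continuous_on ?D (\<lambda>(t, u). V t u)"
    by (rule continuous_on_subset[OF cont]) auto
  ultimately have "compact ?K"
    by (metis (no_types, lifting) closed_atMost compact_imp_closed compact_Int_closed continuous_closed_preimage
        inf.left_idem)
  moreover obtain w where "w \<in> cbox 0 (\<chi> i. 1)" "V t0 u0 = V t0 w"
    using torus_representative[OF per[OF t0(1)]] by blast
  then have "(t0, w) \<in> ?K" using t0 by auto
  moreover have "continuous_on ?K fst" by (intro continuous_intros)
  ultimately obtain p where p: "p \<in> ?K" "\<And>p'. p' \<in> ?K \<Longrightarrow> fst p \<le> fst p'"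
    using continuous_attains_inf[of ?K fst] by blast
  obtain t u where tu: "p = (t, u)" by force
  have t: "0 \<le> t" "t \<le> t0" "V t u \<le> c" using p(1) tu by auto
  have before: "V s v > c" if st: "0 \<le> s" "s < t" for s v
  proof (rule ccontr)
    assume "\<not> V s v > c"
    moreover obtain w where "w \<in> cbox 0 (\<chi> i. 1)" "V s v = V s w"
      using torus_representative[OF per[OF st(1)]] by blast
    ultimately have "(s, w) \<in> ?K" using st t by auto
    from p(2)[OF this] st tu show False by simp
  qed
  have tpos: "t > 0" using t ini[of u] by (cases "t = 0") auto
  have "V t v \<ge> c" for v
  proof -
    have "continuous_on {0..t} (\<lambda>s. case (s, v) of (t, u) \<Rightarrow> V t u)"
      by (rule continuous_on_compose2[OF cont]) (auto intro!: continuous_intros)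
    then have "((\<lambda>s. V s v) \<longlongrightarrow> V t v) (at t within {0..t})"
      using tpos by (simp add: continuous_on_def)
    then have "((\<lambda>s. V s v) \<longlongrightarrow> V t v) (at_left t)"
      using tpos by (simp add: at_within_Icc_at_left)
    moreover have "eventually (\<lambda>s. V s v \<ge> c) (at_left t)"
      by (rule eventually_at_leftI[OF _ tpos]) (use before in \<open>auto intro!: less_imp_le\<close>)
    ultimately show ?thesis by (rule tendsto_lowerbound) simp
  qed
  moreover from this[of u] t have "V t u = c" by simp
  ultimately show thesis using that tpos t before by blast
qed

lemma second_derivative_at_min:
  fixes F F' :: "real \<Rightarrow> real"
  assumes d: "\<And>s. (F has_real_derivative F' s) (at s)" and d2: "(F' has_real_derivative K) (at 0)"
    and m: "\<And>s. F 0 \<le> F s"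
  shows "F' 0 = 0" "K \<ge> 0"
proof -
  show z: "F' 0 = 0" by (rule DERIV_local_min[OF d, of 1]) (use m in auto)
  show "K \<ge> 0"
  proof (rule ccontr)
    assume "\<not> K \<ge> 0"
    then obtain e where e: "e > 0" "\<And>s. 0 < s \<Longrightarrow> s < e \<Longrightarrow> F' s < F' 0"
      using DERIV_neg_dec_right[OF d2] by auto
    obtain x where x: "0 < x" "x < e / 2" "F (e / 2) - F 0 = (e / 2 - 0) * F' x"
      using MVT2[of 0 "e / 2" F F'] e(1) d by auto
    then have "F' x < 0" using e z by auto
    then have "(e / 2 - 0) * F' x < 0" using e(1) by (intro mult_pos_neg) auto
    then show False using x(3) m[of "e / 2"] by simp
  qed
qed

context pme_solution
begin

lemma line1: "t \<ge> 0 \<Longrightarrow> ((\<lambda>s. \<rho> t (u + s *\<^sub>R axis i 1)) has_real_derivative g t (u + s *\<^sub>R axis i 1) $ i) (at s)"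
  by (rule GDERIV_line[OF grad])

lemma line2: "t \<ge> 0 \<Longrightarrow> ((\<lambda>s. g t (u + s *\<^sub>R axis i 1) $ i) has_real_derivative H i t (u + s *\<^sub>R axis i 1) $ i) (at s)"
  by (rule GDERIV_line[OF hess])

text \<open>The maximum principle for \<open>\<rho>\<close> (\<open>\<sigma> = 1\<close>) and for \<open>- \<rho>\<close> (\<open>\<sigma> = -1\<close>). The equation is parabolic
  only where \<open>\<rho>\<close> is positive, whence the condition at the first touching point.\<close>

lemma comparison:
  assumes \<sigma>: "\<sigma> = 1 \<or> \<sigma> = -1" and c: "\<And>u. \<sigma> * \<rho> 0 u \<ge> c" and \<kappa>: "\<kappa> > 0"
    and nn: "\<And>t u. t \<ge> 0 \<Longrightarrow> \<sigma> * \<rho> t u \<ge> c - \<kappa> \<Longrightarrow> \<rho> t u \<ge> 0"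
    and t0: "t0 \<ge> 0"
  shows "\<sigma> * \<rho> t0 u0 \<ge> c"
proof (rule ccontr)
  assume neg: "\<not> ?thesis"
  \<comment> \<open>The slope of the correction in time. Bounded through \<open>\<kappa>\<close>, it
    keeps the touching point where \<open>nn\<close> applies; bounded through the defect at
    \<open>(t0, u0)\<close>, it still lets \<open>V\<close> come down to \<open>c - \<theta>\<close>
    there.\<close>
  define \<theta> where "\<theta> = min \<kappa> (c - \<sigma> * \<rho> t0 u0) / (1 + t0)"
  have \<theta>: "\<theta> > 0" "\<theta> * (1 + t0) \<le> \<kappa>" "\<theta> * (1 + t0) \<le> c - \<sigma> * \<rho> t0 u0"
    using neg \<kappa> t0 by (auto simp: \<theta>_def)
  define V where "V t u = \<sigma> * \<rho> t u + \<theta> * t" for t u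
  have "continuous_on ({0..} \<times> UNIV) (\<lambda>p. \<sigma> * (case p of (t, u) \<Rightarrow> \<rho> t u) + \<theta> * fst p)"
    by (intro continuous_intros cont_rho)
  then have "continuous_on ({0..} \<times> UNIV) (\<lambda>(t, u). V t u)"
    by (simp add: V_def case_prod_beta')
  moreover have "torus_fun (V t)" if "t \<ge> 0" for t
    using per[OF that] by (simp add: torus_fun_def V_def)
  moreover have "V 0 u > c - \<theta>" for u using c[of u] \<theta>(1) by (simp add: V_def)
  moreover have "V t0 u0 \<le> c - \<theta>" using \<theta>(3) by (simp add: V_def algebra_simps)
  ultimately obtain t u where t: "0 < t" "t \<le> t0" "V t u = c - \<theta>" "\<And>v. V t v \<ge> c - \<theta>"
      "\<And>s v. 0 \<le> s \<Longrightarrow> s < t \<Longrightarrow> V s v > c - \<theta>"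
    using first_touching[of V "c - \<theta>" t0 u0] t0 by blast
  have tt: "t \<ge> 0" using t by simp
  have mins: "\<sigma> * \<rho> t u \<le> \<sigma> * \<rho> t v" for v using t(3) t(4)[of v] by (simp add: V_def)
  have gH: "\<sigma> * g t u $ i = 0" "\<sigma> * H i t u $ i \<ge> 0" for i
  proof -
    have "((\<lambda>s. \<sigma> * \<rho> t (u + s *\<^sub>R axis i 1)) has_real_derivative \<sigma> * g t (u + s *\<^sub>R axis i 1) $ i) (at s)" for s
      by (intro DERIV_cmult line1 tt)
    moreover have "((\<lambda>s. \<sigma> * g t (u + s *\<^sub>R axis i 1) $ i) has_real_derivative \<sigma> * H i t u $ i) (at 0)"
      using DERIV_cmult[OF line2[OF tt, of u i 0], of \<sigma>] by simp
    ultimately show "\<sigma> * g t u $ i = 0" "\<sigma> * H i t u $ i \<ge> 0"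
      using second_derivative_at_min[of "\<lambda>s. \<sigma> * \<rho> t (u + s *\<^sub>R axis i 1)" "\<lambda>s. \<sigma> * g t (u + s *\<^sub>R axis i 1) $ i" "\<sigma> * H i t u $ i"] mins
      by auto
  qed
  have "\<theta> * t \<le> \<theta> * t0" using \<theta>(1) t(2) by simp
  then have "\<rho> t u \<ge> 0" using \<theta>(2) t(3) by (intro nn tt) (simp add: V_def algebra_simps)
  then have "\<sigma> * h t u \<ge> 0"
    unfolding pde[OF tt] sum_distrib_left
  proof (intro sum_nonneg)
    fix i assume r: "\<rho> t u \<ge> 0"
    have "g t u $ i = 0" using gH(1)[of i] \<sigma> by auto
    moreover have "0 \<le> 2 * \<rho> t u * (\<sigma> * H i t u $ i)" by (rule mult_nonneg_nonneg) (use r gH(2) in auto)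
    ultimately show "0 \<le> \<sigma> * (2 * (g t u $ i)\<^sup>2 + 2 * \<rho> t u * H i t u $ i)" by (simp add: algebra_simps)
  qed
  moreover have "((\<lambda>s. V s u) has_real_derivative \<sigma> * h t u + \<theta>) (at t)"
  proof -
    have "at t within {0..} = at t" using t(1) by (intro at_within_interior) simp
    then have "((\<lambda>s. \<rho> s u) has_real_derivative h t u) (at t)" using time[OF tt, of u] by simp
    then show ?thesis unfolding V_def by (auto intro!: derivative_eq_intros)
  qed
  \<comment> \<open>At the touching point the right-hand side of the equation has a sign, so
    \<open>V\<close> grows there at a rate of at least \<open>\<theta>\<close>; hence it was lower
    just before, too early for the first touching time.\<close>
  ultimately obtain e where e: "e > 0" "\<And>s. 0 < s \<Longrightarrow> s < e \<Longrightarrow> V (t - s) u < V t u"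
    using DERIV_pos_inc_left[of "\<lambda>s. V s u" "\<sigma> * h t u + \<theta>" t] \<theta>(1) by auto
  define s where "s = min (e / 2) (t / 2)"
  have "0 < s" "s < e" "s < t" using e(1) t(1) by (auto simp: s_def)
  then show False using e(2)[of s] t(3) t(5)[of "t - s" u] by auto
qed

text \<open>In the lower bound the margin \<open>\<kappa> = \<delta>\<close> keeps the touching
  value nonnegative. The upper bound takes the nonnegativity from the lower bound, so any margin
  will do, here 1.\<close>

lemma rho_bounds: "t \<ge> 0 \<Longrightarrow> \<delta> \<le> \<rho> t u" "t \<ge> 0 \<Longrightarrow> \<rho> t u \<le> 1 - \<delta>"
proof -
  show lower: "\<delta> \<le> \<rho> t u" if "t \<ge> 0" for t u
    using comparison[of 1 \<delta> \<delta> t u] init \<delta> that by simp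
  show "\<rho> t u \<le> 1 - \<delta>" if "t \<ge> 0" for t u
  proof -
    have "\<rho> s v \<ge> 0" if "s \<ge> 0" for s v using lower[OF that, of v] \<delta> by simp
    moreover have i: "-1 * \<rho> 0 v \<ge> - (1 - \<delta>)" for v using init[of v] by simp
    ultimately have "- (1 - \<delta>) \<le> -1 * \<rho> t u"
      using comparison[OF _ i, of 1 t u] \<open>t \<ge> 0\<close> by simp
    then show ?thesis by simp
  qed
qed

end

section \<open>Discretization of the equation\<close>

context pme_solution
begin

text \<open>The chemical potential of the macroscopic profile; \<open>pot1 j\<close> and
  \<open>pot2 j\<close> are its first and second derivatives in direction \<open>j\<close>, written
  out by the quotient rule.\<close>

definition pot :: "real \<Rightarrow> real ^ 'd \<Rightarrow> real" where
  "pot t u = ln (\<rho> t u / (1 - \<rho> t u))"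

definition pot1 :: "'d \<Rightarrow> real \<Rightarrow> real ^ 'd \<Rightarrow> real" where
  "pot1 j t u = g t u $ j / (\<rho> t u * (1 - \<rho> t u))"

definition pot2 :: "'d \<Rightarrow> real \<Rightarrow> real ^ 'd \<Rightarrow> real" where
  "pot2 j t u = H j t u $ j / (\<rho> t u * (1 - \<rho> t u))
     - (1 - 2 * \<rho> t u) * (g t u $ j)\<^sup>2 / (\<rho> t u * (1 - \<rho> t u))\<^sup>2"

lemma rho_pos: "t \<ge> 0 \<Longrightarrow> 0 < \<rho> t u" "t \<ge> 0 \<Longrightarrow> \<rho> t u < 1" 
  using rho_bounds[of t u] \<delta> by linarith+

lemma rho_ne: "t \<ge> 0 \<Longrightarrow> \<rho> t u \<noteq> 0" "t \<ge> 0 \<Longrightarrow> 1 - \<rho> t u \<noteq> 0"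
  using rho_pos[of t u] by auto

lemma pot_line:
  assumes t: "t \<ge> 0"
  shows "((\<lambda>s. pot t (u + s *\<^sub>R axis j 1)) has_real_derivative pot1 j t (u + s *\<^sub>R axis j 1)) (at s)"
proof -
  let ?r = "\<rho> t (u + s *\<^sub>R axis j 1)" and ?g = "g t (u + s *\<^sub>R axis j 1) $ j"
  have r: "0 < ?r" "?r < 1" using rho_pos[OF t] by auto
  have pot_eq: "pot t v = ln (\<rho> t v) - ln (1 - \<rho> t v)" for v
    using rho_pos[OF t, of v] by (simp add: pot_def ln_div)
  have "((\<lambda>s. ln (\<rho> t (u + s *\<^sub>R axis j 1)) - ln (1 - \<rho> t (u + s *\<^sub>R axis j 1))) has_real_derivative
      ?g / ?r + ?g / (1 - ?r)) (at s)"
    using r by (auto intro!: derivative_eq_intros line1[OF t])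
  also have "?g / ?r + ?g / (1 - ?r) = pot1 j t (u + s *\<^sub>R axis j 1)"
    using r by (simp add: pot1_def add_frac_eq flip: distrib_left)
  finally show ?thesis
    by (simp add: pot_eq)
qed

lemma pot1_line:
  assumes t: "t \<ge> 0"
  shows "((\<lambda>s. pot1 j t (u + s *\<^sub>R axis j 1)) has_real_derivative pot2 j t (u + s *\<^sub>R axis j 1)) (at s)"
proof -
  let ?v = "u + s *\<^sub>R axis j 1"
  have r: "\<rho> t ?v * (1 - \<rho> t ?v) \<noteq> 0" using rho_ne[OF t, of ?v] by simp
  have "((\<lambda>s. pot1 j t (u + s *\<^sub>R axis j 1)) has_real_derivative
     (H j t ?v $ j * (\<rho> t ?v * (1 - \<rho> t ?v)) - g t ?v $ j * (g t ?v $ j * (1 - \<rho> t ?v) + - g t ?v $ j * \<rho> t ?v))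
      / ((\<rho> t ?v * (1 - \<rho> t ?v)) * (\<rho> t ?v * (1 - \<rho> t ?v)))) (at s)"
    unfolding pot1_def
  proof (rule DERIV_divide)
    show "((\<lambda>s. \<rho> t (u + s *\<^sub>R axis j 1) * (1 - \<rho> t (u + s *\<^sub>R axis j 1))) has_real_derivative
        g t ?v $ j * (1 - \<rho> t ?v) + - g t ?v $ j * \<rho> t ?v) (at s)"
      by (auto intro!: derivative_eq_intros line1[OF t])
  qed (rule line2[OF t], rule r)
  also have "(H j t ?v $ j * (\<rho> t ?v * (1 - \<rho> t ?v)) - g t ?v $ j * (g t ?v $ j * (1 - \<rho> t ?v) + - g t ?v $ j * \<rho> t ?v))
      / ((\<rho> t ?v * (1 - \<rho> t ?v)) * (\<rho> t ?v * (1 - \<rho> t ?v))) = pot2 j t ?v"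
  proof -
    define R where "R = \<rho> t ?v * (1 - \<rho> t ?v)"
    have "g t ?v $ j * (g t ?v $ j * (1 - \<rho> t ?v) + - g t ?v $ j * \<rho> t ?v) = (1 - 2 * \<rho> t ?v) * (g t ?v $ j)\<^sup>2"
      by (simp add: power2_eq_square algebra_simps)
    then show ?thesis using r unfolding pot2_def R_def[symmetric]
      by (simp add: diff_divide_distrib power2_eq_square)
  qed
  finally show ?thesis .
qed

text \<open>This is where the equation enters: in the limit, the linear coefficient of the drift is
  the time derivative of the potential, hence it cancels the term that comes from the motion of the
  reference measure.\<close>

lemma pot_consistency:
  assumes t: "t \<ge> 0"
  shows "(\<Sum>j\<in>UNIV. pot2 j t u * (2 * \<rho> t u) + (pot1 j t u)\<^sup>2 / 2 * (8 * \<rho> t u - 12 * (\<rho> t u)\<^sup>2))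
     = h t u / (\<rho> t u * (1 - \<rho> t u))"
  unfolding pde[OF t] sum_divide_distrib
proof (rule sum.cong[OF refl])
  fix j :: 'd
  have r: "\<rho> t u \<noteq> 0" "1 - \<rho> t u \<noteq> 0" using rho_ne[OF t, of u] by auto
  define a b where "a = \<rho> t u" and "b = 1 - \<rho> t u"
  have ab: "a \<noteq> 0" "b \<noteq> 0" "8 * \<rho> t u - 12 * (\<rho> t u)\<^sup>2 = 8 * a - 12 * a\<^sup>2" "1 - 2 * \<rho> t u = b - a" "a = 1 - b" using r by (auto simp: a_def b_def)
  have "H j t u $ j / (a * b) * (2 * a) - (b - a) * (g t u $ j)\<^sup>2 / (a * b)\<^sup>2 * (2 * a) + (g t u $ j)\<^sup>2 / (a * b)\<^sup>2 / 2 * (8 * a - 12 * a\<^sup>2)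
    = 2 * a * H j t u $ j / (a * b) + (g t u $ j)\<^sup>2 / (a * b)\<^sup>2 * ((8 * a - 12 * a\<^sup>2) / 2 - (b - a) * (2 * a))"
    by (simp add: algebra_simps diff_divide_distrib add_divide_distrib)
  also have "(8 * a - 12 * a\<^sup>2) / 2 - (b - a) * (2 * a) = 2 * (a * b)"
    unfolding ab(5) by (simp add: power2_eq_square field_simps)
  also have "(g t u $ j)\<^sup>2 / (a * b)\<^sup>2 * (2 * (a * b)) = 2 * (g t u $ j)\<^sup>2 / (a * b)"
    using ab(1,2) by (simp add: power2_eq_square)
  finally show "pot2 j t u * (2 * \<rho> t u) + (pot1 j t u)\<^sup>2 / 2 * (8 * \<rho> t u - 12 * (\<rho> t u)\<^sup>2) =
       (2 * (g t u $ j)\<^sup>2 + 2 * \<rho> t u * H j t u $ j) / (\<rho> t u * (1 - \<rho> t u))"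
    unfolding pot2_def pot1_def ab(3,4) unfolding b_def[symmetric] unfolding a_def[symmetric]
    unfolding left_diff_distrib[of "H j t u $ j / (a * b)" _ "2 * a"] power_divide add_divide_distrib[of "2 * (g t u $ j)\<^sup>2"]
    by (rule trans[OF _ add.commute])
qed

lemma cont_rho': "continuous_on ({0..} \<times> UNIV) (\<lambda>p. \<rho> (fst p) (snd p))"
  using cont_rho by (simp add: case_prod_beta')

lemma cont_g': "continuous_on ({0..} \<times> UNIV) (\<lambda>p. g (fst p) (snd p) $ j)"
  using cont_g[of j] by (simp add: case_prod_beta')

lemma cont_H': "continuous_on ({0..} \<times> UNIV) (\<lambda>p. H j (fst p) (snd p) $ j)"
  using cont_H[of j] by (simp add: case_prod_beta')

lemma cont_pot1: "continuous_on ({0..} \<times> UNIV) (\<lambda>p. pot1 j (fst p) (snd p))"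
  unfolding pot1_def
  by (intro continuous_on_divide continuous_on_mult continuous_on_diff continuous_on_const cont_rho' cont_g')
     (auto simp: rho_ne less_imp_neq[OF rho_pos(2)])

lemma cont_pot2: "continuous_on ({0..} \<times> UNIV) (\<lambda>p. pot2 j (fst p) (snd p))"
  unfolding pot2_def
  by (intro continuous_on_divide continuous_on_mult continuous_on_diff continuous_on_const continuous_on_power
      cont_rho' cont_g' cont_H') (auto simp: rho_ne less_imp_neq[OF rho_pos(2)])

text \<open>The enlarged cube contains every axis-parallel step of length at most 1 from a point of
  the unit cube, so intermediate points of the mean value theorem need no reduction modulo the
  lattice.\<close>

abbreviation slab :: "real \<Rightarrow> (real \<times> (real ^ 'd)) set" where
  "slab T \<equiv> {0..T} \<times> cbox (\<chi> i. -1) (\<chi> i. 2)"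

lemma line_in_box:
  fixes u :: "real ^ 'd"
  assumes "u \<in> cbox 0 (\<chi> i. 1)" "\<bar>s\<bar> \<le> 1"
  shows "u + s *\<^sub>R axis j 1 \<in> cbox (\<chi> i. -1) (\<chi> i. 2)"
proof -
  have "0 \<le> u $ i \<and> u $ i \<le> 1" for i using assms(1) by (simp add: mem_box_cart)
  moreover have "\<bar>s * axis j 1 $ i\<bar> \<le> 1" for i using assms(2) by (cases "i = j") (auto simp: axis_def)
  ultimately have "-1 \<le> u $ i + s * axis j 1 $ i \<and> u $ i + s * axis j 1 $ i \<le> 2" for i
    by (smt (verit))
  then show ?thesis by (simp add: mem_box_cart)
qed

lemma derivative_bounds:
  obtains \<Lambda> where "\<Lambda> > 0"
    "\<And>t u j. 0 \<le> t \<Longrightarrow> t \<le> T \<Longrightarrow> u \<in> cbox (\<chi> i. -1) (\<chi> i. 2) \<Longrightarrow> \<bar>g t u $ j\<bar> \<le> \<Lambda> \<and> \<bar>pot1 j t u\<bar> \<le> \<Lambda> \<and> \<bar>pot2 j t u\<bar> \<le> \<Lambda>"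
proof -
  let ?F = "\<lambda>p. \<Sum>j\<in>UNIV. \<bar>g (fst p) (snd p) $ j\<bar> + \<bar>pot1 j (fst p) (snd p)\<bar> + \<bar>pot2 j (fst p) (snd p)\<bar>"
  have "continuous_on ({0..} \<times> UNIV) ?F"
    by (intro continuous_on_sum continuous_on_add continuous_on_rabs cont_pot1 cont_pot2 cont_g')
  then have "continuous_on (slab T) ?F" by (rule continuous_on_subset) auto
  then have "compact (?F ` slab T)"
    by (rule compact_continuous_image) (intro compact_Times compact_Icc compact_cbox)
  then obtain B where B: "\<And>p. p \<in> slab T \<Longrightarrow> norm (?F p) \<le> B"
    by (meson bounded_iff compact_imp_bounded imageI)
  show thesis
  proof (rule that[of "\<bar>B\<bar> + 1"])
    fix t :: real and u :: "real ^ 'd" and j :: 'd assume tu: "0 \<le> t" "t \<le> T" "u \<in> cbox (\<chi> i. -1) (\<chi> i. 2)"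
    have "?F (t, u) \<le> B" using B[of "(t, u)"] tu by auto
    moreover have "\<bar>g t u $ j\<bar> + \<bar>pot1 j t u\<bar> + \<bar>pot2 j t u\<bar> \<le> ?F (t, u)"
      unfolding fst_conv snd_conv by (rule member_le_sum) auto
    ultimately show "\<bar>g t u $ j\<bar> \<le> \<bar>B\<bar> + 1 \<and> \<bar>pot1 j t u\<bar> \<le> \<bar>B\<bar> + 1 \<and> \<bar>pot2 j t u\<bar> \<le> \<bar>B\<bar> + 1"
      by linarith
  qed simp
qed

lemma derivative_modulus:
  assumes "\<phi> > 0"
  obtains d where "d > 0"
    "\<And>t u v j. 0 \<le> t \<Longrightarrow> t \<le> T \<Longrightarrow> u \<in> cbox (\<chi> i. -1) (\<chi> i. 2) \<Longrightarrow> v \<in> cbox (\<chi> i. -1) (\<chi> i. 2) \<Longrightarrow> dist u v < d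
      \<Longrightarrow> \<bar>pot1 j t u - pot1 j t v\<bar> \<le> \<phi> \<and> \<bar>pot2 j t u - pot2 j t v\<bar> \<le> \<phi>"
proof -
  let ?F = "\<lambda>p. ((\<chi> j. pot1 j (fst p) (snd p)) :: real ^ 'd, (\<chi> j. pot2 j (fst p) (snd p)) :: real ^ 'd)"
  have "continuous_on ({0..} \<times> UNIV) ?F"
    by (intro continuous_intros continuous_on_vec_lambda cont_pot1 cont_pot2)
  then have "continuous_on (slab T) ?F" by (rule continuous_on_subset) auto
  then have "uniformly_continuous_on (slab T) ?F"
    by (rule compact_uniformly_continuous) (intro compact_Times compact_Icc compact_cbox)
  then obtain d where d: "d > 0" "\<And>p p'. p \<in> slab T \<Longrightarrow> p' \<in> slab T \<Longrightarrow> dist p' p < d \<Longrightarrow> dist (?F p') (?F p) < \<phi>"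
    using assms unfolding uniformly_continuous_on_def by metis
  show thesis
  proof (rule that[OF d(1)])
    fix t :: real and u v :: "real ^ 'd" and j :: 'd assume tu: "0 \<le> t" "t \<le> T" "u \<in> cbox (\<chi> i. -1) (\<chi> i. 2)" "v \<in> cbox (\<chi> i. -1) (\<chi> i. 2)" "dist u v < d"
    have F: "dist (?F (t, u)) (?F (t, v)) < \<phi>" by (rule d(2)) (use tu in \<open>auto simp: dist_Pair_Pair\<close>)
    have "dist (fst (?F (t, u)) $ j) (fst (?F (t, v)) $ j) \<le> dist (?F (t, u)) (?F (t, v))"
      by (rule order_trans[OF dist_vec_nth_le dist_fst_le])
    moreover have "dist (snd (?F (t, u)) $ j) (snd (?F (t, v)) $ j) \<le> dist (?F (t, u)) (?F (t, v))"
      by (rule order_trans[OF dist_vec_nth_le dist_snd_le])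
    ultimately show "\<bar>pot1 j t u - pot1 j t v\<bar> \<le> \<phi> \<and> \<bar>pot2 j t u - pot2 j t v\<bar> \<le> \<phi>"
      using F by (simp add: dist_real_def)
  qed
qed

lemma first_difference:
  assumes t: "t \<ge> 0" and e: "e > 0"
  obtains s where "0 < s" "s < e" "pot t (u + e *\<^sub>R axis j 1) - pot t u = e * pot1 j t (u + s *\<^sub>R axis j 1)"
proof -
  have "\<exists>s. 0 < s \<and> s < e \<and> pot t (u + e *\<^sub>R axis j 1) - pot t (u + 0 *\<^sub>R axis j 1) = (e - 0) * pot1 j t (u + s *\<^sub>R axis j 1)"
    by (rule MVT2[OF e]) (rule pot_line[OF t])
  then show thesis using that by auto
qed

text \<open>Maclaurin's formula at order two for the sum of the values of \<open>pot\<close> at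
  opposite displacements, an even function whose first derivative vanishes at 0. A single
  intermediate \<open>s\<close> thus serves both sides.\<close>

lemma second_difference:
  assumes t: "t \<ge> 0" and e: "e > 0"
  obtains s where "0 < s" "s < e" "pot t (u + e *\<^sub>R axis j 1) + pot t (u + (- e) *\<^sub>R axis j 1) - 2 * pot t u
     = e\<^sup>2 / 2 * (pot2 j t (u + s *\<^sub>R axis j 1) + pot2 j t (u + (- s) *\<^sub>R axis j 1))"
proof -
  let ?P = "\<lambda>f s. f (u + s *\<^sub>R axis j 1)"
  define D where "D m s = (if m = 0 then ?P (pot t) s + ?P (pot t) (- s)
     else if m = 1 then ?P (pot1 j t) s - ?P (pot1 j t) (- s) else ?P (pot2 j t) s + ?P (pot2 j t) (- s))" for m :: nat and s
  have neg: "((\<lambda>s. f (- s)) has_real_derivative - f') (at s)" if "(f has_real_derivative f') (at (- s))" for f f' and s :: real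
    using DERIV_mirror[of f f' s] that by simp
  have "\<exists>s. 0 < s \<and> s < e \<and> D 0 e = (\<Sum>m<2. D m 0 / fact m * e ^ m) + D 2 s / fact 2 * e ^ 2"
  proof (rule Maclaurin[OF e _ refl])
    show "\<forall>(m :: nat) s. m < 2 \<and> 0 \<le> s \<and> s \<le> e \<longrightarrow> (D m has_real_derivative D (Suc m) s) (at s)"
    proof (intro allI impI)
      fix m :: nat and s assume "m < 2 \<and> 0 \<le> s \<and> s \<le> e"
      then consider "m = 0" | "m = 1" by linarith
      then show "(D m has_real_derivative D (Suc m) s) (at s)"
      proof cases
        case 1
        have "((\<lambda>s. ?P (pot t) s + ?P (pot t) (- s)) has_real_derivative ?P (pot1 j t) s + - ?P (pot1 j t) (- s)) (at s)"
          by (intro DERIV_add pot_line[OF t] neg)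
        then show ?thesis using 1 by (simp add: D_def[abs_def])
      next
        case 2
        have "((\<lambda>s. ?P (pot1 j t) s - ?P (pot1 j t) (- s)) has_real_derivative ?P (pot2 j t) s - - ?P (pot2 j t) (- s)) (at s)"
          by (intro DERIV_diff pot1_line[OF t] neg)
        then show ?thesis using 2 by (simp add: D_def[abs_def])
      qed
    qed
  qed simp
  then obtain s where s: "0 < s" "s < e" "D 0 e = (\<Sum>m<2. D m 0 / fact m * e ^ m) + D 2 s / fact 2 * e ^ 2" by blast
  have "(\<Sum>m<2. D m 0 / fact m * e ^ m) = 2 * pot t u"
    by (simp add: D_def lessThan_nat_numeral)
  with s(3) have "pot t (u + e *\<^sub>R axis j 1) + pot t (u + (- e) *\<^sub>R axis j 1) - 2 * pot t u
     = e\<^sup>2 / 2 * (pot2 j t (u + s *\<^sub>R axis j 1) + pot2 j t (u + (- s) *\<^sub>R axis j 1))"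
    by (simp add: D_def mult.commute)
  with s show thesis using that by blast
qed

end

section \<open>The profile sampled on the lattice\<close>

lemma embed_shift:
  assumes N: "N \<ge> 1" and f: "torus_fun f"
  shows "f (embed N (shift N j k x)) = f (embed N x + (of_int k / real N) *\<^sub>R axis j 1)"
proof -
  have N0: "real N > 0" using N by simp
  define q where "q i = (x $ i + (if i = j then k else 0)) div int N" for i
  have "embed N x + (of_int k / real N) *\<^sub>R axis j 1 = embed N (shift N j k x) + (\<chi> i. of_int ((\<chi> i. q i) $ i))"
  proof (simp add: vec_eq_iff, intro allI)
    fix i
    have "x $ i + (if i = j then k else 0) = int N * q i + shift N j k x $ i"
      unfolding shift_nth q_def by simp
    then have "real_of_int (x $ i) + (if i = j then of_int k else 0) = real N * of_int (q i) + of_int (shift N j k x $ i)"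
      using arg_cong[of _ _ real_of_int] by (cases "i = j") fastforce+
    then show "embed N x $ i + of_int k * axis j 1 $ i / real N = embed N (shift N j k x) $ i + of_int (q i)"
      using N0 by (auto simp: embed_def axis_def field_simps split: if_splits)
  qed
  then show ?thesis using f unfolding torus_fun_def by metis
qed

lemma embed_in_cube: "N \<ge> 1 \<Longrightarrow> x \<in> sites N \<Longrightarrow> embed N x \<in> cbox 0 (\<chi> i. 1)"
proof -
  assume N: "N \<ge> 1" and x: "x \<in> sites N"
  have "0 \<le> real_of_int (x $ i)" "real_of_int (x $ i) \<le> real N" for i
    using x by (auto simp: sites_iff less_imp_le) (metis less_imp_le of_int_le_iff of_int_of_nat_eq)
  then show ?thesis using N by (simp add: mem_box_cart embed_def)
qed

context pme_solution
begin

abbreviation rN :: "nat \<Rightarrow> real \<Rightarrow> int ^ 'd \<Rightarrow> real" where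
  "rN N t x \<equiv> \<rho> t (embed N x)"

lemma params_rN: "N \<ge> 1 \<Longrightarrow> t \<ge> 0 \<Longrightarrow> params N (rN N t)"
  by (simp add: params_def rho_pos)

lemma chem_rN: "N \<ge> 1 \<Longrightarrow> t \<ge> 0 \<Longrightarrow> params.chem (rN N t) x = pot t (embed N x)"
  by (simp add: params.chem_def[OF params_rN] pot_def)

lemma pot_shift:
  assumes "N \<ge> 1" "t \<ge> 0"
  shows "pot t (embed N (shift N j k x)) = pot t (embed N x + (of_int k / real N) *\<^sub>R axis j 1)"
  unfolding pot_def by (simp add: embed_shift[OF assms(1) per[OF assms(2)]])

text \<open>By compactness of the slab all constants are uniform in \<open>N\<close>, in space and
  in time up to \<open>T\<close>. For the last claim the intermediate points lie within
  \<open>1 / N\<close> of the site; uniform continuity moves them to the site, where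
  \<open>pot_consistency\<close> applies.\<close>

theorem discretization:
  assumes T: "T \<ge> 0"
  obtains \<Lambda> where "\<Lambda> > 0"
    "\<And>N t x j k. N \<ge> 1 \<Longrightarrow> 0 \<le> t \<Longrightarrow> t \<le> T \<Longrightarrow> x \<in> sites N \<Longrightarrow> \<bar>k\<bar> \<le> int N \<Longrightarrow>
        \<bar>rN N t (shift N j k x) - rN N t x\<bar> \<le> \<Lambda> * \<bar>of_int k\<bar> / real N"
    "\<And>N t x j. N \<ge> 1 \<Longrightarrow> 0 \<le> t \<Longrightarrow> t \<le> T \<Longrightarrow> x \<in> sites N \<Longrightarrow>
        \<bar>params.chem (rN N t) (shift N j 1 x) - params.chem (rN N t) x\<bar> \<le> \<Lambda> / real N
        \<and> \<bar>params.lap N (rN N t) j x\<bar> \<le> \<Lambda> \<and> \<bar>params.grd N (rN N t) j x\<bar> \<le> \<Lambda>\<^sup>2"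
    "\<And>\<phi>. \<phi> > 0 \<Longrightarrow> \<exists>N0. \<forall>N\<ge>N0. \<forall>t\<in>{0..T}. \<forall>x\<in>sites N.
        \<bar>(\<Sum>j\<in>UNIV. params.lap N (rN N t) j x * (2 * rN N t x) + params.grd N (rN N t) j x / 2 * (8 * rN N t x - 12 * (rN N t x)\<^sup>2))
          - h t (embed N x) / (rN N t x * (1 - rN N t x))\<bar> \<le> \<phi>"
proof -
  obtain \<Lambda> where \<Lambda>: "\<Lambda> > 0"
    "\<And>t u j. 0 \<le> t \<Longrightarrow> t \<le> T \<Longrightarrow> u \<in> cbox (\<chi> i. -1) (\<chi> i. 2) \<Longrightarrow> \<bar>g t u $ j\<bar> \<le> \<Lambda> \<and> \<bar>pot1 j t u\<bar> \<le> \<Lambda> \<and> \<bar>pot2 j t u\<bar> \<le> \<Lambda>"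
    using derivative_bounds[of T] by blast
  have lapx: "\<exists>s. 0 < s \<and> s < 1 / real N \<and> params.lap N (rN N t) j x =
      (pot2 j t (embed N x + s *\<^sub>R axis j 1) + pot2 j t (embed N x + (- s) *\<^sub>R axis j 1)) / 2"
    if N: "N \<ge> 1" "0 \<le> t" for N t x j
  proof -
    have N0: "1 / real N > 0" using N by simp
    obtain s where s: "0 < s" "s < 1 / real N" "pot t (embed N x + (1 / real N) *\<^sub>R axis j 1) + pot t (embed N x + (- (1 / real N)) *\<^sub>R axis j 1) - 2 * pot t (embed N x)
      = (1 / real N)\<^sup>2 / 2 * (pot2 j t (embed N x + s *\<^sub>R axis j 1) + pot2 j t (embed N x + (- s) *\<^sub>R axis j 1))"
      using second_difference[OF N(2) N0] by blast
    have "params.lap N (rN N t) j x = (real N)\<^sup>2 * (pot t (embed N x + (1 / real N) *\<^sub>R axis j 1) + pot t (embed N x + (- (1 / real N)) *\<^sub>R axis j 1) - 2 * pot t (embed N x))"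
      unfolding params.lap_def[OF params_rN[OF N]] chem_rN[OF N] pot_shift[OF N] by simp
    also have "\<dots> = (pot2 j t (embed N x + s *\<^sub>R axis j 1) + pot2 j t (embed N x + (- s) *\<^sub>R axis j 1)) / 2"
      unfolding s(3) using N by (simp add: power2_eq_square)
    finally show ?thesis using s by blast
  qed
  have difx: "\<exists>s. 0 < s \<and> s < 1 / real N \<and> params.chem (rN N t) (shift N j 1 x) - params.chem (rN N t) x =
      pot1 j t (embed N x + s *\<^sub>R axis j 1) / real N"
    if N: "N \<ge> 1" "0 \<le> t" for N t x j
  proof -
    have N0: "1 / real N > 0" using N by simp
    obtain s where s: "0 < s" "s < 1 / real N" "pot t (embed N x + (1 / real N) *\<^sub>R axis j 1) - pot t (embed N x)
      = (1 / real N) * pot1 j t (embed N x + s *\<^sub>R axis j 1)"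
      using first_difference[OF N(2) N0] by blast
    then show ?thesis
      unfolding chem_rN[OF N] pot_shift[OF N] by (intro exI[of _ s]) simp
  qed
  have grdx: "params.grd N (rN N t) j x = (real N * (params.chem (rN N t) (shift N j 1 x) - params.chem (rN N t) x))\<^sup>2"
    if N: "N \<ge> 1" "0 \<le> t" for N t x j
    unfolding params.grd_def[OF params_rN[OF N]] by (simp add: power_mult_distrib)
  have le1: "1 / real N \<le> 1" if "N \<ge> 1" for N using that by simp
  have inb: "embed N x + s *\<^sub>R axis j 1 \<in> cbox (\<chi> i. -1) (\<chi> i. 2)"
    if "N \<ge> 1" "x \<in> sites N" "\<bar>s\<bar> \<le> 1 / real N" for N x s and j :: 'd
    by (rule line_in_box[OF embed_in_cube[OF that(1,2)] order_trans[OF that(3) le1[OF that(1)]]])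
  show thesis
  proof (rule that[OF \<Lambda>(1)])
    fix N :: nat and t :: real and x :: "int ^ 'd" and j :: 'd and k :: int
    assume N: "N \<ge> 1" and t: "0 \<le> t" "t \<le> T" and x: "x \<in> sites N" and k: "\<bar>k\<bar> \<le> int N"
    let ?u = "embed N x" and ?e = "of_int k / real N"
    have e: "\<bar>?e\<bar> \<le> 1"
    proof -
      have "\<bar>real_of_int k\<bar> \<le> real N" using k by linarith
      then show ?thesis using N by simp
    qed
    then have e': "-1 \<le> ?e" "?e \<le> 1" by linarith+
    have "\<bar>\<rho> t (?u + ?e *\<^sub>R axis j 1) - \<rho> t (?u + 0 *\<^sub>R axis j 1)\<bar> \<le> \<Lambda> * \<bar>?e - 0\<bar>"
      unfolding real_norm_def[symmetric]
    proof (rule field_differentiable_bound[of "{-1..1}" "\<lambda>s. \<rho> t (?u + s *\<^sub>R axis j 1)" "\<lambda>s. g t (?u + s *\<^sub>R axis j 1) $ j"])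
      fix s :: real assume s: "s \<in> {-1..1}"
      show "((\<lambda>s. \<rho> t (?u + s *\<^sub>R axis j 1)) has_real_derivative g t (?u + s *\<^sub>R axis j 1) $ j) (at s within {-1..1})"
        by (rule has_field_derivative_at_within[OF line1[OF t(1)]])
      show "norm (g t (?u + s *\<^sub>R axis j 1) $ j) \<le> \<Lambda>"
        using \<Lambda>(2)[OF t line_in_box[OF embed_in_cube[OF N x], of s j], of j] s by (simp add: abs_le_iff)
    qed (use e' in simp_all)
    then show "\<bar>rN N t (shift N j k x) - rN N t x\<bar> \<le> \<Lambda> * \<bar>of_int k\<bar> / real N"
      by (simp add: embed_shift[OF N per[OF t(1)]])
  next
    fix N :: nat and t :: real and x :: "int ^ 'd" and j :: 'd
    assume N: "N \<ge> 1" and t: "0 \<le> t" "t \<le> T" and x: "x \<in> sites N"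
    obtain s where s: "0 < s" "s < 1 / real N" "params.chem (rN N t) (shift N j 1 x) - params.chem (rN N t) x =
      pot1 j t (embed N x + s *\<^sub>R axis j 1) / real N" using difx[OF N t(1)] by blast
    obtain s' where s': "0 < s'" "s' < 1 / real N" "params.lap N (rN N t) j x =
      (pot2 j t (embed N x + s' *\<^sub>R axis j 1) + pot2 j t (embed N x + (- s') *\<^sub>R axis j 1)) / 2" using lapx[OF N t(1)] by blast
    have b: "\<bar>pot1 j t (embed N x + s *\<^sub>R axis j 1)\<bar> \<le> \<Lambda>"
      "\<bar>pot2 j t (embed N x + s' *\<^sub>R axis j 1)\<bar> \<le> \<Lambda>" "\<bar>pot2 j t (embed N x + (- s') *\<^sub>R axis j 1)\<bar> \<le> \<Lambda>"
      using \<Lambda>(2)[OF t inb[OF N x, of s j], of j] \<Lambda>(2)[OF t inb[OF N x, of s' j], of j] \<Lambda>(2)[OF t inb[OF N x, of "- s'" j], of j] s s'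
      by auto
    have "\<bar>params.chem (rN N t) (shift N j 1 x) - params.chem (rN N t) x\<bar> \<le> \<Lambda> / real N"
      unfolding s(3) using b(1) N by (simp add: divide_right_mono)
    moreover have "\<bar>params.lap N (rN N t) j x\<bar> \<le> \<Lambda>" unfolding s'(3) using b(2,3) by (auto simp: abs_le_iff)
    moreover have "\<bar>params.grd N (rN N t) j x\<bar> \<le> \<Lambda>\<^sup>2"
      unfolding grdx[OF N t(1)] s(3) using b(1) N \<Lambda>(1) abs_le_square_iff[of "pot1 j t (embed N x + s *\<^sub>R axis j 1)" \<Lambda>] by simp
    ultimately show "\<bar>params.chem (rN N t) (shift N j 1 x) - params.chem (rN N t) x\<bar> \<le> \<Lambda> / real N
        \<and> \<bar>params.lap N (rN N t) j x\<bar> \<le> \<Lambda> \<and> \<bar>params.grd N (rN N t) j x\<bar> \<le> \<Lambda>\<^sup>2" by blast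
  next
    fix \<phi> :: real assume \<phi>: "\<phi> > 0"
    \<comment> \<open>For each direction, the error of \<open>lap\<close> is multiplied by at most
      2, and the error of \<open>grd\<close>, at most \<open>2 * \<Lambda> * \<psi>\<close>, by at
      most 10.\<close>
    define c where "c = real CARD('d) * (2 + 20 * \<Lambda>)"
    have c: "c > 0" using \<Lambda>(1) by (simp add: c_def)
    define \<psi> where "\<psi> = \<phi> / c"
    have \<psi>: "\<psi> > 0" using \<phi> c by (simp add: \<psi>_def)
    obtain d where d: "d > 0"
      "\<And>t u v j. 0 \<le> t \<Longrightarrow> t \<le> T \<Longrightarrow> u \<in> cbox (\<chi> i. -1) (\<chi> i. 2) \<Longrightarrow> v \<in> cbox (\<chi> i. -1) (\<chi> i. 2) \<Longrightarrow> dist u v < d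
      \<Longrightarrow> \<bar>pot1 j t u - pot1 j t v\<bar> \<le> \<psi> \<and> \<bar>pot2 j t u - pot2 j t v\<bar> \<le> \<psi>"
      using derivative_modulus[OF \<psi>, of T] by blast
    obtain N1 where N1: "1 / real (Suc N1) < d" using d(1) by (meson nat_approx_posE)
    show "\<exists>N0. \<forall>N\<ge>N0. \<forall>t\<in>{0..T}. \<forall>x\<in>sites N.
        \<bar>(\<Sum>j\<in>UNIV. params.lap N (rN N t) j x * (2 * rN N t x) + params.grd N (rN N t) j x / 2 * (8 * rN N t x - 12 * (rN N t x)\<^sup>2))
          - h t (embed N x) / (rN N t x * (1 - rN N t x))\<bar> \<le> \<phi>"
    proof (intro exI[of _ "Suc N1"] allI impI ballI)
      fix N t and x :: "int ^ 'd" assume NN: "Suc N1 \<le> N" and tT: "t \<in> {0..T}" and x: "x \<in> sites N"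
      have N: "N \<ge> 1" and t: "0 \<le> t" "t \<le> T" using NN tT by auto
      have "1 / real N \<le> 1 / real (Suc N1)" using NN by (intro divide_left_mono) auto
      then have Nd: "1 / real N < d" using N1 by linarith
      let ?u = "embed N x" and ?r = "rN N t x"
      have r: "0 < ?r" "?r < 1" using rho_pos[OF t(1)] by auto
      have near: "dist (?u + s *\<^sub>R axis j 1) ?u < d" if "\<bar>s\<bar> < 1 / real N" for s and j :: 'd
        using that Nd by (simp add: dist_norm)
      have u0: "?u \<in> cbox (\<chi> i. -1) (\<chi> i. 2)" using inb[OF N x, of 0] by simp
      have pj: "\<bar>(params.lap N (rN N t) j x * (2 * ?r) + params.grd N (rN N t) j x / 2 * (8 * ?r - 12 * ?r\<^sup>2))
         - (pot2 j t ?u * (2 * ?r) + (pot1 j t ?u)\<^sup>2 / 2 * (8 * ?r - 12 * ?r\<^sup>2))\<bar> \<le> (2 + 20 * \<Lambda>) * \<psi>" for j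
      proof -
        obtain s where s: "0 < s" "s < 1 / real N" "params.chem (rN N t) (shift N j 1 x) - params.chem (rN N t) x =
          pot1 j t (?u + s *\<^sub>R axis j 1) / real N" using difx[OF N t(1)] by blast
        obtain s' where s': "0 < s'" "s' < 1 / real N" "params.lap N (rN N t) j x =
          (pot2 j t (?u + s' *\<^sub>R axis j 1) + pot2 j t (?u + (- s') *\<^sub>R axis j 1)) / 2" using lapx[OF N t(1)] by blast
        let ?p = "pot1 j t (?u + s *\<^sub>R axis j 1)"
        have gp: "params.grd N (rN N t) j x = ?p\<^sup>2" unfolding grdx[OF N t(1)] s(3) using N by simp
        have "\<bar>pot2 j t (?u + s' *\<^sub>R axis j 1) - pot2 j t ?u\<bar> \<le> \<psi>" "\<bar>pot2 j t (?u + (- s') *\<^sub>R axis j 1) - pot2 j t ?u\<bar> \<le> \<psi>"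
          using d(2)[OF t inb[OF N x] u0 near, of s' j j] d(2)[OF t inb[OF N x] u0 near, of "- s'" j j] s' by auto
        then have 1: "\<bar>params.lap N (rN N t) j x - pot2 j t ?u\<bar> \<le> \<psi>" unfolding s'(3) by (auto simp: abs_le_iff field_simps)
        have "\<bar>?p - pot1 j t ?u\<bar> \<le> \<psi>"
          using d(2)[OF t inb[OF N x] u0 near, of s j j] s by auto
        moreover have "\<bar>?p\<bar> \<le> \<Lambda>" "\<bar>pot1 j t ?u\<bar> \<le> \<Lambda>"
          using \<Lambda>(2)[OF t inb[OF N x, of s j], of j] \<Lambda>(2)[OF t u0, of j] s by auto
        then have "\<bar>?p + pot1 j t ?u\<bar> \<le> 2 * \<Lambda>" by linarith
        ultimately have "\<bar>?p - pot1 j t ?u\<bar> * \<bar>?p + pot1 j t ?u\<bar> \<le> \<psi> * (2 * \<Lambda>)"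
          by (intro mult_mono) (use \<psi> in auto)
        then have 2: "\<bar>?p\<^sup>2 - (pot1 j t ?u)\<^sup>2\<bar> \<le> \<psi> * (2 * \<Lambda>)"
          by (simp add: power2_eq_square square_diff_square_factored abs_mult mult.commute)
        have rr: "\<bar>(8 * ?r - 12 * ?r\<^sup>2) / 2\<bar> \<le> 10"
        proof -
          have "0 \<le> ?r\<^sup>2" "?r\<^sup>2 \<le> 1" using r by (auto simp: power_le_one)
          then have "8 * ?r - 12 * ?r\<^sup>2 \<le> 20" "- (8 * ?r - 12 * ?r\<^sup>2) \<le> 20" using r by linarith+
          then show ?thesis by (simp add: abs_le_iff)
        qed
        have "\<bar>(params.lap N (rN N t) j x - pot2 j t ?u) * (2 * ?r)\<bar> \<le> \<psi> * 2"
          unfolding abs_mult using 1 r by (intro mult_mono) auto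
        moreover have "\<bar>(?p\<^sup>2 - (pot1 j t ?u)\<^sup>2) * ((8 * ?r - 12 * ?r\<^sup>2) / 2)\<bar> \<le> \<psi> * (2 * \<Lambda>) * 10"
          unfolding abs_mult[of "?p\<^sup>2 - (pot1 j t ?u)\<^sup>2"] using 2 rr \<psi> \<Lambda>(1) by (intro mult_mono) auto
        ultimately have 3: "\<bar>(params.lap N (rN N t) j x - pot2 j t ?u) * (2 * ?r) + (?p\<^sup>2 - (pot1 j t ?u)\<^sup>2) * ((8 * ?r - 12 * ?r\<^sup>2) / 2)\<bar>
            \<le> \<psi> * 2 + \<psi> * (2 * \<Lambda>) * 10"
          by (rule order_trans[OF abs_triangle_ineq add_mono])
        have 4: "(params.lap N (rN N t) j x * (2 * ?r) + params.grd N (rN N t) j x / 2 * (8 * ?r - 12 * ?r\<^sup>2))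
         - (pot2 j t ?u * (2 * ?r) + (pot1 j t ?u)\<^sup>2 / 2 * (8 * ?r - 12 * ?r\<^sup>2))
         = (params.lap N (rN N t) j x - pot2 j t ?u) * (2 * ?r) + (?p\<^sup>2 - (pot1 j t ?u)\<^sup>2) * ((8 * ?r - 12 * ?r\<^sup>2) / 2)"
          unfolding gp by (simp add: left_diff_distrib)
        have 5: "\<psi> * 2 + \<psi> * (2 * \<Lambda>) * 10 = (2 + 20 * \<Lambda>) * \<psi>" by (simp add: algebra_simps)
        show ?thesis unfolding 4 by (rule 3[unfolded 5])
      qed
      have "\<bar>(\<Sum>j\<in>UNIV. params.lap N (rN N t) j x * (2 * ?r) + params.grd N (rN N t) j x / 2 * (8 * ?r - 12 * ?r\<^sup>2))
          - h t ?u / (?r * (1 - ?r))\<bar> \<le> (\<Sum>j\<in>(UNIV :: 'd set). (2 + 20 * \<Lambda>) * \<psi>)"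
        unfolding pot_consistency[OF t(1), symmetric] sum_subtractf[symmetric]
        by (intro order_trans[OF sum_abs] sum_mono pj)
      also have "\<dots> = c * \<psi>" by (simp add: c_def)
      also have "\<dots> = \<phi>" using c by (simp add: \<psi>_def)
      finally show "\<bar>(\<Sum>j\<in>UNIV. params.lap N (rN N t) j x * (2 * ?r) + params.grd N (rN N t) j x / 2 * (8 * ?r - 12 * ?r\<^sup>2))
          - h t ?u / (?r * (1 - ?r))\<bar> \<le> \<phi>" .
    qed
  qed
qed

end

section \<open>The law of the process\<close>

text \<open>There are \<open>CARD('d) * N ^ CARD('d)\<close> bonds, each with rate at most 2 and a
  difference of at most twice the bound of the function. This operator norm makes the exponential
  series converge.\<close>

lemma generator_pow_bound:
  fixes f :: "'d::finite config \<Rightarrow> real"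
  assumes N: "N \<ge> 3" and f: "\<And>\<eta>. \<eta> \<in> configs N \<Longrightarrow> \<bar>f \<eta>\<bar> \<le> F" and \<eta>: "\<eta> \<in> configs N"
  shows "\<bar>(generator N ^^ n) f \<eta>\<bar> \<le> (4 * real CARD('d) * real (N ^ CARD('d))) ^ n * F"
  using \<eta>
proof (induction n arbitrary: \<eta>)
  case (Suc n \<eta>)
  let ?g = "(generator N ^^ n) f" and ?B = "(4 * real CARD('d) * real (N ^ CARD('d))) ^ n * F"
  have "\<bar>generator N ?g \<eta>\<bar> \<le> (\<Sum>x\<in>(sites N :: (int ^ 'd) set). \<Sum>j\<in>(UNIV :: 'd set). 2 * (?B + ?B))"
    unfolding generator_bonds[OF N, of ?g \<eta>]
  proof (rule order_trans[OF sum_abs], rule sum_mono, rule order_trans[OF sum_abs], rule sum_mono)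
    fix x :: "int ^ 'd" and j :: 'd assume x: "x \<in> sites N"
    have "\<bar>?g (bond_swap N x j \<eta>)\<bar> \<le> ?B" "\<bar>?g \<eta>\<bar> \<le> ?B"
      using Suc.IH Suc.prems x N by auto
    then have "\<bar>?g (bond_swap N x j \<eta>) - ?g \<eta>\<bar> \<le> ?B + ?B" by linarith
    then show "\<bar>bond_rate N x j \<eta> * (?g (bond_swap N x j \<eta>) - ?g \<eta>)\<bar> \<le> 2 * (?B + ?B)"
      unfolding abs_mult using bond_rate_bounds[of N x j \<eta>] by (intro mult_mono) auto
  qed
  then show ?case by (simp add: card_sites mult_ac)
qed (use f in simp)

text \<open>At a fixed configuration the semigroup is an everywhere convergent power series in
  \<open>t\<close>; differentiating it term by term shifts the powers of the generator by
  one.\<close>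

lemma semigroup_deriv:
  fixes f :: "'d::finite config \<Rightarrow> real"
  assumes N: "N \<ge> 3" and \<eta>: "\<eta> \<in> configs N"
  shows "((\<lambda>t. semigroup_of (generator N) t f \<eta>) has_real_derivative semigroup_of (generator N) t (generator N f) \<eta>) (at t)"
proof -
  define c where "c n = (generator N ^^ n) f \<eta> / fact n" for n
  define F where "F = Max ((\<lambda>\<eta>. \<bar>f \<eta>\<bar>) ` configs N)"
  define C where "C = 4 * real CARD('d) * real (N ^ CARD('d))"
  have F: "\<bar>f \<zeta>\<bar> \<le> F" if "\<zeta> \<in> configs N" for \<zeta>
    unfolding F_def using that by (intro Max_ge) auto
  have summ: "summable (\<lambda>n. c n * y ^ n)" for y
  proof (rule summable_comparison_test'[where N = 0])
    have "summable (\<lambda>n. (C * \<bar>y\<bar>) ^ n /\<^sub>R fact n * F)" by (intro summable_mult2 summable_exp_generic)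
    then show "summable (\<lambda>n. F * ((C * \<bar>y\<bar>) ^ n / fact n))" by (simp add: field_simps)
    fix n
    have "\<bar>(generator N ^^ n) f \<eta>\<bar> \<le> C ^ n * F" unfolding C_def by (rule generator_pow_bound[OF N F \<eta>])
    then have "\<bar>(generator N ^^ n) f \<eta>\<bar> * \<bar>y\<bar> ^ n / fact n \<le> C ^ n * F * \<bar>y\<bar> ^ n / fact n"
      by (intro divide_right_mono mult_right_mono) auto
    then show "norm (c n * y ^ n) \<le> F * ((C * \<bar>y\<bar>) ^ n / fact n)"
      by (simp add: c_def abs_mult power_abs power_mult_distrib mult_ac)
  qed
  have "((\<lambda>t. \<Sum>n. c n * t ^ n) has_real_derivative (\<Sum>n. diffs c n * t ^ n)) (at t)"
    by (rule termdiffs_strong_converges_everywhere[OF summ])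
  moreover have "(\<lambda>t. \<Sum>n. c n * t ^ n) = (\<lambda>t. semigroup_of (generator N) t f \<eta>)"
    by (simp add: semigroup_of_def c_def mult.commute)
  moreover have "diffs c n * t ^ n = t ^ n / fact n * (generator N ^^ n) (generator N f) \<eta>" for n
  proof -
    have "(generator N ^^ Suc n) f \<eta> = (generator N ^^ n) (generator N f) \<eta>"
      by (simp add: funpow_swap1)
    moreover have "fact (Suc n) = real (Suc n) * (fact n :: real)" by (simp add: algebra_simps)
    ultimately have "diffs c n = (generator N ^^ n) (generator N f) \<eta> / fact n"
      unfolding diffs_def c_def by (simp del: fact_Suc funpow.simps of_nat_Suc)
    then show ?thesis by simp
  qed
  then have "(\<Sum>n. diffs c n * t ^ n) = semigroup_of (generator N) t (generator N f) \<eta>"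
    by (simp add: semigroup_of_def)
  ultimately show ?thesis by simp
qed

lemma integral_finite_valued:
  fixes f :: "'s \<Rightarrow> real"
  assumes M: "prob_space M" and X: "X \<in> measurable M (count_space S)" and S: "finite S"
  shows "integrable M (\<lambda>\<omega>. f (X \<omega>))"
    and "(\<integral>\<omega>. f (X \<omega>) \<partial>M) = (\<Sum>s\<in>S. measure M {\<omega> \<in> space M. X \<omega> = s} * f s)"
proof -
  interpret prob_space M by (rule M)
  have ev: "{\<omega> \<in> space M. X \<omega> = s} \<in> sets M" for s
  proof (cases "s \<in> S")
    case True
    have "X -` {s} \<inter> space M \<in> sets M" using X by (rule measurable_sets) (use True in auto)
    moreover have "X -` {s} \<inter> space M = {\<omega> \<in> space M. X \<omega> = s}" by auto
    ultimately show ?thesis by simp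
  next
    case False
    then have "{\<omega> \<in> space M. X \<omega> = s} = {}" using measurable_space[OF X] by auto
    then show ?thesis by (metis sets.empty_sets)
  qed
  have eq: "f (X \<omega>) = (\<Sum>s\<in>S. f s * indicator {\<omega> \<in> space M. X \<omega> = s} \<omega>)" if "\<omega> \<in> space M" for \<omega>
  proof -
    have "X \<omega> \<in> S" using measurable_space[OF X that] by simp
    then show ?thesis using that S by (simp add: indicator_def if_distrib sum.delta' cong: if_cong)
  qed
  have int: "integrable M (\<lambda>\<omega>. \<Sum>s\<in>S. f s * indicator {\<omega> \<in> space M. X \<omega> = s} \<omega>)"
    using ev by (intro Bochner_Integration.integrable_sum integrable_mult_right integrable_real_indicator) (auto simp: emeasure_eq_measure)
  show "integrable M (\<lambda>\<omega>. f (X \<omega>))"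
    using int by (rule Bochner_Integration.integrable_cong[THEN iffD2, rotated 2]) (auto simp: eq)
  have "(\<integral>\<omega>. f (X \<omega>) \<partial>M) = (\<integral>\<omega>. (\<Sum>s\<in>S. f s * indicator {\<omega> \<in> space M. X \<omega> = s} \<omega>) \<partial>M)"
    by (rule Bochner_Integration.integral_cong) (auto simp: eq)
  also have "\<dots> = (\<Sum>s\<in>S. f s * measure M {\<omega> \<in> space M. X \<omega> = s})"
    using ev by (subst Bochner_Integration.integral_sum)
      (auto simp: emeasure_eq_measure Int_absorb1 Collect_conj_eq intro!: integrable_mult_right integrable_real_indicator sum.cong)
  finally show "(\<integral>\<omega>. f (X \<omega>) \<partial>M) = (\<Sum>s\<in>S. measure M {\<omega> \<in> space M. X \<omega> = s} * f s)"
    by (simp add: mult.commute)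
qed

lemma prob_finite_valued:
  assumes M: "prob_space M" and X: "X \<in> measurable M (count_space S)" and S: "finite S"
  shows "(\<Sum>s\<in>S. measure M {\<omega> \<in> space M. X \<omega> = s}) = 1"
  using integral_finite_valued(2)[OF M X S, of "\<lambda>_. 1"] prob_space.prob_space[OF M] by simp

definition law :: "'w measure \<Rightarrow> (real \<Rightarrow> 'w \<Rightarrow> 's) \<Rightarrow> real \<Rightarrow> 's \<Rightarrow> real" where
  "law M X t s = measure M {\<omega> \<in> space M. X t \<omega> = s}"

text \<open>The Markov property at time 0, integrated: a conditional expectation has the same mean
  as the variable itself.\<close>

lemma markov_expectation:
  fixes f :: "'s \<Rightarrow> real"
  assumes mp: "markov_process S L \<mu> M X" and S: "finite S" and t: "t \<ge> 0"
  shows "(\<Sum>s\<in>S. law M X t s * f s) = (\<Sum>s\<in>S. law M X 0 s * semigroup_of L t f s)"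
proof -
  have M: "prob_space M" and X: "\<And>t. t \<ge> 0 \<Longrightarrow> X t \<in> measurable M (count_space S)"
    and all: "\<forall>s\<ge>0. \<forall>t\<ge>0. \<forall>f :: 's \<Rightarrow> real. AE \<omega> in M.
        real_cond_exp M (past M X s) (\<lambda>\<omega>. f (X (s + t) \<omega>)) \<omega> = semigroup_of L t f (X s \<omega>)"
    using mp unfolding markov_process_def by blast+
  have ce: "AE \<omega> in M. real_cond_exp M (past M X 0) (\<lambda>\<omega>. f (X t \<omega>)) \<omega> = semigroup_of L t f (X 0 \<omega>)"
    using all[rule_format, of 0 t f] t by simp
  interpret prob_space M by (rule M)
  have sub: "subalgebra M (past M X 0)"
  proof -
    have "X r -` A \<inter> space M \<in> sets M" if "0 \<le> r" "r \<le> 0" for r A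
    proof -
      \<comment> \<open>The sets \<open>A\<close> in the definition of the past range over all sets
        of states, whereas measurability concerns subsets of \<open>S\<close>; the values of
        \<open>X r\<close> lie in \<open>S\<close>.\<close>
      have "X r -` A \<inter> space M = X r -` (A \<inter> S) \<inter> space M"
        using measurable_space[OF X[OF that(1)]] by auto
      also have "\<dots> \<in> sets M" by (rule measurable_sets[OF X[OF that(1)]]) auto
      finally show ?thesis .
    qed
    then have "sigma_sets (space M) {X r -` A \<inter> space M | r A. 0 \<le> r \<and> r \<le> 0} \<subseteq> sets M"
      by (intro sets.sigma_sets_subset) auto
    moreover have "sets (past M X 0) = sigma_sets (space M) {X r -` A \<inter> space M | r A. 0 \<le> r \<and> r \<le> 0}"
      unfolding past_def by (rule sets_measure_of) auto
    ultimately show ?thesis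
      by (simp add: subalgebra_def) (simp add: past_def space_measure_of_conv)
  qed
  interpret sigma_finite_subalgebra M "past M X 0"
    by (rule finite_measure_subalgebra_is_sigma_finite) (simp add: finite_measure_subalgebra_def finite_measure_axioms finite_measure_subalgebra_axioms_def sub)
  have "(\<Sum>s\<in>S. law M X t s * f s) = (\<integral>\<omega>. f (X t \<omega>) \<partial>M)"
    unfolding law_def by (rule integral_finite_valued(2)[OF M X[OF t] S, symmetric])
  also have "\<dots> = (\<integral>\<omega>. real_cond_exp M (past M X 0) (\<lambda>\<omega>. f (X t \<omega>)) \<omega> \<partial>M)"
    by (rule real_cond_exp_int(2)[OF integral_finite_valued(1)[OF M X[OF t] S], symmetric])
  also have "\<dots> = (\<integral>\<omega>. semigroup_of L t f (X 0 \<omega>) \<partial>M)"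
    by (rule integral_cong_AE) (use ce integral_finite_valued(1)[OF M X[of 0] S] in \<open>auto intro: borel_measurable_integrable\<close>)
  also have "\<dots> = (\<Sum>s\<in>S. law M X 0 s * semigroup_of L t f s)"
    unfolding law_def by (rule integral_finite_valued(2)[OF M X S]) simp
  finally show ?thesis .
qed

lemma markov_law:
  assumes mp: "markov_process S L \<mu> M X" and S: "finite S"
  shows "t \<ge> 0 \<Longrightarrow> law M X t s \<ge> 0" "t \<ge> 0 \<Longrightarrow> (\<Sum>s\<in>S. law M X t s) = 1"
    "s \<in> S \<Longrightarrow> law M X 0 s = measure \<mu> {s}"
proof -
  have M: "prob_space M" and X: "\<And>t. t \<ge> 0 \<Longrightarrow> X t \<in> measurable M (count_space S)"
    and d: "distr M (count_space S) (X 0) = \<mu>"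
    using mp unfolding markov_process_def by auto
  show "law M X t s \<ge> 0" by (simp add: law_def)
  show "t \<ge> 0 \<Longrightarrow> (\<Sum>s\<in>S. law M X t s) = 1"
    unfolding law_def by (rule prob_finite_valued[OF M X S])
  assume s: "s \<in> S"
  have "measure \<mu> {s} = measure M (X 0 -` {s} \<inter> space M)"
    unfolding d[symmetric] using s X[of 0] by (intro measure_distr) auto
  also have "X 0 -` {s} \<inter> space M = {\<omega> \<in> space M. X 0 \<omega> = s}" by auto
  finally show "law M X 0 s = measure \<mu> {s}" by (simp add: law_def)
qed

text \<open>Tested with the indicator of \<open>\<eta>\<close>, the expectation formula gives the
  law at \<open>\<eta>\<close>. Its derivative pairs the law with the generator of the indicator,
  and symmetry puts the generator on the law.\<close>

theorem master_equation:
  fixes M :: "'w measure" and X :: "real \<Rightarrow> 'w \<Rightarrow> 'd::finite config"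
  assumes mp: "markov_process (configs N) (generator N) \<mu> M X" and N: "N \<ge> 3"
    and \<eta>: "\<eta> \<in> configs N" and t: "t \<ge> 0"
  shows "((\<lambda>t. law M X t \<eta>) has_real_derivative generator N (law M X t) \<eta>) (at t within {0..})"
proof -
  let ?e = "\<lambda>\<zeta>. of_bool (\<zeta> = \<eta>) :: real"
  define Q where "Q f t = (\<Sum>\<xi>\<in>configs N. law M X 0 \<xi> * semigroup_of (generator N) t f \<xi>)" for f t
  have QP: "Q f t = (\<Sum>\<zeta>\<in>configs N. law M X t \<zeta> * f \<zeta>)" if "t \<ge> 0" for f t
    unfolding Q_def by (rule markov_expectation[OF mp finite_configs that, symmetric])
  have pick: "(\<Sum>\<zeta>\<in>configs N. g \<zeta> * ?e \<zeta>) = g \<eta>" for g :: "'d config \<Rightarrow> real"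
    using \<eta> by (simp add: of_bool_def if_distrib sum.delta cong: if_cong)
  have "(Q ?e has_real_derivative Q (generator N ?e) t) (at t within {0..})"
    unfolding Q_def by (intro DERIV_sum DERIV_cmult has_field_derivative_at_within[OF semigroup_deriv[OF N]])
  also have "Q (generator N ?e) t = (\<Sum>\<zeta>\<in>configs N. generator N (law M X t) \<zeta> * ?e \<zeta>)"
    unfolding QP[OF t] by (rule generator_symmetric[OF N])
  also have "\<dots> = generator N (law M X t) \<eta>" by (rule pick)
  finally show ?thesis
    by (rule has_field_derivative_transform_within[where d = 1]) (use t QP pick in auto)
qed

section \<open>The product measure as a point weight\<close>

lemma product_bernoulli_singleton:
  fixes \<rho>\<^sub>0 :: "real ^ 'd::finite \<Rightarrow> real"
  assumes r: "\<And>u. 0 \<le> \<rho>\<^sub>0 u \<and> \<rho>\<^sub>0 u \<le> 1" and \<eta>: "\<eta> \<in> configs N"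
  shows "{\<eta>} \<in> sets (product_bernoulli N \<rho>\<^sub>0)"
    and "measure (product_bernoulli N \<rho>\<^sub>0) {\<eta>} = nu N (\<lambda>x. \<rho>\<^sub>0 (embed N x)) \<eta>"
proof -
  let ?B = "\<lambda>x. measure_pmf (bernoulli_pmf (\<rho>\<^sub>0 (embed N x)))"
  interpret finite_product_prob_space ?B "sites N :: (int ^ 'd) set"
    by (rule finite_product_prob_space.intro)
       (auto simp: product_prob_space_def product_prob_space_axioms_def product_sigma_finite_def
         finite_product_sigma_finite_def finite_product_sigma_finite_axioms_def
         prob_space_measure_pmf prob_space_imp_sigma_finite)
  have e: "{\<eta>} = (\<Pi>\<^sub>E x\<in>sites N. {\<eta> x})"
  proof -
    have "\<eta> \<in> extensional (sites N)" using \<eta> by (simp add: configs_def PiE_def)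
    then show ?thesis by (rule PiE_singleton[symmetric])
  qed
  show "{\<eta>} \<in> sets (product_bernoulli N \<rho>\<^sub>0)"
    unfolding product_bernoulli_def e by (rule sets_PiM_I_finite) auto
  have "measure (product_bernoulli N \<rho>\<^sub>0) {\<eta>} = (\<Prod>x\<in>sites N. measure (?B x) {\<eta> x})"
    unfolding product_bernoulli_def e by (rule finite_measure_PiM_emb) auto
  also have "\<dots> = nu N (\<lambda>x. \<rho>\<^sub>0 (embed N x)) \<eta>"
    unfolding nu_def using r by (intro prod.cong) (auto simp: measure_pmf_single)
  finally show "measure (product_bernoulli N \<rho>\<^sub>0) {\<eta>} = nu N (\<lambda>x. \<rho>\<^sub>0 (embed N x)) \<eta>" .
qed

lemma product_bernoulli_integral:
  fixes \<rho>\<^sub>0 :: "real ^ 'd::finite \<Rightarrow> real" and f :: "'d config \<Rightarrow> real"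
  assumes r: "\<And>u. 0 \<le> \<rho>\<^sub>0 u \<and> \<rho>\<^sub>0 u \<le> 1"
  shows "(\<integral>\<eta>. f \<eta> \<partial>product_bernoulli N \<rho>\<^sub>0) = expect N (\<lambda>x. \<rho>\<^sub>0 (embed N x)) f"
proof -
  let ?M = "product_bernoulli N \<rho>\<^sub>0"
  have sp: "space ?M = configs N"
    by (simp add: product_bernoulli_def space_PiM configs_def)
  have sets: "A \<in> sets ?M" if "A \<subseteq> configs N" for A
  proof -
    have "finite A" using that finite_configs finite_subset by blast
    then have "(\<Union>\<eta>\<in>A. {\<eta>}) \<in> sets ?M"
      by (rule sets.finite_UN) (use that in \<open>auto intro: product_bernoulli_singleton(1)[OF r]\<close>)
    then show ?thesis by simp
  qed
  have idm: "id \<in> measurable ?M (count_space (configs N))"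
    by (rule measurableI) (auto simp: sp intro!: sets)
  have ps: "prob_space ?M"
    unfolding product_bernoulli_def by (intro prob_space_PiM prob_space_measure_pmf)
  have "(\<integral>\<eta>. f (id \<eta>) \<partial>?M) = (\<Sum>s\<in>configs N. measure ?M {\<omega> \<in> space ?M. id \<omega> = s} * f s)"
    by (rule integral_finite_valued(2)[OF ps idm finite_configs])
  also have "\<dots> = (\<Sum>s\<in>configs N. nu N (\<lambda>x. \<rho>\<^sub>0 (embed N x)) s * f s)"
  proof (rule sum.cong[OF refl])
    fix s assume s: "s \<in> (configs N :: 'd config set)"
    then have "{\<omega> \<in> space ?M. id \<omega> = s} = {s}" by (auto simp: sp)
    then show "measure ?M {\<omega> \<in> space ?M. id \<omega> = s} * f s = nu N (\<lambda>x. \<rho>\<^sub>0 (embed N x)) s * f s"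
      by (simp add: product_bernoulli_singleton(2)[OF r s])
  qed
  finally show ?thesis by (simp add: expect_def)
qed

section \<open>Growth of the entropy\<close>

text \<open>\<open>exp (- A * t) * (f t + B / A)\<close> does not increase. The mean value theorem
  evaluates its derivative at an interior time, where the differential inequality is
  assumed.\<close>

lemma gronwall:
  fixes f f' :: "real \<Rightarrow> real"
  assumes d: "\<And>t. t \<ge> 0 \<Longrightarrow> (f has_real_derivative f' t) (at t within {0..})"
    and le: "\<And>t. 0 < t \<Longrightarrow> t \<le> T \<Longrightarrow> f' t \<le> A * f t + B" and T: "T \<ge> 0" and A: "A > 0"
  shows "f T \<le> exp (A * T) * (f 0 + B / A) - B / A"
proof -
  define g where "g t = exp (- A * t) * (f t + B / A)" for t
  define g' where "g' t = exp (- A * t) * (f' t - A * f t - B)" for t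
  have gd: "(g has_real_derivative g' t) (at t within {0..})" if "t \<ge> 0" for t
    unfolding g_def g'_def using A
    by (auto intro!: derivative_eq_intros d[OF that] simp: algebra_simps)
  have "g T \<le> g 0"
  proof (cases "T = 0")
    case False
    then have T0: "0 < T" using T by simp
    have c: "continuous_on {0..T} g"
      unfolding continuous_on_eq_continuous_within
    proof
      fix t assume t: "t \<in> {0..T}"
      have "(g has_real_derivative g' t) (at t within {0..T})"
        by (rule DERIV_subset[OF gd]) (use t in auto)
      then show "continuous (at t within {0..T}) g" by (rule DERIV_continuous)
    qed
    have "(g has_derivative (\<lambda>x. x * g' t)) (at t)" if "0 < t" "t < T" for t
    proof -
      have "at t within {0..} = at t" using that by (intro at_within_interior) simp
      then show ?thesis using gd[of t] that by (simp add: has_field_derivative_def mult_commute_abs)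
    qed
    from mvt[OF T0 c this] obtain x where x: "0 < x" "x < T" "g T - g 0 = (T - 0) * g' x" by blast
    have "g' x \<le> 0" using le[of x] x unfolding g'_def by (intro mult_nonneg_nonpos) auto
    then have "(T - 0) * g' x \<le> 0" using T0 by (intro mult_nonneg_nonpos) auto
    then show ?thesis using x(3) by simp
  qed simp
  then have "exp (A * T) * g T \<le> exp (A * T) * g 0" by (intro mult_left_mono) auto
  moreover have "exp (A * T) * g T = f T + B / A"
    by (simp add: g_def mult.assoc[symmetric] flip: exp_add)
  moreover have "g 0 = f 0 + B / A" by (simp add: g_def)
  ultimately show ?thesis by simp
qed

section \<open>Time derivative of the relative entropy\<close>

context pme_solution
begin

text \<open>The time derivative of the chemical potential at \<open>x\<close>. Weighted with the
  centred occupation variables and summed, it is the time derivative of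
  \<open>ln nu\<close>.\<close>

definition source :: "nat \<Rightarrow> real \<Rightarrow> int ^ 'd \<Rightarrow> real" where
  "source N t x = h t (embed N x) / (rN N t x * (1 - rN N t x))"

text \<open>Differentiating the logarithm of \<open>R\<close> produces the sum of \<open>R'\<close>,
  which vanishes by \<open>mass\<close>; there remain \<open>R'\<close> against the logarithm and
  the motion of the reference weight.\<close>

lemma entropy_deriv:
  fixes R R' :: "real \<Rightarrow> 'd config \<Rightarrow> real"
  assumes N: "N \<ge> 1" and t: "t \<ge> 0"
    and pos: "\<And>t \<eta>. t \<ge> 0 \<Longrightarrow> \<eta> \<in> configs N \<Longrightarrow> R t \<eta> > 0"
    and d: "\<And>\<eta>. \<eta> \<in> configs N \<Longrightarrow> ((\<lambda>t. R t \<eta>) has_real_derivative R' t \<eta>) (at t within {0..})"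
    and mass: "(\<Sum>\<eta>\<in>configs N. R' t \<eta>) = 0"
  shows "((\<lambda>t. params.entropy N (rN N t) (R t)) has_real_derivative
     (\<Sum>\<eta>\<in>configs N. R' t \<eta> * ln (R t \<eta> / nu N (rN N t) \<eta>))
     - params.avg N (R t) (\<lambda>\<eta>. \<Sum>x\<in>sites N. source N t x * (of_bool (\<eta> x) - rN N t x))) (at t within {0..})"
proof -
  let ?S = "\<lambda>\<eta>. \<Sum>x\<in>sites N. source N t x * (of_bool (\<eta> x) - rN N t x)"
  let ?ln = "\<lambda>t \<eta>. \<Sum>x\<in>sites N. ln (if \<eta> x then rN N t x else 1 - rN N t x)"
  have lnnu: "ln (nu N (rN N t) \<eta>) = ?ln t \<eta>" if "t \<ge> 0" for t and \<eta> :: "'d config"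
    unfolding nu_def using rho_pos[OF that] by (intro ln_prod) (auto simp: less_imp_neq[symmetric])
  have nupos: "nu N (rN N t) \<eta> > 0" if "t \<ge> 0" for t and \<eta> :: "'d config"
    by (rule params.nu_pos[OF params_rN[OF N that]])
  have dln: "((\<lambda>t. ?ln t \<eta>) has_real_derivative ?S \<eta>) (at t within {0..})" for \<eta>
  proof (rule DERIV_sum)
    fix x :: "int ^ 'd" assume "x \<in> sites N"
    have r: "0 < rN N t x" "rN N t x < 1" using rho_pos[OF t] by auto
    show "((\<lambda>t. ln (if \<eta> x then rN N t x else 1 - rN N t x)) has_real_derivative
        source N t x * (of_bool (\<eta> x) - rN N t x)) (at t within {0..})"
    proof (cases "\<eta> x")
      case True
      have "((\<lambda>t. ln (rN N t x)) has_real_derivative h t (embed N x) / rN N t x) (at t within {0..})"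
        using r by (auto intro!: derivative_eq_intros time[OF t] simp: divide_inverse)
      also have "h t (embed N x) / rN N t x = source N t x * (1 - rN N t x)" using r by (simp add: source_def)
      finally show ?thesis using True by simp
    next
      case False
      have "((\<lambda>t. ln (1 - rN N t x)) has_real_derivative - h t (embed N x) / (1 - rN N t x)) (at t within {0..})"
        using r by (auto intro!: derivative_eq_intros time[OF t] simp: divide_inverse)
      also have "- h t (embed N x) / (1 - rN N t x) = source N t x * (0 - rN N t x)" using r by (simp add: source_def)
      finally show ?thesis using False by simp
    qed
  qed
  have "((\<lambda>t. \<Sum>\<eta>\<in>configs N. R t \<eta> * (ln (R t \<eta>) - ?ln t \<eta>)) has_real_derivative
     (\<Sum>\<eta>\<in>configs N. R' t \<eta> * ln (R t \<eta> / nu N (rN N t) \<eta>) + (R' t \<eta> - R t \<eta> * ?S \<eta>))) (at t within {0..})"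
  proof (rule DERIV_sum)
    fix \<eta> :: "'d config" assume \<eta>: "\<eta> \<in> configs N"
    have p: "R t \<eta> > 0" by (rule pos[OF t \<eta>])
    have "((\<lambda>t. R t \<eta> * (ln (R t \<eta>) - ?ln t \<eta>)) has_real_derivative
       R' t \<eta> * (ln (R t \<eta>) - ?ln t \<eta>) + (R' t \<eta> / R t \<eta> - ?S \<eta>) * R t \<eta>) (at t within {0..})"
    proof (rule DERIV_mult'[THEN DERIV_cong])
      show "((\<lambda>t. ln (R t \<eta>) - ?ln t \<eta>) has_real_derivative R' t \<eta> / R t \<eta> - ?S \<eta>) (at t within {0..})"
        by (rule DERIV_diff[OF _ dln]) (use p in \<open>auto intro!: derivative_eq_intros d[OF \<eta>] simp: divide_inverse\<close>)
    qed (rule d[OF \<eta>], simp)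
    also have "R' t \<eta> * (ln (R t \<eta>) - ?ln t \<eta>) + (R' t \<eta> / R t \<eta> - ?S \<eta>) * R t \<eta>
       = R' t \<eta> * ln (R t \<eta> / nu N (rN N t) \<eta>) + (R' t \<eta> - R t \<eta> * ?S \<eta>)"
      using p nupos[OF t, of \<eta>] lnnu[OF t, of \<eta>] by (simp add: ln_div left_diff_distrib)
    finally show "((\<lambda>t. R t \<eta> * (ln (R t \<eta>) - ?ln t \<eta>)) has_real_derivative
       R' t \<eta> * ln (R t \<eta> / nu N (rN N t) \<eta>) + (R' t \<eta> - R t \<eta> * ?S \<eta>)) (at t within {0..})" .
  qed
  also have "(\<Sum>\<eta>\<in>configs N. R' t \<eta> * ln (R t \<eta> / nu N (rN N t) \<eta>) + (R' t \<eta> - R t \<eta> * ?S \<eta>)) =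
     (\<Sum>\<eta>\<in>configs N. R' t \<eta> * ln (R t \<eta> / nu N (rN N t) \<eta>)) - params.avg N (R t) ?S"
    using mass by (simp add: sum.distrib sum_subtractf params.avg_def[OF params_rN[OF N t]])
  finally show ?thesis
  proof (rule has_field_derivative_transform_within[where d = 1])
    fix s :: real assume s: "s \<in> {0..}"
    then have s': "s \<ge> 0" by simp
    show "(\<Sum>\<eta>\<in>configs N. R s \<eta> * (ln (R s \<eta>) - ?ln s \<eta>)) = params.entropy N (rN N s) (R s)"
      unfolding params.entropy_def[OF params_rN[OF N s']]
      using pos[OF s'] nupos[OF s'] lnnu[OF s']
      by (intro sum.cong refl) (simp add: ln_div less_imp_neq[OF nupos[OF s'], symmetric])
  qed (use t in auto)
qed

text \<open>\<open>A\<close> is fixed before \<open>e\<close>, so Gronwall's exponential does not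
  grow as the error shrinks. The error is split into \<open>e / 2\<close> for the block term,
  through the choice of \<open>q\<close>, \<open>2 * (e / 8)\<close> for the discretized equation,
  and \<open>e / 4\<close> for the terms that vanish as \<open>N\<close> grows.\<close>

lemma production_bound:
  assumes T: "T \<ge> 0"
  obtains A where "A > 0" "\<And>e. e > 0 \<Longrightarrow> \<exists>N0\<ge>3. \<forall>N\<ge>N0. \<forall>t\<in>{0..T}. \<forall>P.
      (\<forall>\<eta>\<in>configs N. P \<eta> > 0) \<and> (\<Sum>\<eta>\<in>configs N. P \<eta>) = 1 \<longrightarrow>
      (real N)\<^sup>2 * (\<Sum>\<eta>\<in>configs N. generator N P \<eta> * ln (P \<eta> / nu N (rN N t) \<eta>))
       - params.avg N P (\<lambda>\<eta>. \<Sum>x\<in>sites N. source N t x * (of_bool (\<eta> x) - rN N t x))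
      \<le> A * params.entropy N (rN N t) P + real (N ^ CARD('d)) * e"
proof -
  obtain \<Lambda> where \<Lambda>: "\<Lambda> > 0"
    and lip: "\<And>N t x j k. N \<ge> 1 \<Longrightarrow> 0 \<le> t \<Longrightarrow> t \<le> T \<Longrightarrow> x \<in> sites N \<Longrightarrow> \<bar>k\<bar> \<le> int N \<Longrightarrow>
        \<bar>rN N t (shift N j k x) - rN N t x\<bar> \<le> \<Lambda> * \<bar>of_int k\<bar> / real N"
    and dis: "\<And>N t x j. N \<ge> 1 \<Longrightarrow> 0 \<le> t \<Longrightarrow> t \<le> T \<Longrightarrow> x \<in> sites N \<Longrightarrow>
        \<bar>params.chem (rN N t) (shift N j 1 x) - params.chem (rN N t) x\<bar> \<le> \<Lambda> / real N
        \<and> \<bar>params.lap N (rN N t) j x\<bar> \<le> \<Lambda> \<and> \<bar>params.grd N (rN N t) j x\<bar> \<le> \<Lambda>\<^sup>2"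
    and con: "\<And>\<phi>. \<phi> > 0 \<Longrightarrow> \<exists>N0. \<forall>N\<ge>N0. \<forall>t\<in>{0..T}. \<forall>x\<in>sites N.
        \<bar>(\<Sum>j\<in>UNIV. params.lap N (rN N t) j x * (2 * rN N t x) + params.grd N (rN N t) j x / 2 * (8 * rN N t x - 12 * (rN N t x)\<^sup>2))
          - h t (embed N x) / (rN N t x * (1 - rN N t x))\<bar> \<le> \<phi>"
    by (rule discretization[OF T]) (rule that; assumption)
  define G where "G = \<Lambda> + \<Lambda>\<^sup>2"
  have G: "G > 0" "\<Lambda> \<le> G" "\<Lambda>\<^sup>2 \<le> G" using \<Lambda> by (auto simp: G_def add_pos_nonneg)
  define \<gamma> where "\<gamma> = \<delta>\<^sup>2 / 160"
  have \<gamma>: "\<gamma> > 0" using \<delta> by (simp add: \<gamma>_def)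
  let ?d = "real CARD('d)"
  define A where "A = 65 * G * ?d / \<gamma>"
  have A: "A > 0" using G \<gamma> by (simp add: A_def)
  show thesis
  proof (rule that[OF A])
    fix e :: real assume e: "e > 0"
    have "(\<lambda>q. 130 * G * ?d * (ln (3 * (real q + 1)) / (\<gamma> * real (2 * (6 * q + 4))))) \<longlonglongrightarrow> 0"
      using \<gamma> by real_asymp
    then have "\<forall>\<^sub>F q in sequentially. 130 * G * ?d * (ln (3 * (real q + 1)) / (\<gamma> * real (2 * (6 * q + 4)))) < e / 2"
      using e by (intro order_tendstoD) auto
    then have "\<forall>\<^sub>F q in sequentially. q \<ge> 1 \<and> 130 * G * ?d * (ln (3 * (real q + 1)) / (\<gamma> * real (2 * (6 * q + 4)))) < e / 2"
      using eventually_ge_at_top[of 1] by (rule eventually_conj[rotated])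
    then obtain q where q: "q \<ge> 1" and qe: "130 * G * ?d * (ln (3 * (real q + 1)) / (\<gamma> * real (2 * (6 * q + 4)))) < e / 2"
      using eventually_happens'[OF sequentially_bot] by blast
    define n where "n = 6 * q + 4"
    obtain M0 where M0: "\<And>w w'. length w = n \<Longrightarrow> linked w w' \<Longrightarrow> \<exists>m\<le>M0. (symclp move ^^ m) w w'"
      using linked_bounded[of n] by blast
    define M where "M = max M0 1"
    have M: "\<exists>m\<le>M. (symclp move ^^ m) w w'" if "length w = n" "linked w w'" for w w'
      using M0[OF that] unfolding M_def by (meson max.coboundedI1)
    have M1: "M \<ge> 1" by (simp add: M_def)
    have "e / 8 > 0" using e by simp
    then obtain N1 where N1: "\<And>N t x. N \<ge> N1 \<Longrightarrow> t \<in> {0..T} \<Longrightarrow> x \<in> sites N \<Longrightarrow>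
        \<bar>(\<Sum>j\<in>UNIV. params.lap N (rN N t) j x * (2 * rN N t x) + params.grd N (rN N t) j x / 2 * (8 * rN N t x - 12 * (rN N t x)\<^sup>2))
          - source N t x\<bar> \<le> e / 8"
      unfolding source_def using con by blast
    define W where "W = 2 ^ n * real M"
    have "(\<lambda>N. 8 * ?d * \<Lambda> ^ 3 / real N + 52 * G * ?d * W * (39 * G * W * real n / (real N)\<^sup>2 + 2 * \<Lambda> / real N)) \<longlonglongrightarrow> 0"
      by real_asymp
    then have ev1: "\<forall>\<^sub>F N in sequentially. 8 * ?d * \<Lambda> ^ 3 / real N + 52 * G * ?d * W * (39 * G * W * real n / (real N)\<^sup>2 + 2 * \<Lambda> / real N) < e / 4"
      using e by (intro order_tendstoD) auto
    have "(\<lambda>N. 2 * \<Lambda> / real N) \<longlonglongrightarrow> 0" by real_asymp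
    then have ev2: "\<forall>\<^sub>F N in sequentially. 2 * \<Lambda> / real N < 1" by (rule order_tendstoD) simp
    have "(\<lambda>N. \<Lambda> * real n / real N) \<longlonglongrightarrow> 0" by real_asymp
    then have "(\<lambda>N. 40 * \<gamma> * real q * (\<Lambda> * real n / real N)\<^sup>2) \<longlonglongrightarrow> 40 * \<gamma> * real q * 0\<^sup>2"
      by (intro tendsto_intros)
    then have "(\<lambda>N. 40 * \<gamma> * real q * (\<Lambda> * real n / real N)\<^sup>2) \<longlonglongrightarrow> 0" by simp
    then have ev3: "\<forall>\<^sub>F N in sequentially. 40 * \<gamma> * real q * (\<Lambda> * real n / real N)\<^sup>2 < 1" by (rule order_tendstoD) simp
    from eventually_conj[OF ev1 eventually_conj[OF ev2 ev3]] obtain N2 where N2: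
      "\<And>N. N \<ge> N2 \<Longrightarrow> 8 * ?d * \<Lambda> ^ 3 / real N + 52 * G * ?d * W * (39 * G * W * real n / (real N)\<^sup>2 + 2 * \<Lambda> / real N) < e / 4"
      "\<And>N. N \<ge> N2 \<Longrightarrow> 2 * \<Lambda> / real N < 1" "\<And>N. N \<ge> N2 \<Longrightarrow> 40 * \<gamma> * real q * (\<Lambda> * real n / real N)\<^sup>2 < 1"
      unfolding eventually_sequentially by blast
    show "\<exists>N0\<ge>3. \<forall>N\<ge>N0. \<forall>t\<in>{0..T}. \<forall>P.
      (\<forall>\<eta>\<in>configs N. P \<eta> > 0) \<and> (\<Sum>\<eta>\<in>configs N. P \<eta>) = 1 \<longrightarrow>
      (real N)\<^sup>2 * (\<Sum>\<eta>\<in>configs N. generator N P \<eta> * ln (P \<eta> / nu N (rN N t) \<eta>))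
       - params.avg N P (\<lambda>\<eta>. \<Sum>x\<in>sites N. source N t x * (of_bool (\<eta> x) - rN N t x))
      \<le> A * params.entropy N (rN N t) P + real (N ^ CARD('d)) * e"
    proof (intro exI[of _ "max (max 3 n) (max N1 N2)"] conjI allI ballI impI)
      fix N t and P :: "'d config \<Rightarrow> real"
      assume N: "max (max 3 n) (max N1 N2) \<le> N" and tT: "t \<in> {0..T}"
        and P: "(\<forall>\<eta>\<in>configs N. P \<eta> > 0) \<and> (\<Sum>\<eta>\<in>configs N. P \<eta>) = 1"
      have N3: "N \<ge> 3" and nN: "n \<le> N" and NN: "N \<ge> N1" "N \<ge> N2" "N \<ge> 1" and t: "0 \<le> t" "t \<le> T" using N tT by auto
      interpret p: params N "rN N t" by (rule params_rN[OF NN(3) t(1)])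
      have chem: "\<bar>p.chem (shift N j 1 x) - p.chem x\<bar> \<le> \<Lambda> / real N" if "x \<in> sites N" for x j
        using dis[OF NN(3) t that] by blast
      have L1: "2 * (\<Lambda> / real N) \<le> 1" using N2(2)[OF NN(2)] by simp
      \<comment> \<open>A bond exchange changes \<open>nu\<close> by the exponential of a number of
        size at most \<open>\<Lambda> / N\<close>; the factor 2 is that of
        \<open>exp_first_order\<close>.\<close>
      interpret ne: near_exchangeable N "rN N t" P "2 * \<Lambda> / real N"
      proof
        fix x :: "int ^ 'd" and j and \<eta> :: "'d config" assume x: "x \<in> sites N"
        let ?z = "(of_bool (\<eta> x) - of_bool (\<eta> (shift N j 1 x))) * (p.chem (shift N j 1 x) - p.chem x)"
        have "\<bar>?z\<bar> \<le> 1 * (\<Lambda> / real N)"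
          unfolding abs_mult using chem[OF x] by (intro mult_mono) auto
        then have z: "\<bar>?z\<bar> \<le> \<Lambda> / real N" by simp
        moreover have "\<Lambda> / real N \<ge> 0" using \<Lambda> by simp
        ultimately have "\<bar>?z\<bar> \<le> 1" using L1 by linarith
        then have "\<bar>exp ?z - 1\<bar> \<le> 2 * \<bar>?z\<bar>" by (rule exp_first_order)
        then show "\<bar>nu N (rN N t) (bond_swap N x j \<eta>) / nu N (rN N t) \<eta> - 1\<bar> \<le> 2 * \<Lambda> / real N"
          unfolding p.nu_ex_ratio[OF order_trans[OF _ N3] x, simplified] using z by simp
      qed (use N3 P L1 in auto)
      have "(real N)\<^sup>2 * (\<Sum>\<eta>\<in>configs N. generator N P \<eta> * ln (P \<eta> / nu N (rN N t) \<eta>))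
        - p.avg P (\<lambda>\<eta>. \<Sum>x\<in>sites N. source N t x * (of_bool (\<eta> x) - rN N t x))
        \<le> 65 * G * ?d / \<gamma> * p.entropy P + real (N ^ CARD('d)) *
         (8 * ?d * \<Lambda> ^ 3 / real N + 2 * (e / 8) + 130 * G * ?d * (ln (3 * (real q + 1)) / (\<gamma> * real (2 * n)))
        + 52 * G * ?d * (2 ^ n * real M) * (39 * G * (2 ^ n * real M) * real n / (real N)\<^sup>2 + 2 * \<Lambda> / real N))"
      proof (rule ne.entropy_production[OF chem _ _ _ G(1) _ q n_def nN \<delta> _ \<gamma>_def _ _ M M1])
        show "\<bar>p.lap j x\<bar> \<le> G" "\<bar>p.grd j x\<bar> \<le> G" if "x \<in> sites N" for x j
          using dis[OF NN(3) t that, of j] G by auto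
        show "\<Lambda> / real N \<le> 1" using L1 by linarith
        show "\<delta> \<le> rN N t x" for x by (rule rho_bounds(1)[OF t(1)])
        show "\<bar>(\<Sum>j\<in>UNIV. p.lap j x * (2 * rN N t x) + p.grd j x / 2 * (8 * rN N t x - 12 * (rN N t x)\<^sup>2)) - source N t x\<bar> \<le> e / 8"
          if "x \<in> sites N" for x by (rule N1[OF NN(1) tT that])
        show "40 * \<gamma> * real q * (\<Lambda> * real n / real N)\<^sup>2 \<le> 1" using N2(3)[OF NN(2)] by simp
        fix x :: "int ^ 'd" and j k assume x: "x \<in> sites N" and k: "\<bar>k\<bar> < int n"
        have "\<bar>rN N t (shift N j k x) - rN N t x\<bar> \<le> \<Lambda> * \<bar>of_int k\<bar> / real N"
          by (rule lip[OF NN(3) t x]) (use k nN in linarith)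
        also have "\<dots> \<le> \<Lambda> * real n / real N"
        proof (intro divide_right_mono mult_left_mono)
          show "\<bar>real_of_int k\<bar> \<le> real n" using k by linarith
        qed (use \<Lambda> in auto)
        finally show "\<bar>rN N t (shift N j k x) - rN N t x\<bar> \<le> \<Lambda> * real n / real N" .
      qed
      also have "\<dots> \<le> A * p.entropy P + real (N ^ CARD('d)) * e"
        unfolding A_def
      proof (intro add_mono order_refl mult_left_mono)
        show "8 * ?d * \<Lambda> ^ 3 / real N + 2 * (e / 8) + 130 * G * ?d * (ln (3 * (real q + 1)) / (\<gamma> * real (2 * n)))
          + 52 * G * ?d * (2 ^ n * real M) * (39 * G * (2 ^ n * real M) * real n / (real N)\<^sup>2 + 2 * \<Lambda> / real N) \<le> e"
          using N2(1)[OF NN(2)] qe unfolding W_def n_def by linarith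
      qed simp
      finally show "(real N)\<^sup>2 * (\<Sum>\<eta>\<in>configs N. generator N P \<eta> * ln (P \<eta> / nu N (rN N t) \<eta>))
        - params.avg N P (\<lambda>\<eta>. \<Sum>x\<in>sites N. source N t x * (of_bool (\<eta> x) - rN N t x))
        \<le> A * params.entropy N (rN N t) P + real (N ^ CARD('d)) * e" .
    qed simp
  qed
qed

end

text \<open>The law may vanish at some configurations. A small multiple of the uniform distribution,
  which is invariant, is added to it in order to have logarithms.\<close>

definition mix :: "nat \<Rightarrow> ('d::finite config \<Rightarrow> real) \<Rightarrow> 'd config \<Rightarrow> real" where
  "mix N P \<eta> = (1 - 1 / real N) * P \<eta> + (1 / real N) / real (card (configs N :: 'd config set))"

lemma card_configs_pos: "real (card (configs N :: 'd::finite config set)) > 0"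
  using configs_nonempty finite_configs by (simp add: card_gt_0_iff)

lemma mix_props:
  fixes P :: "'d::finite config \<Rightarrow> real"
  assumes N: "N \<ge> 1" and P: "\<And>\<eta>. \<eta> \<in> configs N \<Longrightarrow> P \<eta> \<ge> 0" "(\<Sum>\<eta>\<in>configs N. P \<eta>) = 1"
  shows "\<eta> \<in> configs N \<Longrightarrow> mix N P \<eta> > 0" "(\<Sum>\<eta>\<in>configs N. mix N P \<eta>) = 1"
    "\<eta> \<in> configs N \<Longrightarrow> (1 - 1 / real N) * P \<eta> \<le> mix N P \<eta>"
proof -
  have u: "(1 / real N) / real (card (configs N :: 'd config set)) > 0"
    using N card_configs_pos[where ?'d = 'd, of N] by (intro divide_pos_pos) auto
  have N': "0 \<le> 1 - 1 / real N" using N by simp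
  show "\<eta> \<in> configs N \<Longrightarrow> mix N P \<eta> > 0"
    unfolding mix_def using P(1)[of \<eta>] N' u by (intro add_nonneg_pos mult_nonneg_nonneg)
  show "(1 - 1 / real N) * P \<eta> \<le> mix N P \<eta>" using u by (simp add: mix_def)
  show "(\<Sum>\<eta>\<in>configs N. mix N P \<eta>) = 1"
    using card_configs_pos[where ?'d = 'd, of N] N
    by (simp add: mix_def sum.distrib P(2) configs_nonempty flip: sum_distrib_left)
qed

lemma generator_mix: "N \<ge> 3 \<Longrightarrow> generator N (mix N P) \<eta> = (1 - 1 / real N) * generator N P \<eta>"
  unfolding generator_bonds mix_def sum_distrib_left by (intro sum.cong refl) (simp add: algebra_simps)

lemma sum_generator_zero: "N \<ge> 3 \<Longrightarrow> (\<Sum>\<eta>\<in>configs N. generator N P \<eta>) = 0"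
  using generator_symmetric[of N "\<lambda>_. 1" P] by (simp add: generator_def)

text \<open>The supremum is tested with the logarithmic density of the mixture, whose exponential
  integrates to 1. The entropy of the mixture averages this same function: over
  \<open>\<mu>\<close>, where the test bounds it, and over the uniform part, where the pointwise
  bound \<open>N ^ CARD('d) * ln (1 / \<delta>)\<close> meets the weight
  \<open>1 / N\<close>.\<close>

lemma initial_entropy:
  fixes \<rho>\<^sub>0 :: "real ^ 'd::finite \<Rightarrow> real" and \<mu> :: "'d config measure"
  assumes N: "N \<ge> 1" and \<mu>: "prob_space \<mu>" "sets \<mu> = Pow (configs N)"
    and \<delta>: "\<delta> > 0" "\<And>u. \<delta> \<le> \<rho>\<^sub>0 u \<and> \<rho>\<^sub>0 u \<le> 1 - \<delta>"
    and ent: "rel_entropy \<mu> (product_bernoulli N \<rho>\<^sub>0) / ereal (real N ^ CARD('d)) < ereal e" and e: "e > 0"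
  shows "params.entropy N (\<lambda>x. \<rho>\<^sub>0 (embed N x)) (mix N (\<lambda>\<eta>. measure \<mu> {\<eta>})) \<le> real (N ^ CARD('d)) * (e + ln (1 / \<delta>) / real N)"
proof -
  let ?r = "\<lambda>x. \<rho>\<^sub>0 (embed N x)" and ?P = "\<lambda>\<eta>. measure \<mu> {\<eta>}" and ?Nd = "real (N ^ CARD('d))"
  have d1: "\<delta> \<le> 1 / 2" using \<delta>(2)[of 0] by linarith
  interpret params N ?r
  proof
    show "0 < ?r x \<and> ?r x < 1" for x using \<delta>(2)[of "embed N x"] \<delta>(1) by linarith
  qed (rule N)
  have Nd: "?Nd > 0" using N by simp
  have sp: "space \<mu> = configs N" using \<mu>(2) by (metis Pow_top sets.sets_into_space sets.top Pow_iff subset_antisym)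
  have idm: "id \<in> measurable \<mu> (count_space (configs N))"
    by (rule measurableI) (auto simp: sp \<mu>(2))
  have int: "(\<integral>\<eta>. f \<eta> \<partial>\<mu>) = (\<Sum>\<eta>\<in>configs N. ?P \<eta> * f \<eta>)" for f :: "'d config \<Rightarrow> real"
  proof -
    have "(\<integral>\<eta>. f (id \<eta>) \<partial>\<mu>) = (\<Sum>s\<in>configs N. measure \<mu> {\<omega> \<in> space \<mu>. id \<omega> = s} * f s)"
      by (rule integral_finite_valued(2)[OF \<mu>(1) idm finite_configs])
    also have "\<dots> = (\<Sum>\<eta>\<in>configs N. ?P \<eta> * f \<eta>)"
    proof (rule sum.cong[OF refl])
      fix s assume "s \<in> (configs N :: 'd config set)"
      then have "{\<omega> \<in> space \<mu>. id \<omega> = s} = {s}" by (auto simp: sp)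
      then show "measure \<mu> {\<omega> \<in> space \<mu>. id \<omega> = s} * f s = ?P s * f s" by simp
    qed
    finally show ?thesis by simp
  qed
  have Psum: "(\<Sum>\<eta>\<in>configs N. ?P \<eta>) = 1" using int[of "\<lambda>_. 1"] prob_space.prob_space[OF \<mu>(1)] by simp
  note mp = mix_props[OF N, of ?P, OF _ Psum, simplified]
  define f where "f \<eta> = ln (mix N ?P \<eta> / nu N ?r \<eta>)" for \<eta>
  have "(\<integral>\<eta>. exp (f \<eta>) \<partial>product_bernoulli N \<rho>\<^sub>0) = expect N ?r (\<lambda>\<eta>. exp (f \<eta>))"
  proof (rule product_bernoulli_integral)
    show "0 \<le> \<rho>\<^sub>0 u \<and> \<rho>\<^sub>0 u \<le> 1" for u using \<delta>(2)[of u] \<delta>(1) by linarith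
  qed
  also have "\<dots> = (\<Sum>\<eta>\<in>configs N. mix N ?P \<eta>)"
    unfolding expect_def f_def using mp(1) nu_pos by (intro sum.cong refl) (simp add: less_imp_neq[symmetric])
  also have "\<dots> = 1" by (rule mp(2))
  finally have one: "(\<integral>\<eta>. exp (f \<eta>) \<partial>product_bernoulli N \<rho>\<^sub>0) = 1" .
  have "ereal ((\<integral>\<eta>. f \<eta> \<partial>\<mu>) - ln (\<integral>\<eta>. exp (f \<eta>) \<partial>product_bernoulli N \<rho>\<^sub>0)) \<le> rel_entropy \<mu> (product_bernoulli N \<rho>\<^sub>0)"
    unfolding rel_entropy_def by (rule SUP_upper) simp
  then have "ereal (\<Sum>\<eta>\<in>configs N. ?P \<eta> * f \<eta>) \<le> rel_entropy \<mu> (product_bernoulli N \<rho>\<^sub>0)"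
    by (simp add: int one)
  then have "ereal (\<Sum>\<eta>\<in>configs N. ?P \<eta> * f \<eta>) / ereal (real N ^ CARD('d)) \<le> rel_entropy \<mu> (product_bernoulli N \<rho>\<^sub>0) / ereal (real N ^ CARD('d))"
    using N by (intro ereal_divide_right_mono) auto
  also note ent
  finally have "(\<Sum>\<eta>\<in>configs N. ?P \<eta> * f \<eta>) / ?Nd < e" using N by simp
  then have s1: "(\<Sum>\<eta>\<in>configs N. ?P \<eta> * f \<eta>) \<le> ?Nd * e" using Nd by (simp add: field_simps)
  have fb: "f \<eta> \<le> ?Nd * ln (1 / \<delta>)" if \<eta>: "\<eta> \<in> configs N" for \<eta>
  proof -
    have "mix N ?P \<eta> \<le> (\<Sum>\<eta>\<in>configs N. mix N ?P \<eta>)"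
      by (rule member_le_sum) (use \<eta> mp(1) in \<open>auto intro: less_imp_le\<close>)
    then have m1: "mix N ?P \<eta> \<le> 1" using mp(2) by simp
    have "(\<Prod>x\<in>(sites N :: (int ^ 'd) set). \<delta>) \<le> nu N ?r \<eta>"
      unfolding nu_def using \<delta> by (intro prod_mono) (auto simp: le_diff_eq add.commute)
    then have n1: "\<delta> ^ (N ^ CARD('d)) \<le> nu N ?r \<eta>" by (simp add: card_sites)
    have "f \<eta> = ln (mix N ?P \<eta>) - ln (nu N ?r \<eta>)"
      unfolding f_def using mp(1)[OF \<eta>] nu_pos[of \<eta>] by (simp add: ln_div)
    also have "\<dots> \<le> 0 - ln (\<delta> ^ (N ^ CARD('d)))"
    proof (intro diff_mono)
      show "ln (mix N ?P \<eta>) \<le> 0" using m1 mp(1)[OF \<eta>] by simp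
      show "ln (\<delta> ^ (N ^ CARD('d))) \<le> ln (nu N ?r \<eta>)"
        using n1 \<delta>(1) nu_pos[of \<eta>] by (subst ln_le_cancel_iff) auto
    qed
    also have "\<dots> = ?Nd * ln (1 / \<delta>)" using \<delta>(1) by (simp add: ln_realpow ln_div)
    finally show ?thesis .
  qed
  let ?C = "real (card (configs N :: 'd config set))"
  have "entropy (mix N ?P) = (1 - 1 / real N) * (\<Sum>\<eta>\<in>configs N. ?P \<eta> * f \<eta>) + (1 / real N) / ?C * (\<Sum>\<eta>\<in>configs N. f \<eta>)"
    unfolding entropy_def f_def[symmetric]
    by (simp add: mix_def algebra_simps sum.distrib sum_subtractf sum_distrib_left sum_divide_distrib)
  also have "\<dots> \<le> ?Nd * e + (1 / real N) / ?C * (\<Sum>\<eta>\<in>(configs N :: 'd config set). ?Nd * ln (1 / \<delta>))"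
  proof (intro add_mono mult_left_mono sum_mono fb)
    \<comment> \<open>The sum may be negative, so the factor below 1 is dropped only after passing
      to the positive upper bound.\<close>
    have "(1 - 1 / real N) * (\<Sum>\<eta>\<in>configs N. ?P \<eta> * f \<eta>) \<le> (1 - 1 / real N) * (?Nd * e)"
      using s1 N by (intro mult_left_mono) auto
    also have "\<dots> \<le> 1 * (?Nd * e)" using Nd e N by (intro mult_right_mono) auto
    finally show "(1 - 1 / real N) * (\<Sum>\<eta>\<in>configs N. ?P \<eta> * f \<eta>) \<le> ?Nd * e" by simp
  qed auto
  also have "(1 / real N) / ?C * (\<Sum>\<eta>\<in>(configs N :: 'd config set). ?Nd * ln (1 / \<delta>)) = (1 / real N) * (?Nd * ln (1 / \<delta>))"
    by (simp add: configs_nonempty)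
  also have "?Nd * e + (1 / real N) * (?Nd * ln (1 / \<delta>)) = ?Nd * (e + ln (1 / \<delta>) / real N)"
    by (simp add: algebra_simps)
  finally show ?thesis .
qed

section \<open>Propagation of the entropy bound in time\<close>

context pme_solution
begin

theorem entropy_estimate:
  fixes \<mu> :: "nat \<Rightarrow> 'd config measure" and M :: "nat \<Rightarrow> 'w measure" and X :: "nat \<Rightarrow> real \<Rightarrow> 'w \<Rightarrow> 'd config"
  assumes \<mu>: "\<And>N. N \<ge> 1 \<Longrightarrow> prob_space (\<mu> N) \<and> sets (\<mu> N) = Pow (configs N)"
    and ent: "(\<lambda>N. rel_entropy (\<mu> N) (product_bernoulli N (\<rho> 0)) / ereal (real N ^ CARD('d))) \<longlonglongrightarrow> 0"
    and mp: "\<And>N. N \<ge> 1 \<Longrightarrow> markov_process (configs N) (generator N) (\<mu> N) (M N) (X N)"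
    and T: "T \<ge> 0" and e: "e > 0"
  shows "\<forall>\<^sub>F N in sequentially. params.entropy N (rN N T) (mix N (law (M N) (X N) (T * (real N)\<^sup>2))) \<le> real (N ^ CARD('d)) * e"
proof -
  obtain A where A: "A > 0" and pr: "\<And>e. e > 0 \<Longrightarrow> \<exists>N0\<ge>3. \<forall>N\<ge>N0. \<forall>t\<in>{0..T}. \<forall>P.
      (\<forall>\<eta>\<in>configs N. P \<eta> > 0) \<and> (\<Sum>\<eta>\<in>configs N. P \<eta>) = 1 \<longrightarrow>
      (real N)\<^sup>2 * (\<Sum>\<eta>\<in>configs N. generator N P \<eta> * ln (P \<eta> / nu N (rN N t) \<eta>))
       - params.avg N P (\<lambda>\<eta>. \<Sum>x\<in>sites N. source N t x * (of_bool (\<eta> x) - rN N t x))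
      \<le> A * params.entropy N (rN N t) P + real (N ^ CARD('d)) * e"
    using production_bound[OF T] by blast
  \<comment> \<open>In Gronwall's bound the initial entropy contributes \<open>2 * e'\<close>, half
    of it caused by the mixture, and the constant error contributes \<open>e' / A\<close>.\<close>
  define c where "c = exp (A * T) * (2 + 1 / A)"
  have c: "c > 0" unfolding c_def using A by (intro mult_pos_pos add_pos_pos) auto
  define e' where "e' = e / c"
  have e': "e' > 0" using e c by (simp add: e'_def)
  obtain N0 where N0: "N0 \<ge> 3" "\<And>N t P. N \<ge> N0 \<Longrightarrow> t \<in> {0..T} \<Longrightarrow> (\<forall>\<eta>\<in>configs N. P \<eta> > 0) \<Longrightarrow> (\<Sum>\<eta>\<in>configs N. P \<eta>) = 1 \<Longrightarrow>
      (real N)\<^sup>2 * (\<Sum>\<eta>\<in>configs N. generator N P \<eta> * ln (P \<eta> / nu N (rN N t) \<eta>))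
       - params.avg N P (\<lambda>\<eta>. \<Sum>x\<in>sites N. source N t x * (of_bool (\<eta> x) - rN N t x))
      \<le> A * params.entropy N (rN N t) P + real (N ^ CARD('d)) * e'"
    using pr[OF e'] by blast
  have ev1: "\<forall>\<^sub>F N in sequentially. rel_entropy (\<mu> N) (product_bernoulli N (\<rho> 0)) / ereal (real N ^ CARD('d)) < ereal e'"
    using ent e' by (intro order_tendstoD) auto
  have "(\<lambda>N. ln (1 / \<delta>) / real N) \<longlonglongrightarrow> 0" by real_asymp
  then have ev2: "\<forall>\<^sub>F N in sequentially. ln (1 / \<delta>) / real N < e'" using e' by (rule order_tendstoD)
  show ?thesis
    using ev1 ev2 eventually_ge_at_top[of N0]
  proof eventually_elim
    case (elim N)
    have N: "N \<ge> 3" "N \<ge> 1" using elim N0 by auto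
    let ?Nd = "real (N ^ CARD('d))"
    define P where "P t = law (M N) (X N) (t * (real N)\<^sup>2)" for t
    note lw = markov_law[OF mp[OF N(2)] finite_configs]
    have P: "P t \<eta> \<ge> 0" "(\<Sum>\<eta>\<in>configs N. P t \<eta>) = 1" if "t \<ge> 0" for t \<eta>
      using lw(1,2)[of "t * (real N)\<^sup>2"] that by (auto simp: P_def)
    note mx = mix_props[OF N(2) P(1) P(2)]
    define R' where "R' t \<eta> = (real N)\<^sup>2 * generator N (mix N (P t)) \<eta>" for t \<eta>
    have dP: "((\<lambda>t. P t \<eta>) has_real_derivative (real N)\<^sup>2 * generator N (P t) \<eta>) (at t within {0..})"
      if "\<eta> \<in> configs N" "t \<ge> 0" for t \<eta>
    proof -
      have "((\<lambda>s. law (M N) (X N) s \<eta>) has_real_derivative generator N (P t) \<eta>) (at (t * (real N)\<^sup>2) within (\<lambda>t. t * (real N)\<^sup>2) ` {0..})"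
        unfolding P_def by (rule DERIV_subset[OF master_equation[OF mp[OF N(2)] N(1) that(1)]]) (use that in auto)
      then have "((\<lambda>s. law (M N) (X N) s \<eta>) \<circ> (\<lambda>t. t * (real N)\<^sup>2) has_real_derivative generator N (P t) \<eta> * (real N)\<^sup>2) (at t within {0..})"
        by (rule DERIV_image_chain) (auto intro!: derivative_eq_intros)
      then show ?thesis by (simp add: P_def o_def mult.commute)
    qed
    have dR: "((\<lambda>t. mix N (P t) \<eta>) has_real_derivative R' t \<eta>) (at t within {0..})"
      if "\<eta> \<in> configs N" "t \<ge> 0" for t \<eta>
    proof -
      have "((\<lambda>t. (1 - 1 / real N) * P t \<eta> + (1 / real N) / real (card (configs N :: 'd config set))) has_real_derivative
          (1 - 1 / real N) * ((real N)\<^sup>2 * generator N (P t) \<eta>) + 0) (at t within {0..})"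
        by (intro DERIV_add DERIV_cmult dP that DERIV_const)
      then show ?thesis by (simp add: mix_def R'_def generator_mix[OF N(1)] mult_ac)
    qed
    let ?H = "\<lambda>t. params.entropy N (rN N t) (mix N (P t))"
    have dH: "(?H has_real_derivative
        (\<Sum>\<eta>\<in>configs N. R' t \<eta> * ln (mix N (P t) \<eta> / nu N (rN N t) \<eta>))
        - params.avg N (mix N (P t)) (\<lambda>\<eta>. \<Sum>x\<in>sites N. source N t x * (of_bool (\<eta> x) - rN N t x))) (at t within {0..})"
      if t: "t \<ge> 0" for t
    proof (rule entropy_deriv[OF N(2) t])
      show "(\<Sum>\<eta>\<in>configs N. R' t \<eta>) = 0"
        by (simp add: R'_def sum_generator_zero[OF N(1)] flip: sum_distrib_left)
    qed (use mx(1) dR t in auto)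
    have prod: "(\<Sum>\<eta>\<in>configs N. R' t \<eta> * ln (mix N (P t) \<eta> / nu N (rN N t) \<eta>))
        - params.avg N (mix N (P t)) (\<lambda>\<eta>. \<Sum>x\<in>sites N. source N t x * (of_bool (\<eta> x) - rN N t x))
        \<le> A * ?H t + ?Nd * e'" if t: "0 < t" "t \<le> T" for t
    proof -
      have "(\<Sum>\<eta>\<in>configs N. R' t \<eta> * ln (mix N (P t) \<eta> / nu N (rN N t) \<eta>)) =
        (real N)\<^sup>2 * (\<Sum>\<eta>\<in>configs N. generator N (mix N (P t)) \<eta> * ln (mix N (P t) \<eta> / nu N (rN N t) \<eta>))"
        by (simp add: R'_def sum_distrib_left mult.assoc)
      then show ?thesis using N0(2)[OF elim(3), of t "mix N (P t)"] t mx(1,2)[of t] by simp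
    qed
    have H0: "?H 0 \<le> ?Nd * (e' + e')"
    proof -
      have "mix N (P 0) \<eta> = mix N (\<lambda>\<eta>. measure (\<mu> N) {\<eta>}) \<eta>" if "\<eta> \<in> configs N" for \<eta>
        using lw(3)[OF that] by (simp add: mix_def P_def)
      then have "?H 0 = params.entropy N (rN N 0) (mix N (\<lambda>\<eta>. measure (\<mu> N) {\<eta>}))"
        unfolding params.entropy_def[OF params_rN[OF N(2) order_refl]] by (intro sum.cong refl) simp
      also have "\<dots> \<le> ?Nd * (e' + ln (1 / \<delta>) / real N)"
        by (rule initial_entropy[OF N(2) _ _ \<delta> init elim(1) e']) (use \<mu>[OF N(2)] in auto)
      also have "\<dots> \<le> ?Nd * (e' + e')" using elim(2) by (intro mult_left_mono) auto
      finally show ?thesis .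
    qed
    have "?H T \<le> exp (A * T) * (?H 0 + ?Nd * e' / A) - ?Nd * e' / A"
      by (rule gronwall[OF dH prod T A])
    also have "\<dots> \<le> exp (A * T) * (?Nd * (e' + e') + ?Nd * e' / A) - 0"
      using H0 e' A by (intro diff_mono mult_left_mono add_mono) auto
    also have "\<dots> = ?Nd * (c * e')" by (simp add: c_def algebra_simps)
    also have "c * e' = e" using c by (simp add: e'_def)
    finally show ?case by (simp add: P_def)
  qed
qed

end

section \<open>Convergence of the empirical measure\<close>

context params
begin

lemma exp_moment_linear:
  assumes "\<And>x. x \<in> sites N \<Longrightarrow> \<bar>s * a x\<bar> \<le> c" "c \<le> 1"
  shows "expect N r (\<lambda>\<eta>. exp (s * (\<Sum>x\<in>sites N. a x * (of_bool (\<eta> x) - r x)))) \<le> exp (real (N ^ CARD('d)) * c\<^sup>2)"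
proof -
  have "expect N r (\<lambda>\<eta>. exp (s * (\<Sum>x\<in>sites N. a x * (of_bool (\<eta> x) - r x)))) =
     expect N r (\<lambda>\<eta>. \<Prod>x\<in>sites N. exp ((s * a x) * (of_bool (\<eta> x) - r x)))"
    by (simp add: exp_sum sum_distrib_left mult.assoc)
  also have "\<dots> = (\<Prod>x\<in>sites N. expect N r (\<lambda>\<eta>. exp ((s * a x) * (of_bool (\<eta> x) - r x))))"
    by (rule expect_prod_indep[where A = "\<lambda>x. {x}"]) (auto simp: local_on_def)
  also have "\<dots> \<le> (\<Prod>x\<in>(sites N :: (int ^ 'd) set). exp (c\<^sup>2))"
  proof (rule prod_mono, intro conjI)
    fix x :: "int ^ 'd" assume x: "x \<in> sites N"
    show "0 \<le> expect N r (\<lambda>\<eta>. exp ((s * a x) * (of_bool (\<eta> x) - r x)))"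
      by (rule less_imp_le[OF expect_pos]) simp
    have "expect N r (\<lambda>\<eta>. exp ((s * a x) * (of_bool (\<eta> x) - r x))) \<le> exp ((s * a x)\<^sup>2)"
      by (rule exp_moment_single[OF x]) (use assms(1)[OF x] assms(2) in linarith)
    also have "(s * a x)\<^sup>2 \<le> c\<^sup>2"
      using assms(1)[OF x] by (intro abs_le_square_iff[THEN iffD1]) linarith
    finally show "expect N r (\<lambda>\<eta>. exp ((s * a x) * (of_bool (\<eta> x) - r x))) \<le> exp (c\<^sup>2)" by simp
  qed
  also have "\<dots> = exp (real (N ^ CARD('d)) * c\<^sup>2)"
    by (simp add: card_sites flip: exp_of_nat_mult)
  finally show ?thesis .
qed

text \<open>The absolute value is handled by
  \<open>exp \<bar>y\<bar> \<le> exp y + exp (- y)\<close>, which accounts for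
  \<open>ln 2\<close>.\<close>

lemma deviation_bound:
  assumes P: "\<And>\<eta>. \<eta> \<in> configs N \<Longrightarrow> P \<eta> > 0" "(\<Sum>\<eta>\<in>configs N. P \<eta>) = 1"
    and a: "\<And>x. x \<in> sites N \<Longrightarrow> \<bar>a x\<bar> \<le> K" and g: "\<gamma> > 0" "\<gamma> * K \<le> 1"
  shows "(\<Sum>\<eta>\<in>configs N. P \<eta> * \<bar>\<Sum>x\<in>sites N. a x * (of_bool (\<eta> x) - r x)\<bar>)
     \<le> (entropy P + ln 2) / \<gamma> + \<gamma> * K\<^sup>2 * real (N ^ CARD('d))"
proof -
  let ?Y = "\<lambda>\<eta>. \<Sum>x\<in>sites N. a x * (of_bool (\<eta> x) - r x)" and ?Nd = "real (N ^ CARD('d))"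
  have b: "\<bar>s * a x\<bar> \<le> \<gamma> * K" if "x \<in> sites N" "s = \<gamma> \<or> s = - \<gamma>" for s x
    using a[OF that(1)] g(1) that(2) by (auto simp: abs_mult)
  have "expect N r (\<lambda>\<eta>. exp (\<gamma> * \<bar>?Y \<eta>\<bar>)) \<le> expect N r (\<lambda>\<eta>. exp (\<gamma> * ?Y \<eta>) + exp ((- \<gamma>) * ?Y \<eta>))"
    by (rule expect_mono) (auto simp: abs_if)
  also have "\<dots> = expect N r (\<lambda>\<eta>. exp (\<gamma> * ?Y \<eta>)) + expect N r (\<lambda>\<eta>. exp ((- \<gamma>) * ?Y \<eta>))"
    by (rule expect_add)
  also have "\<dots> \<le> exp (?Nd * (\<gamma> * K)\<^sup>2) + exp (?Nd * (\<gamma> * K)\<^sup>2)"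
    by (intro add_mono exp_moment_linear b g(2)) auto
  finally have "ln (expect N r (\<lambda>\<eta>. exp (\<gamma> * \<bar>?Y \<eta>\<bar>))) \<le> ln (2 * exp (?Nd * (\<gamma> * K)\<^sup>2))"
    by (subst ln_le_cancel_iff) (auto intro: expect_pos)
  also have "\<dots> = ln 2 + ?Nd * (\<gamma> * K)\<^sup>2" by (simp add: ln_mult)
  finally have "(\<Sum>\<eta>\<in>configs N. P \<eta> * (\<gamma> * \<bar>?Y \<eta>\<bar>)) \<le> entropy P + ln 2 + ?Nd * (\<gamma> * K)\<^sup>2"
    using entropy_inequality[OF P, of "\<lambda>\<eta>. \<gamma> * \<bar>?Y \<eta>\<bar>"] by linarith
  moreover have "(\<Sum>\<eta>\<in>configs N. P \<eta> * (\<gamma> * \<bar>?Y \<eta>\<bar>)) = \<gamma> * (\<Sum>\<eta>\<in>configs N. P \<eta> * \<bar>?Y \<eta>\<bar>)"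
    by (simp add: sum_distrib_left mult_ac)
  ultimately have "\<gamma> * (\<Sum>\<eta>\<in>configs N. P \<eta> * \<bar>?Y \<eta>\<bar>) \<le> \<gamma> * ((entropy P + ln 2) / \<gamma> + \<gamma> * K\<^sup>2 * ?Nd)"
  proof -
    have "\<gamma> * (X / \<gamma> + \<gamma> * K\<^sup>2 * n) = X + n * (\<gamma> * K)\<^sup>2" for X n
      using g(1) by (simp add: distrib_left power2_eq_square)
    then have "\<gamma> * ((entropy P + ln 2) / \<gamma> + \<gamma> * K\<^sup>2 * ?Nd) = entropy P + ln 2 + ?Nd * (\<gamma> * K)\<^sup>2"
      by blast
    then show ?thesis
      using \<open>(\<Sum>\<eta>\<in>configs N. P \<eta> * (\<gamma> * \<bar>?Y \<eta>\<bar>)) \<le> entropy P + ln 2 + ?Nd * (\<gamma> * K)\<^sup>2\<close>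
        \<open>(\<Sum>\<eta>\<in>configs N. P \<eta> * (\<gamma> * \<bar>?Y \<eta>\<bar>)) = \<gamma> * (\<Sum>\<eta>\<in>configs N. P \<eta> * \<bar>?Y \<eta>\<bar>)\<close> by linarith
  qed
  then show ?thesis using g(1) by simp
qed

end

section \<open>Cells of the unit cube and Riemann sums\<close>

definition cell :: "nat \<Rightarrow> int ^ 'd \<Rightarrow> (real ^ 'd::finite) set" where
  "cell N x = {u. \<forall>i. of_int (x $ i) / real N \<le> u $ i \<and> u $ i < (of_int (x $ i) + 1) / real N}"

lemma cell_sets [measurable]: "cell N x \<in> sets lborel"
proof -
  have "cell N x = (\<Inter>i. {u. of_int (x $ i) / real N \<le> u $ i} \<inter> {u. u $ i < (of_int (x $ i) + 1) / real N})"
    by (auto simp: cell_def)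
  also have "\<dots> \<in> sets borel"
    by (intro sets.countable_INT'') (auto intro!: sets.Int borel_closed borel_open closed_Collect_le open_Collect_less continuous_intros)
  finally show ?thesis by simp
qed

lemma unit_cube_cell: "unit_cube = cell 1 0"
  by (auto simp: unit_cube_def cell_def)

text \<open>A half-open cell lies between an open and a closed box of equal volume.\<close>

lemma emeasure_cell:
  fixes x :: "int ^ 'd::finite"
  assumes N: "N \<ge> 1"
  shows "emeasure lborel (cell N x) = ennreal (1 / real (N ^ CARD('d)))"
proof -
  let ?a = "(\<chi> i. of_int (x $ i) / real N) :: real ^ 'd" and ?b = "(\<chi> i. (of_int (x $ i) + 1) / real N) :: real ^ 'd"
  have ab: "?a \<bullet> b \<le> ?b \<bullet> b" if "b \<in> Basis" for b
    using that by (auto simp: Basis_vec_def inner_axis divide_right_mono)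
  have "(\<Prod>b\<in>Basis. (?b - ?a) \<bullet> b) = (\<Prod>i\<in>(UNIV :: 'd set). (?b - ?a) $ i)"
    by (rule prod.reindex_bij_witness[where i = "\<lambda>i. axis i 1" and j = "\<lambda>b. SOME i. b = axis i 1"])
       (auto simp: Basis_vec_def inner_axis axis_eq_axis)
  also have "\<dots> = 1 / real (N ^ CARD('d))"
    by (simp add: power_one_over field_simps flip: diff_divide_distrib)
  finally have v: "(\<Prod>b\<in>Basis. (?b - ?a) \<bullet> b) = 1 / real (N ^ CARD('d))" .
  have "emeasure lborel (box ?a ?b) \<le> emeasure lborel (cell N x)"
    by (intro emeasure_mono) (auto simp: cell_def mem_box_cart less_imp_le)
  moreover have "emeasure lborel (cell N x) \<le> emeasure lborel (cbox ?a ?b)"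
    by (intro emeasure_mono) (auto simp: cell_def mem_box_cart less_imp_le)
  moreover have "emeasure lborel (box ?a ?b) = ennreal (1 / real (N ^ CARD('d)))"
    using ab v by (simp add: emeasure_lborel_box_eq)
  moreover have "emeasure lborel (cbox ?a ?b) = ennreal (1 / real (N ^ CARD('d)))"
    using ab v by (simp add: emeasure_lborel_cbox_eq)
  ultimately show ?thesis by (metis antisym)
qed

abbreviation cube_measure :: "(real ^ 'd::finite) measure" where
  "cube_measure \<equiv> restrict_space lborel unit_cube"

lemma cube_sets: "unit_cube \<in> sets (lborel :: (real ^ 'd::finite) measure)"
  unfolding unit_cube_cell by (rule cell_sets)

lemma prob_cube: "prob_space (cube_measure :: (real ^ 'd::finite) measure)"
proof
  have "emeasure (cube_measure :: (real ^ 'd) measure) unit_cube = emeasure lborel (unit_cube :: (real ^ 'd) set)"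
    using cube_sets by (intro emeasure_restrict_space) auto
  also have "\<dots> = 1" unfolding unit_cube_cell using emeasure_cell[of 1 "0 :: int ^ 'd"] by simp
  finally show "emeasure cube_measure (space cube_measure :: (real ^ 'd) set) = 1"
    by (simp add: space_restrict_space)
qed

lemma cell_subset: "N \<ge> 1 \<Longrightarrow> x \<in> sites N \<Longrightarrow> cell N x \<subseteq> unit_cube"
proof
  fix u assume N: "N \<ge> 1" and x: "x \<in> sites N" and u: "u \<in> cell N x"
  have "0 \<le> u $ i \<and> u $ i < 1" for i
  proof -
    have "0 \<le> x $ i" "x $ i + 1 \<le> int N" using x by (auto simp: sites_iff less_imp_le zless_imp_add1_zle)
    then have "0 \<le> real_of_int (x $ i)" "real_of_int (x $ i) + 1 \<le> real N" by linarith+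
    then have "0 \<le> of_int (x $ i) / real N" "(of_int (x $ i) + 1) / real N \<le> 1" using N by auto
    moreover have "of_int (x $ i) / real N \<le> u $ i" "u $ i < (of_int (x $ i) + 1) / real N" using u by (auto simp: cell_def)
    ultimately show ?thesis by linarith
  qed
  then show "u \<in> unit_cube" by (simp add: unit_cube_def)
qed

lemma cell_unique:
  fixes u :: "real ^ 'd::finite"
  assumes N: "N \<ge> 1" and u: "u \<in> unit_cube"
  defines "y \<equiv> \<chi> i. \<lfloor>real N * u $ i\<rfloor>"
  shows "y \<in> sites N" "u \<in> cell N x \<longleftrightarrow> x = y"
proof -
  have N0: "real N > 0" using N by simp
  have "0 \<le> \<lfloor>real N * u $ i\<rfloor> \<and> \<lfloor>real N * u $ i\<rfloor> < int N" for i
  proof -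
    have "0 \<le> u $ i" "u $ i < 1" using u by (auto simp: unit_cube_def)
    then have "0 \<le> real N * u $ i" "real N * u $ i < real N * 1" using N0 by auto
    then show ?thesis by (simp add: floor_less_iff)
  qed
  then show "y \<in> sites N" by (simp add: sites_iff y_def)
  have "of_int (x $ i) / real N \<le> u $ i \<and> u $ i < (of_int (x $ i) + 1) / real N \<longleftrightarrow> x $ i = \<lfloor>real N * u $ i\<rfloor>" for i
    using N0 by (auto simp: field_simps floor_eq_iff eq_commute[of "x $ i"])
  then show "u \<in> cell N x \<longleftrightarrow> x = y" by (simp add: cell_def vec_eq_iff y_def)
qed

lemma cont_measurable_cube:
  fixes F :: "real ^ 'd::finite \<Rightarrow> real"
  assumes "continuous_on UNIV F"
  shows "F \<in> borel_measurable cube_measure"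
  using borel_measurable_continuous_onI[OF assms] by (intro measurable_restrict_space1) simp

lemma cont_bounded_cube:
  fixes F :: "real ^ 'd::finite \<Rightarrow> real"
  assumes "continuous_on UNIV F"
  obtains B where "B > 0" "\<And>u. u \<in> cbox 0 (\<chi> i. 1) \<Longrightarrow> \<bar>F u\<bar> \<le> B"
proof -
  have "compact (F ` cbox 0 (\<chi> i. 1))"
    by (intro compact_continuous_image continuous_on_subset[OF assms]) auto
  then obtain B where B: "\<And>u. u \<in> cbox 0 (\<chi> i. 1) \<Longrightarrow> norm (F u) \<le> B"
    by (meson bounded_iff compact_imp_bounded imageI)
  show thesis
  proof (rule that[of "\<bar>B\<bar> + 1"])
    show "\<bar>F u\<bar> \<le> \<bar>B\<bar> + 1" if "u \<in> cbox 0 (\<chi> i. 1)" for u using B[OF that] by simp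
  qed simp
qed

lemma unit_cube_subset: "unit_cube \<subseteq> cbox 0 ((\<chi> i. 1) :: real ^ 'd::finite)"
  by (auto simp: unit_cube_def mem_box_cart less_imp_le)

text \<open>The sum is the integral of a step function on the half-open cells. Each cell lies within
  \<open>CARD('d) / N\<close> of its corner \<open>embed N x\<close>, so uniform continuity
  applies.\<close>

theorem riemann_sum:
  fixes F :: "real ^ 'd::finite \<Rightarrow> real"
  assumes F: "continuous_on UNIV F"
  shows "(\<lambda>N. (\<Sum>x\<in>sites N. F (embed N x)) / real (N ^ CARD('d))) \<longlonglongrightarrow> (\<integral>u. F u \<partial>cube_measure)"
proof (rule LIMSEQ_I)
  fix e :: real assume e: "e > 0"
  let ?C = "cube_measure :: (real ^ 'd) measure"
  interpret C: prob_space ?C by (rule prob_cube)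
  have spC: "space ?C = unit_cube" by (simp add: space_restrict_space)
  have "uniformly_continuous_on (cbox 0 (\<chi> i. 1)) F"
    by (rule compact_uniformly_continuous[OF continuous_on_subset[OF F]]) auto
  then obtain d where d: "d > 0" "\<And>u v. u \<in> cbox 0 (\<chi> i. 1) \<Longrightarrow> v \<in> cbox 0 (\<chi> i. 1) \<Longrightarrow> dist v u < d \<Longrightarrow> dist (F v) (F u) < e / 2"
    unfolding uniformly_continuous_on_def using e by (meson half_gt_zero)
  obtain B where B: "B > 0" "\<And>u. u \<in> cbox 0 (\<chi> i. 1) \<Longrightarrow> \<bar>F u\<bar> \<le> B" using cont_bounded_cube[OF F] by blast
  have "(\<lambda>N. real CARD('d) / real N) \<longlonglongrightarrow> 0" by real_asymp
  then have "\<forall>\<^sub>F N in sequentially. real CARD('d) / real N < d" using d(1) by (rule order_tendstoD)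
  then obtain N1 where N1: "\<And>N. N \<ge> N1 \<Longrightarrow> real CARD('d) / real N < d" unfolding eventually_sequentially by blast
  show "\<exists>N0. \<forall>N\<ge>N0. norm ((\<Sum>x\<in>sites N. F (embed N x)) / real (N ^ CARD('d)) - (\<integral>u. F u \<partial>?C)) < e"
  proof (intro exI[of _ "max 1 N1"] allI impI)
    fix N assume "max 1 N1 \<le> N"
    then have N: "N \<ge> 1" "N \<ge> N1" by auto
    let ?S = "\<lambda>u. \<Sum>x\<in>sites N. F (embed N x) * indicator (cell N x) u"
    have cs: "cell N x \<in> sets ?C" if "x \<in> sites N" for x
      using cell_subset[OF N(1) that] cube_sets cell_sets[of N x] by (subst sets_restrict_space_iff) auto
    have mc: "measure ?C (cell N x) = 1 / real (N ^ CARD('d))" if "x \<in> sites N" for x :: "int ^ 'd"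
    proof -
      have "measure ?C (cell N x) = measure lborel (cell N x)"
        by (rule measure_restrict_space) (use cell_subset[OF N(1) that] cube_sets in auto)
      then show ?thesis using emeasure_cell[OF N(1), of x] by (simp add: measure_def)
    qed
    have iS: "integrable ?C ?S"
      using cs by (intro Bochner_Integration.integrable_sum integrable_mult_right integrable_real_indicator) (auto simp: C.emeasure_eq_measure)
    have iF: "integrable ?C F"
      by (rule C.integrable_const_bound[of _ B])
         (use B(2) unit_cube_subset cont_measurable_cube[OF F] spC in \<open>auto intro!: AE_I2\<close>)
    have "(\<integral>u. ?S u \<partial>?C) = (\<Sum>x\<in>sites N. F (embed N x) * measure ?C (cell N x))"
      using cs by (subst Bochner_Integration.integral_sum)
        (auto simp: C.emeasure_eq_measure spC Int_absorb2 cell_subset[OF N(1)] intro!: integrable_mult_right integrable_real_indicator sum.cong)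
    also have "\<dots> = (\<Sum>x\<in>sites N. F (embed N x)) / real (N ^ CARD('d))"
      unfolding sum_divide_distrib by (intro sum.cong refl) (simp add: mc)
    finally have IS: "(\<integral>u. ?S u \<partial>?C) = (\<Sum>x\<in>sites N. F (embed N x)) / real (N ^ CARD('d))" .
    have near: "\<bar>?S u - F u\<bar> \<le> e / 2" if u: "u \<in> unit_cube" for u
    proof -
      define y where "y = (\<chi> i. \<lfloor>real N * u $ i\<rfloor>)"
      have y: "y \<in> sites N" "\<And>x. u \<in> cell N x \<longleftrightarrow> x = y"
        unfolding y_def using cell_unique[OF N(1) u] by auto
      have "?S u = (\<Sum>x\<in>sites N. if x = y then F (embed N x) else 0)"
        by (rule sum.cong) (auto simp: indicator_def y(2))
      also have "\<dots> = F (embed N y)" using y(1) by (simp add: sum.delta')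
      finally have S: "?S u = F (embed N y)" .
      have uy: "u \<in> cell N y" using y(2) by simp
      have "norm (embed N y - u) \<le> (\<Sum>i\<in>UNIV. \<bar>(embed N y - u) $ i\<bar>)" by (rule norm_le_l1_cart)
      also have "\<dots> \<le> (\<Sum>i\<in>(UNIV :: 'd set). 1 / real N)"
      proof (rule sum_mono)
        fix i
        have "of_int (y $ i) / real N \<le> u $ i" "u $ i < (of_int (y $ i) + 1) / real N" using uy by (auto simp: cell_def)
        then show "\<bar>(embed N y - u) $ i\<bar> \<le> 1 / real N" by (simp add: embed_def abs_le_iff add_divide_distrib)
      qed
      also have "\<dots> < d" using N1[OF N(2)] by simp
      finally have "dist (embed N y) u < d" by (simp add: dist_norm)
      then have "dist (F (embed N y)) (F u) < e / 2"
        using u unit_cube_subset by (intro d(2) embed_in_cube[OF N(1) y(1)]) auto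
      then show ?thesis by (simp add: S dist_real_def)
    qed
    have "\<bar>(\<integral>u. ?S u \<partial>?C) - (\<integral>u. F u \<partial>?C)\<bar> = \<bar>\<integral>u. ?S u - F u \<partial>?C\<bar>"
      by (simp only: Bochner_Integration.integral_diff[OF iS iF])
    also have "\<dots> \<le> (\<integral>u. \<bar>?S u - F u\<bar> \<partial>?C)" by (rule integral_abs_bound)
    also have "\<dots> \<le> e / 2"
      by (rule C.integral_le_const) (use iS iF near spC in \<open>auto intro!: AE_I2\<close>)
    also have "\<dots> < e" using e by simp
    finally show "norm ((\<Sum>x\<in>sites N. F (embed N x)) / real (N ^ CARD('d)) - (\<integral>u. F u \<partial>?C)) < e"
      unfolding IS real_norm_def .
  qed
qed

section \<open>Measures on the torus and the weak topology\<close>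

lemma embed_unit_cube: "N \<ge> 1 \<Longrightarrow> x \<in> sites N \<Longrightarrow> embed N x \<in> unit_cube"
  by (auto simp: unit_cube_def embed_def sites_iff) (metis of_int_less_iff of_int_of_nat_eq)

lemma embed_measurable:
  "N \<ge> 1 \<Longrightarrow> embed N \<in> measurable (count_space (sites N)) (restrict_space borel (unit_cube :: (real ^ 'd::finite) set))"
  by (auto simp: space_restrict_space embed_unit_cube)

lemma empirical_torus:
  assumes N: "N \<ge> 1"
  shows "empirical_measure N \<eta> \<in> (torus_measures :: (real ^ 'd::finite) measure set)"
proof -
  let ?D = "density (count_space (sites N :: (int ^ 'd) set)) (\<lambda>x. ennreal (of_bool (\<eta> x) / real N ^ CARD('d)))"
  have "emeasure ?D (space ?D) = (\<Sum>x\<in>sites N. ennreal (of_bool (\<eta> x) / real N ^ CARD('d)))"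
    by (simp add: emeasure_density nn_integral_count_space_finite cong: nn_integral_cong)
  then have "finite_measure ?D" by (intro finite_measureI) simp
  then have "finite_measure (empirical_measure N \<eta> :: (real ^ 'd) measure)"
    unfolding empirical_measure_def by (rule finite_measure.finite_measure_distr) (use embed_measurable[OF N] in simp)
  then show ?thesis by (simp add: torus_measures_def empirical_measure_def)
qed

lemma empirical_integral:
  fixes G :: "real ^ 'd::finite \<Rightarrow> real"
  assumes N: "N \<ge> 1" and G: "continuous_on UNIV G"
  shows "(\<integral>u. G u \<partial>empirical_measure N \<eta>) = (\<Sum>x\<in>sites N. G (embed N x) * of_bool (\<eta> x)) / real (N ^ CARD('d))"
proof -
  have Gm: "G \<in> borel_measurable (restrict_space borel unit_cube)"
    using borel_measurable_continuous_onI[OF G] by (rule measurable_restrict_space1)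
  have "(\<integral>u. G u \<partial>empirical_measure N \<eta>) = (\<integral>x. G (embed N x) \<partial>density (count_space (sites N)) (\<lambda>x. ennreal (of_bool (\<eta> x) / real N ^ CARD('d))))"
    unfolding empirical_measure_def by (rule integral_distr[OF _ Gm]) (use embed_measurable[OF N] in simp)
  also have "\<dots> = (\<integral>x. (of_bool (\<eta> x) / real N ^ CARD('d)) * G (embed N x) \<partial>count_space (sites N))"
    by (rule integral_real_density) auto
  also have "\<dots> = (\<Sum>x\<in>sites N. (of_bool (\<eta> x) / real N ^ CARD('d)) * G (embed N x))"
    by (rule lebesgue_integral_count_space_finite) simp
  also have "\<dots> = (\<Sum>x\<in>sites N. G (embed N x) * of_bool (\<eta> x)) / real (N ^ CARD('d))"
    unfolding sum_divide_distrib by (intro sum.cong refl) simp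
  finally show ?thesis .
qed

lemma density_integral:
  fixes G r :: "real ^ 'd::finite \<Rightarrow> real"
  assumes G: "continuous_on UNIV G" and r: "continuous_on UNIV r" "\<And>u. 0 \<le> r u"
  shows "measure_with_density r \<in> torus_measures"
    and "(\<integral>u. G u \<partial>measure_with_density r) = (\<integral>u. r u * G u \<partial>cube_measure)"
proof -
  interpret C: prob_space "cube_measure :: (real ^ 'd) measure" by (rule prob_cube)
  obtain B where B: "B > 0" "\<And>u. u \<in> cbox 0 (\<chi> i. 1) \<Longrightarrow> \<bar>r u\<bar> \<le> B" using cont_bounded_cube[OF r(1)] by blast
  have rm: "r \<in> borel_measurable cube_measure" by (rule cont_measurable_cube[OF r(1)])
  have ir: "integrable cube_measure r"
    by (rule C.integrable_const_bound[of _ B])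
       (use B(2) unit_cube_subset rm in \<open>auto intro!: AE_I2 simp: space_restrict_space\<close>)
  have "emeasure (measure_with_density r) (space (measure_with_density r)) = (\<integral>\<^sup>+u. ennreal (r u) \<partial>cube_measure)"
    unfolding measure_with_density_def using rm by (subst emeasure_density) (auto intro!: nn_integral_cong)
  also have "\<dots> < \<infinity>" using ir r(2) by (subst nn_integral_eq_integral) auto
  finally have "finite_measure (measure_with_density r)" by (intro finite_measureI) auto
  moreover have "sets (measure_with_density r) = sets (restrict_space borel unit_cube)"
    by (simp add: measure_with_density_def sets_restrict_space)
  ultimately show "measure_with_density r \<in> torus_measures" by (simp add: torus_measures_def)
  show "(\<integral>u. G u \<partial>measure_with_density r) = (\<integral>u. r u * G u \<partial>cube_measure)"
    unfolding measure_with_density_def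
    by (rule integral_real_density) (use rm cont_measurable_cube[OF G] r(2) in auto)
qed

text \<open>Induction on the generation of the topology: subbasic sets are covered by
  \<open>lim\<close>, an intersection costs a union bound, and a union is missed no more often than
  its member that contains \<open>y\<close>. All events are measurable because \<open>X N\<close>
  takes values in a discrete space.\<close>

lemma converges_in_probabilityI:
  fixes Y :: "nat \<Rightarrow> 's \<Rightarrow> (real ^ 'd::finite) measure" and X :: "nat \<Rightarrow> 'w \<Rightarrow> 's"
  assumes M: "\<And>N. N \<ge> 1 \<Longrightarrow> prob_space (M N)"
    and X: "\<And>N. N \<ge> 1 \<Longrightarrow> X N \<in> measurable (M N) (count_space (S N))"
    and Y: "\<And>N s. N \<ge> 1 \<Longrightarrow> Y N s \<in> torus_measures" and y: "y \<in> torus_measures"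
    and lim: "\<And>(G :: real ^ 'd \<Rightarrow> real) e. continuous_on UNIV G \<Longrightarrow> torus_fun G \<Longrightarrow> e > 0 \<Longrightarrow>
      (\<lambda>N. measure (M N) {\<omega> \<in> space (M N). \<bar>(\<integral>u. G u \<partial>Y N (X N \<omega>)) - (\<integral>u. G u \<partial>y)\<bar> \<ge> e}) \<longlonglongrightarrow> 0"
  shows "converges_in_probability weak_topology M (\<lambda>N \<omega>. Y N (X N \<omega>)) y"
proof -
  have ev: "{\<omega> \<in> space (M N). Q (X N \<omega>)} \<in> sets (M N)" if "N \<ge> 1" for N Q
  proof -
    have "X N -` {s \<in> S N. Q s} \<inter> space (M N) \<in> sets (M N)"
      by (rule measurable_sets[OF X[OF that]]) auto
    also have "X N -` {s \<in> S N. Q s} \<inter> space (M N) = {\<omega> \<in> space (M N). Q (X N \<omega>)}"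
      using measurable_space[OF X[OF that]] by auto
    finally show ?thesis .
  qed
  let ?p = "\<lambda>U N. measure (M N) {\<omega> \<in> space (M N). Y N (X N \<omega>) \<notin> U}"
  have mono: "?p U \<longlonglongrightarrow> 0" if le: "\<And>N. N \<ge> 1 \<Longrightarrow> ?p U N \<le> g N" and g: "g \<longlonglongrightarrow> 0" for U g
  proof (rule tendsto_sandwich[OF _ _ tendsto_const g])
    show "\<forall>\<^sub>F N in sequentially. ?p U N \<le> g N"
      using eventually_ge_at_top[of 1] by eventually_elim (rule le)
  qed simp
  let ?B = "{{m \<in> torus_measures. (\<integral>u. G u \<partial>m) \<in> V} | (G :: real ^ 'd \<Rightarrow> real) V.
        continuous_on UNIV G \<and> torus_fun G \<and> open V}"
  have main: "y \<in> U \<longrightarrow> ?p U \<longlonglongrightarrow> 0" if "generate_topology_on ?B U" for U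
    using that
  proof (induction rule: generate_topology_on.induct)
    case (Int a b)
    show ?case
    proof
      assume yU: "y \<in> a \<inter> b"
      have "(\<lambda>N. ?p a N + ?p b N) \<longlonglongrightarrow> 0 + 0" using Int.IH yU by (intro tendsto_add) auto
      moreover have "?p (a \<inter> b) N \<le> ?p a N + ?p b N" if N: "N \<ge> 1" for N
      proof -
        interpret prob_space "M N" by (rule M[OF N])
        have "?p (a \<inter> b) N \<le> measure (M N) ({\<omega> \<in> space (M N). Y N (X N \<omega>) \<notin> a} \<union> {\<omega> \<in> space (M N). Y N (X N \<omega>) \<notin> b})"
          by (intro finite_measure_mono sets.Un ev[OF N, of "\<lambda>s. Y N s \<notin> a"] ev[OF N, of "\<lambda>s. Y N s \<notin> b"]) auto
        also have "\<dots> \<le> ?p a N + ?p b N"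
          by (intro measure_Un_le ev[OF N, of "\<lambda>s. Y N s \<notin> a"] ev[OF N, of "\<lambda>s. Y N s \<notin> b"])
        finally show ?thesis .
      qed
      ultimately show "?p (a \<inter> b) \<longlonglongrightarrow> 0" by (intro mono[of "a \<inter> b" "\<lambda>N. ?p a N + ?p b N"]) auto
    qed
  next
    case (UN K)
    show ?case
    proof
      assume "y \<in> \<Union> K"
      then obtain k where k: "k \<in> K" "y \<in> k" by blast
      have "?p (\<Union> K) N \<le> ?p k N" if N: "N \<ge> 1" for N
      proof -
        interpret prob_space "M N" by (rule M[OF N])
        show ?thesis using k(1) by (intro finite_measure_mono ev[OF N, of "\<lambda>s. Y N s \<notin> k"]) auto
      qed
      moreover have "?p k \<longlonglongrightarrow> 0" using UN.IH k by blast
      ultimately show "?p (\<Union> K) \<longlonglongrightarrow> 0" by (rule mono)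
    qed
  next
    case (Basis U)
    then obtain G :: "real ^ 'd \<Rightarrow> real" and V where U: "U = {m \<in> torus_measures. (\<integral>u. G u \<partial>m) \<in> V}"
      and G: "continuous_on UNIV G" "torus_fun G" "open V" unfolding mem_Collect_eq by (elim exE conjE) (rule that)
    show ?case
    proof
      assume "y \<in> U"
      then have "(\<integral>u. G u \<partial>y) \<in> V" by (simp add: U)
      then obtain e where e: "e > 0" "\<And>v. dist v (\<integral>u. G u \<partial>y) < e \<Longrightarrow> v \<in> V"
        using G(3) by (meson open_dist)
      have "?p U N \<le> measure (M N) {\<omega> \<in> space (M N). \<bar>(\<integral>u. G u \<partial>Y N (X N \<omega>)) - (\<integral>u. G u \<partial>y)\<bar> \<ge> e}" if N: "N \<ge> 1" for N
      proof -
        interpret prob_space "M N" by (rule M[OF N])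
        show ?thesis
          by (intro finite_measure_mono ev[OF N, of "\<lambda>s. \<bar>(\<integral>u. G u \<partial>Y N s) - (\<integral>u. G u \<partial>y)\<bar> \<ge> e"])
             (use e(2) Y[OF N] in \<open>force simp: U dist_real_def not_le[symmetric]\<close>)
      qed
      then show "?p U \<longlonglongrightarrow> 0" by (rule mono[OF _ lim[OF G(1,2) e(1)]])
    qed
  qed simp
  have "y \<in> topspace weak_topology"
  proof -
    \<comment> \<open>The test function 0 with the whole line as open set makes all torus measures
      one subbasic set.\<close>
    have "{m \<in> torus_measures. (\<integral>u. (0 :: real) \<partial>m) \<in> UNIV} \<in> ?B"
      by (intro CollectI exI[of _ "\<lambda>_. 0"] exI[of _ UNIV]) (auto simp: torus_fun_def)
    then show ?thesis unfolding weak_topology_def topology_generated_by_topspace using y by blast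
  qed
  moreover have "\<forall>\<^sub>F N in sequentially. {\<omega> \<in> space (M N). Y N (X N \<omega>) \<notin> U} \<in> sets (M N)" for U
    using eventually_ge_at_top[of 1] by eventually_elim (rule ev)
  ultimately show ?thesis
    using main unfolding converges_in_probability_def weak_topology_def openin_topology_generated_by_iff by blast
qed

section \<open>From the entropy to convergence in probability\<close>

context pme_solution
begin

text \<open>Markov's inequality for the fluctuation \<open>?Y\<close>, whose mean absolute value
  \<open>deviation_bound\<close> controls by the entropy. The Riemann sum uses up half of the
  tolerance \<open>e\<close>.\<close>

theorem law_of_large_numbers:
  fixes \<mu> :: "nat \<Rightarrow> 'd config measure" and M :: "nat \<Rightarrow> 'w measure" and X :: "nat \<Rightarrow> real \<Rightarrow> 'w \<Rightarrow> 'd config"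
    and G :: "real ^ 'd \<Rightarrow> real"
  assumes \<mu>: "\<And>N. N \<ge> 1 \<Longrightarrow> prob_space (\<mu> N) \<and> sets (\<mu> N) = Pow (configs N)"
    and ent: "(\<lambda>N. rel_entropy (\<mu> N) (product_bernoulli N (\<rho> 0)) / ereal (real N ^ CARD('d))) \<longlonglongrightarrow> 0"
    and mp: "\<And>N. N \<ge> 1 \<Longrightarrow> markov_process (configs N) (generator N) (\<mu> N) (M N) (X N)"
    and t: "t \<ge> 0" and G: "continuous_on UNIV G" and e: "e > 0"
  shows "(\<lambda>N. measure (M N) {\<omega> \<in> space (M N).
      \<bar>(\<integral>u. G u \<partial>empirical_measure N (X N (t * (real N)\<^sup>2) \<omega>)) - (\<integral>u. G u \<partial>measure_with_density (\<rho> t))\<bar> \<ge> e}) \<longlonglongrightarrow> 0"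
proof (rule tendstoI)
  fix z :: real assume z: "z > 0"
  obtain B where B: "B > 0" "\<And>u. u \<in> cbox 0 (\<chi> i. 1) \<Longrightarrow> \<bar>G u\<bar> \<le> B" using cont_bounded_cube[OF G] by blast
  have rt: "continuous_on UNIV (\<rho> t)"
  proof -
    have "continuous_on UNIV (\<lambda>u. case (t, u) of (t, u) \<Rightarrow> \<rho> t u)"
      by (rule continuous_on_compose2[OF cont_rho]) (use t in \<open>auto intro!: continuous_intros\<close>)
    then show ?thesis by simp
  qed
  have r0: "0 \<le> \<rho> t u" for u using rho_pos[OF t, of u] by simp
  define I where "I = (\<integral>u. G u \<partial>measure_with_density (\<rho> t))"
  have I: "I = (\<integral>u. \<rho> t u * G u \<partial>cube_measure)"
    unfolding I_def by (rule density_integral(2)[OF G rt r0])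
  have "(\<lambda>N. (\<Sum>x\<in>sites N. \<rho> t (embed N x) * G (embed N x)) / real (N ^ CARD('d))) \<longlonglongrightarrow> I"
    unfolding I by (rule riemann_sum) (intro continuous_intros rt G)
  then have ev1: "\<forall>\<^sub>F N in sequentially. dist ((\<Sum>x\<in>sites N. \<rho> t (embed N x) * G (embed N x)) / real (N ^ CARD('d))) I < e / 2"
    using e by (intro tendstoD) auto
  \<comment> \<open>The first bound makes the tilt admissible in \<open>deviation_bound\<close>; the
    second one limits the contribution of its quadratic term to \<open>z / 4\<close>.\<close>
  define \<gamma> where "\<gamma> = min (1 / B) (z * e / (16 * B\<^sup>2))"
  have \<gamma>: "\<gamma> > 0" using B z e by (simp add: \<gamma>_def)
  have gB: "\<gamma> * B \<le> 1" "\<gamma> * B\<^sup>2 \<le> z * e / 16"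
  proof -
    have "\<gamma> * B \<le> 1 / B * B" using B by (intro mult_right_mono) (auto simp: \<gamma>_def)
    then show "\<gamma> * B \<le> 1" using B by simp
    have "\<gamma> * B\<^sup>2 \<le> z * e / (16 * B\<^sup>2) * B\<^sup>2" by (intro mult_right_mono) (auto simp: \<gamma>_def)
    then show "\<gamma> * B\<^sup>2 \<le> z * e / 16" using B by simp
  qed
  \<comment> \<open>The entropy and \<open>ln 2\<close> are both bounded by \<open>k\<close> times
    the volume; together they contribute another \<open>z / 4\<close>.\<close>
  define k where "k = \<gamma> * z * e / 32"
  have k: "k > 0" using \<gamma> z e by (simp add: k_def)
  have ev2: "\<forall>\<^sub>F N in sequentially. params.entropy N (rN N t) (mix N (law (M N) (X N) (t * (real N)\<^sup>2))) \<le> real (N ^ CARD('d)) * k"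
    by (rule entropy_estimate[OF \<mu> ent mp t k])
  have "(\<lambda>N. ln 2 / real N) \<longlonglongrightarrow> 0" by real_asymp
  then have ev3: "\<forall>\<^sub>F N in sequentially. ln 2 / real N < k" using k by (rule order_tendstoD)
  show "\<forall>\<^sub>F N in sequentially. dist (measure (M N) {\<omega> \<in> space (M N).
      \<bar>(\<integral>u. G u \<partial>empirical_measure N (X N (t * (real N)\<^sup>2) \<omega>)) - (\<integral>u. G u \<partial>measure_with_density (\<rho> t))\<bar> \<ge> e}) 0 < z"
    using ev1 ev2 ev3 eventually_ge_at_top[of 2]
  proof eventually_elim
    case (elim N)
    have N: "N \<ge> 1" using elim by simp
    let ?Nd = "real (N ^ CARD('d))" and ?s = "t * (real N)\<^sup>2"
    have Nd: "?Nd > 0" using N by simp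
    have s: "?s \<ge> 0" using t by simp
    interpret params N "rN N t" by (rule params_rN[OF N t])
    have M: "prob_space (M N)" and Xm: "X N ?s \<in> measurable (M N) (count_space (configs N))"
      using mp[OF N] s unfolding markov_process_def by auto
    let ?L = "law (M N) (X N) ?s"
    note lw = markov_law[OF mp[OF N] finite_configs]
    note mx = mix_props[OF N lw(1)[OF s] lw(2)[OF s]]
    let ?Y = "\<lambda>\<eta>. \<Sum>x\<in>sites N. G (embed N x) * (of_bool (\<eta> x) - rN N t x)"
    let ?bad = "\<lambda>\<eta>. \<bar>(\<integral>u. G u \<partial>empirical_measure N \<eta>) - I\<bar> \<ge> e"
    have badY: "of_bool (?bad \<eta>) \<le> 2 / (e * ?Nd) * \<bar>?Y \<eta>\<bar>" for \<eta>
    proof (cases "?bad \<eta>")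
      case True
      have "(\<integral>u. G u \<partial>empirical_measure N \<eta>) - (\<Sum>x\<in>sites N. \<rho> t (embed N x) * G (embed N x)) / ?Nd = ?Y \<eta> / ?Nd"
        unfolding empirical_integral[OF N G]
        by (simp add: right_diff_distrib sum_subtractf diff_divide_distrib mult.commute)
      then have "e / 2 \<le> \<bar>?Y \<eta> / ?Nd\<bar>" using True elim(1) unfolding dist_real_def by linarith
      then have "e / 2 * ?Nd \<le> \<bar>?Y \<eta>\<bar>" using Nd by (simp add: pos_le_divide_eq)
      then have "1 \<le> 2 / (e * ?Nd) * \<bar>?Y \<eta>\<bar>" using Nd e by (simp add: field_simps)
      then show ?thesis using True by simp
    next
      case False
      then show ?thesis using Nd e by simp
    qed
    have "measure (M N) {\<omega> \<in> space (M N). ?bad (X N ?s \<omega>)} = (\<integral>\<omega>. of_bool (?bad (X N ?s \<omega>)) \<partial>M N)"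
    proof -
      have "(\<integral>\<omega>. of_bool (?bad (X N ?s \<omega>)) \<partial>M N) = (\<integral>\<omega>. indicator {\<omega> \<in> space (M N). ?bad (X N ?s \<omega>)} \<omega> \<partial>M N)"
        by (rule Bochner_Integration.integral_cong) (auto simp: indicator_def)
      also have "\<dots> = measure (M N) ({\<omega> \<in> space (M N). ?bad (X N ?s \<omega>)} \<inter> space (M N))"
        by (rule Bochner_Integration.integral_indicator)
      also have "{\<omega> \<in> space (M N). ?bad (X N ?s \<omega>)} \<inter> space (M N) = {\<omega> \<in> space (M N). ?bad (X N ?s \<omega>)}" by auto
      finally show ?thesis ..
    qed
    also have "\<dots> = (\<Sum>\<eta>\<in>configs N. ?L \<eta> * of_bool (?bad \<eta>))"
      unfolding law_def by (rule integral_finite_valued(2)[OF M Xm finite_configs])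
    \<comment> \<open>For \<open>N \<ge> 2\<close> the mixture gives every configuration at least
      half of its probability under the law.\<close>
    also have "\<dots> \<le> (\<Sum>\<eta>\<in>configs N. 2 * mix N ?L \<eta> * (2 / (e * ?Nd) * \<bar>?Y \<eta>\<bar>))"
    proof (rule sum_mono)
      fix \<eta> :: "'d config" assume \<eta>: "\<eta> \<in> configs N"
      have "1 / 2 \<le> 1 - 1 / real N" using elim(4) by simp
      then have "1 / 2 * ?L \<eta> \<le> (1 - 1 / real N) * ?L \<eta>" using lw(1)[OF s] by (intro mult_right_mono)
      also have "\<dots> \<le> mix N ?L \<eta>" by (rule mx(3)[OF \<eta>])
      finally have "?L \<eta> \<le> 2 * mix N ?L \<eta>" by simp
      then show "?L \<eta> * of_bool (?bad \<eta>) \<le> 2 * mix N ?L \<eta> * (2 / (e * ?Nd) * \<bar>?Y \<eta>\<bar>)"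
        using badY[of \<eta>] mx(1)[OF \<eta>] by (intro mult_mono) auto
    qed
    also have "\<dots> = 4 / (e * ?Nd) * (\<Sum>\<eta>\<in>configs N. mix N ?L \<eta> * \<bar>?Y \<eta>\<bar>)"
      by (simp add: sum_distrib_left mult_ac)
    also have "\<dots> \<le> 4 / (e * ?Nd) * ((entropy (mix N ?L) + ln 2) / \<gamma> + \<gamma> * B\<^sup>2 * ?Nd)"
      using e Nd embed_in_cube[OF N] B(2) by (intro mult_left_mono deviation_bound mx(1,2) \<gamma> gB(1)) auto
    also have "\<dots> \<le> 4 / (e * ?Nd) * ((?Nd * k + ?Nd * k) / \<gamma> + z * e / 16 * ?Nd)"
    proof (intro mult_left_mono add_mono divide_right_mono mult_right_mono gB(2))
      have "real N \<le> ?Nd" using N by (simp add: self_le_power)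
      then have "ln 2 / ?Nd \<le> ln 2 / real N" using N by (intro divide_left_mono) auto
      then have "ln 2 / ?Nd \<le> k" using elim(3) by simp
      then show "ln 2 \<le> ?Nd * k" using Nd by (simp add: pos_divide_le_eq mult.commute)
    qed (use elim(2) e Nd \<gamma> in auto)
    also have "\<dots> = z / 2"
      using \<gamma> e Nd by (simp add: k_def field_simps)
    also have "\<dots> < z" using z by simp
    finally show ?case by (simp add: I_def)
  qed
qed

end

theorem theorem2p1:
  fixes \<epsilon> \<delta>\<^sub>0 :: real
    and \<rho>\<^sub>0 :: "real ^ 'd \<Rightarrow> real"
    and \<rho> :: "real \<Rightarrow> real ^ 'd \<Rightarrow> real"
    and \<mu> :: "nat \<Rightarrow> 'd config measure"
    and M :: "nat \<Rightarrow> 'w measure"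
    and \<eta> :: "nat \<Rightarrow> real \<Rightarrow> 'w \<Rightarrow> 'd config"
  assumes "\<epsilon> > 0"
    and "\<And>u. \<rho>\<^sub>0 u \<in> {0..1}"
    and "holder_torus (2 + \<epsilon>) \<rho>\<^sub>0"
    and "\<delta>\<^sub>0 > 0"
    and "\<And>u. \<delta>\<^sub>0 \<le> \<rho>\<^sub>0 u \<and> \<rho>\<^sub>0 u \<le> 1 - \<delta>\<^sub>0"
    and "\<And>N. N \<ge> 1 \<Longrightarrow> prob_space (\<mu> N) \<and> sets (\<mu> N) = Pow (configs N)"
    and "(\<lambda>N. rel_entropy (\<mu> N) (product_bernoulli N \<rho>\<^sub>0) / ereal (real N ^ CARD('d)))
           \<longlonglongrightarrow> 0"
    and "\<And>N. N \<ge> 1 \<Longrightarrow> markov_process (configs N) (generator N) (\<mu> N) (M N) (\<eta> N)"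
    and "smooth_pme_solution \<epsilon> \<rho>\<^sub>0 \<rho>"
  shows "\<forall>t\<ge>0. converges_in_probability weak_topology M
           (\<lambda>N \<omega>. empirical_measure N (\<eta> N (t * (real N)\<^sup>2) \<omega>))
           (measure_with_density (\<rho> t))"
proof (intro allI impI)
  fix t :: real assume t: "t \<ge> 0"
  obtain g H h where "pme_solution \<rho> g H h \<delta>\<^sub>0"
    using pme_solution_exists[OF assms(1,9,4,5)] by blast
  then interpret pme_solution \<rho> g H h \<delta>\<^sub>0 .
  have \<rho>0: "\<rho> 0 = \<rho>\<^sub>0" using assms(9) by (simp add: smooth_pme_solution_def)
  have rt: "continuous_on UNIV (\<rho> t)"
  proof -
    have "continuous_on UNIV (\<lambda>u. case (t, u) of (t, u) \<Rightarrow> \<rho> t u)"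
      by (rule continuous_on_compose2[OF cont_rho]) (use t in \<open>auto intro!: continuous_intros\<close>)
    then show ?thesis by simp
  qed
  show "converges_in_probability weak_topology M
           (\<lambda>N \<omega>. empirical_measure N (\<eta> N (t * (real N)\<^sup>2) \<omega>)) (measure_with_density (\<rho> t))"
  proof (rule converges_in_probabilityI[where S = configs])
    show "prob_space (M N)" "\<eta> N (t * (real N)\<^sup>2) \<in> measurable (M N) (count_space (configs N))" if "N \<ge> 1" for N
      using assms(8)[OF that] t unfolding markov_process_def by auto
    show "measure_with_density (\<rho> t) \<in> torus_measures"
      by (rule density_integral(1)[OF rt rt]) (use rho_pos[OF t] in \<open>auto intro: less_imp_le\<close>)
    show "(\<lambda>N. measure (M N) {\<omega> \<in> space (M N). e \<le> \<bar>(\<integral>u. G u \<partial>empirical_measure N (\<eta> N (t * (real N)\<^sup>2) \<omega>)) - (\<integral>u. G u \<partial>measure_with_density (\<rho> t))\<bar>}) \<longlonglongrightarrow> 0"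
      if "continuous_on UNIV G" "torus_fun G" "e > 0" for G and e :: real
      by (rule law_of_large_numbers[OF assms(6) _ assms(8) t that(1,3)]) (use assms(7) \<rho>0 in auto)
  qed (rule empirical_torus)
qed

end
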